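(* Let $\Gamma$ be a compact (not necessarily connected) quantum graph and let the graph $\Gamma'$ be obtained from $\Gamma$ by $k$ identifications of vertices endowed with $\delta$-type conditions, for example by gluing vertices $v_0,v_1,\ldots,v_k$ into one, or by pairwise gluing of $k$ pairs of vertices. Each identification results also in adding the parameters of the $\delta$-type conditions at the identified vertices (gluing two vertices with $\delta$-type conditions with parameters $\alpha_0$ and $\alpha_1$ gives a vertex with the $\delta$-type condition with parameter $\alpha_0+\alpha_1$). Arbitrary self-adjoint conditions are allowed at all other vertices and remain unchanged. Then for every $n\ge1$ $$\lambda_n(\Gamma)\le\lambda_n(\Gamma')\le\lambda_{n+k}(\Gamma).$$
   Context: A compact quantum graph is a metric graph with finitely many vertices and edges, each edge $e$ being a segment of finite positive length, equipped with the operator $\mathcal{H}$ acting as $-d^2/dx^2+V(x)$ on each edge, where $V\in L_2(\Gamma)$ is real-valued, on functions that belong to $H^2(e)$ on each edge $e$ and satisfy local self-adjoint vertex conditions. Self-adjoint conditions at a vertex $w$ of degree $d_w$ are conditions $A_wF(w)+B_wF'(w)=0$, where $F(w)$ and $F'(w)$ are the column vectors of values and of derivatives of $f$ at $w$ along the incident edges, $A_w,B_w$ are $d_w\times d_w$ complex matrices, $(A_w\ B_w)$ has rank $d_w$ and $A_wB_w^*$ is self-adjoint. The eigenvalues $\lambda_n(\Gamma)$, $n\ge1$, of $\mathcal{H}$ are labeled in non-decreasing order, counting multiplicity. $\mathcal{E}_v$ is the set of edges (edge-ends) incident to $v$; derivatives $\frac{df}{dx_e}(v)$ are taken away from the vertex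 and into the edge. The $\delta$-type condition at $v$ with parameter $\alpha\in\mathbb{R}$ is: $f$ is continuous at $v$ and $\sum_{e\in\mathcal{E}_v}\frac{df}{dx_e}(v)=\alpha f(v)$. One identification is the gluing of two distinct vertices $v_0,v_1$ into a single vertex $v$ with $\mathcal{E}_v=\mathcal{E}_{v_0}\cup\mathcal{E}_{v_1}$; $k$ identifications are $k$ such gluings performed successively. *)

theory Defs
  imports
    "HOL-Analysis.Analysis"
    "HOL-Library.Function_Algebras"
    "Jordan_Normal_Form.DL_Rank"
    "Jordan_Normal_Form.Schur_Decomposition"
begin

section \<open>Metric graphs with vertex conditions\<close>

text \<open>
  The edge \<open>e\<close> is the segment \<open>{0..len \<Gamma> e}\<close>.  Its two edge-ends are \<open>(e, False)\<close>, at \<open>0\<close>, and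
  \<open>(e, True)\<close>, at \<open>len \<Gamma> e\<close>.  A vertex \<open>w\<close> is described by the list \<open>ends \<Gamma> w\<close> of the edge-ends
  incident to it, so a loop contributes twice to the degree and parallel edges are allowed.
  The order of the list is the order of the entries of the columns \<open>F(w)\<close>, \<open>F'(w)\<close>, and
  \<open>cA \<Gamma> w\<close>, \<open>cB \<Gamma> w\<close> are the matrices of the condition \<open>A F(w) + B F'(w) = 0\<close>.
\<close>

record ('e, 'v) qgraph =
  edges :: "'e set"
  len :: "'e \<Rightarrow> real"
  pot :: "'e \<Rightarrow> real \<Rightarrow> real"
  verts :: "'v set"
  ends :: "'v \<Rightarrow> ('e \<times> bool) list"
  cA :: "'v \<Rightarrow> complex mat"
  cB :: "'v \<Rightarrow> complex mat"

definition vdegree :: "('e, 'v) qgraph \<Rightarrow> 'v \<Rightarrow> nat" where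
  "vdegree \<Gamma> w = length (ends \<Gamma> w)"

definition hcat :: "complex mat \<Rightarrow> complex mat \<Rightarrow> complex mat" where
  "hcat A B = four_block_mat A B (0\<^sub>m 0 (dim_col A)) (0\<^sub>m 0 (dim_col B))"

definition self_adjoint_condition :: "nat \<Rightarrow> complex mat \<Rightarrow> complex mat \<Rightarrow> bool" where
  "self_adjoint_condition d A B \<longleftrightarrow>
     A \<in> carrier_mat d d \<and> B \<in> carrier_mat d d \<and>
     vec_space.rank d (hcat A B) = d \<and>
     mat_adjoint (A * mat_adjoint B) = A * mat_adjoint B"

definition L2_on :: "real \<Rightarrow> (real \<Rightarrow> 'a :: euclidean_space) \<Rightarrow> bool" where
  "L2_on l u \<longleftrightarrow>
     u \<in> borel_measurable (lebesgue_on {0..l}) \<and>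
     integrable (lebesgue_on {0..l}) (\<lambda>x. (norm (u x))\<^sup>2)"

text \<open>
  Every edge-end belongs to exactly one vertex and every vertex has at least one edge-end
  (functions on the graph do not see a vertex without edges).
\<close>

definition quantum_graph :: "('e, 'v) qgraph \<Rightarrow> bool" where
  "quantum_graph \<Gamma> \<longleftrightarrow>
     finite (edges \<Gamma>) \<and> edges \<Gamma> \<noteq> {} \<and> finite (verts \<Gamma>) \<and>
     (\<forall>e\<in>edges \<Gamma>. 0 < len \<Gamma> e \<and> L2_on (len \<Gamma> e) (pot \<Gamma> e)) \<and>
     (\<forall>w\<in>verts \<Gamma>. ends \<Gamma> w \<noteq> [] \<and> distinct (ends \<Gamma> w)) \<and>
     (\<Union>w\<in>verts \<Gamma>. set (ends \<Gamma> w)) = edges \<Gamma> \<times> UNIV \<and>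
     (\<forall>w\<in>verts \<Gamma>. \<forall>w'\<in>verts \<Gamma>. w \<noteq> w' \<longrightarrow> set (ends \<Gamma> w) \<inter> set (ends \<Gamma> w') = {}) \<and>
     (\<forall>w\<in>verts \<Gamma>. self_adjoint_condition (vdegree \<Gamma> w) (cA \<Gamma> w) (cB \<Gamma> w))"


section \<open>The operator and its eigenvalues\<close>

text \<open>
  \<open>weak_deriv_on l u u'\<close>: \<open>u \<in> H\<^sup>1(0, l)\<close> with weak derivative \<open>u' \<in> L\<^sub>2(0, l)\<close>, where \<open>u\<close> is the
  (absolutely) continuous representative of its class on \<open>{0..l}\<close>.
\<close>

definition weak_deriv_on :: "real \<Rightarrow> (real \<Rightarrow> complex) \<Rightarrow> (real \<Rightarrow> complex) \<Rightarrow> bool" where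
  "weak_deriv_on l u u' \<longleftrightarrow>
     L2_on l u' \<and> (\<forall>x\<in>{0..l}. u x = u 0 + integral\<^sup>L (lebesgue_on {0..x}) u')"

text \<open>
  In \<open>weak_deriv2_on\<close> the intermediate \<open>u'\<close> is itself a continuous representative, so \<open>u\<close> is the
  \<open>C\<^sup>1\<close> representative of an element of \<open>H\<^sup>2(0, l)\<close> and the one-sided derivatives of \<open>u\<close> at \<open>0\<close> and
  \<open>l\<close> exist classically.
\<close>

definition weak_deriv2_on :: "real \<Rightarrow> (real \<Rightarrow> complex) \<Rightarrow> (real \<Rightarrow> complex) \<Rightarrow> bool" where
  "weak_deriv2_on l u u'' \<longleftrightarrow> (\<exists>u'. weak_deriv_on l u u' \<and> weak_deriv_on l u' u'')"

definition H2_on :: "real \<Rightarrow> (real \<Rightarrow> complex) \<Rightarrow> bool" where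
  "H2_on l u \<longleftrightarrow> (\<exists>u''. weak_deriv2_on l u u'')"

fun end_value :: "('e, 'v) qgraph \<Rightarrow> ('e \<Rightarrow> real \<Rightarrow> complex) \<Rightarrow> 'e \<times> bool \<Rightarrow> complex" where
  "end_value \<Gamma> f (e, False) = f e 0"
| "end_value \<Gamma> f (e, True) = f e (len \<Gamma> e)"

fun end_deriv :: "('e, 'v) qgraph \<Rightarrow> ('e \<Rightarrow> real \<Rightarrow> complex) \<Rightarrow> 'e \<times> bool \<Rightarrow> complex" where
  "end_deriv \<Gamma> f (e, False) = vector_derivative (f e) (at 0 within {0..len \<Gamma> e})"
| "end_deriv \<Gamma> f (e, True) = - vector_derivative (f e) (at (len \<Gamma> e) within {0..len \<Gamma> e})"

definition vertex_values :: "('e, 'v) qgraph \<Rightarrow> ('e \<Rightarrow> real \<Rightarrow> complex) \<Rightarrow> 'v \<Rightarrow> complex vec" where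
  "vertex_values \<Gamma> f w = vec_of_list (map (end_value \<Gamma> f) (ends \<Gamma> w))"

definition vertex_derivs :: "('e, 'v) qgraph \<Rightarrow> ('e \<Rightarrow> real \<Rightarrow> complex) \<Rightarrow> 'v \<Rightarrow> complex vec" where
  "vertex_derivs \<Gamma> f w = vec_of_list (map (end_deriv \<Gamma> f) (ends \<Gamma> w))"

definition satisfies_condition :: "nat \<Rightarrow> complex mat \<Rightarrow> complex mat \<Rightarrow> complex vec \<Rightarrow> complex vec \<Rightarrow> bool" where
  "satisfies_condition d A B F F' \<longleftrightarrow> A *\<^sub>v F + B *\<^sub>v F' = 0\<^sub>v d"

text \<open>
  Functions on the graph are extended by \<open>0\<close> outside the edges, so that distinct elements of the
  type are distinct functions on the graph and dimensions are counted correctly.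
\<close>

definition op_domain :: "('e, 'v) qgraph \<Rightarrow> ('e \<Rightarrow> real \<Rightarrow> complex) set" where
  "op_domain \<Gamma> = {f.
     (\<forall>e x. \<not> (e \<in> edges \<Gamma> \<and> x \<in> {0..len \<Gamma> e}) \<longrightarrow> f e x = 0) \<and>
     (\<forall>e\<in>edges \<Gamma>. H2_on (len \<Gamma> e) (f e)) \<and>
     (\<forall>w\<in>verts \<Gamma>. satisfies_condition (vdegree \<Gamma> w) (cA \<Gamma> w) (cB \<Gamma> w)
        (vertex_values \<Gamma> f w) (vertex_derivs \<Gamma> f w))}"

text \<open>\<open>op_maps \<Gamma> f h\<close>: \<open>f\<close> is in the domain and \<open>h\<close> represents \<open>- f'' + V f\<close> in \<open>L\<^sub>2\<close>.\<close>

definition op_maps :: "('e, 'v) qgraph \<Rightarrow> ('e \<Rightarrow> real \<Rightarrow> complex) \<Rightarrow> ('e \<Rightarrow> real \<Rightarrow> complex) \<Rightarrow> bool" where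
  "op_maps \<Gamma> f h \<longleftrightarrow> f \<in> op_domain \<Gamma> \<and>
     (\<forall>e\<in>edges \<Gamma>. \<exists>u''. weak_deriv2_on (len \<Gamma> e) (f e) u'' \<and>
        (AE x in lebesgue_on {0..len \<Gamma> e}. h e x = - u'' x + of_real (pot \<Gamma> e x) * f e x))"

definition fscale :: "complex \<Rightarrow> ('e \<Rightarrow> real \<Rightarrow> complex) \<Rightarrow> ('e \<Rightarrow> real \<Rightarrow> complex)" where
  "fscale c f = (\<lambda>e x. c * f e x)"

global_interpretation fun_space: vector_space "fscale :: complex \<Rightarrow> ('e \<Rightarrow> real \<Rightarrow> complex) \<Rightarrow> _"
  by unfold_locales (auto simp: fscale_def fun_eq_iff algebra_simps)

definition eigenspace :: "('e, 'v) qgraph \<Rightarrow> real \<Rightarrow> ('e \<Rightarrow> real \<Rightarrow> complex) set" where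
  "eigenspace \<Gamma> \<mu> = {f. op_maps \<Gamma> f (fscale (of_real \<mu>) f)}"

text \<open>
  Multiplicities are finite: the equation \<open>- f'' + V f = \<mu> f\<close> has a solution space of dimension two on
  each edge.  A number that is not an eigenvalue has multiplicity \<open>0\<close>.
\<close>

definition eig_multiplicity :: "('e, 'v) qgraph \<Rightarrow> real \<Rightarrow> nat" where
  "eig_multiplicity \<Gamma> \<mu> = fun_space.dim (eigenspace \<Gamma> \<mu>)"

definition eigenvalue_labeling :: "('e, 'v) qgraph \<Rightarrow> (nat \<Rightarrow> real) \<Rightarrow> bool" where
  "eigenvalue_labeling \<Gamma> s \<longleftrightarrow>
     mono_on {1..} s \<and>
     (\<forall>\<mu>. finite {n. 1 \<le> n \<and> s n = \<mu>} \<and> card {n. 1 \<le> n \<and> s n = \<mu>} = eig_multiplicity \<Gamma> \<mu>)"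

text \<open>
  A labeling is determined by the graph on the indices \<open>n \<ge> 1\<close>; the value at \<open>0\<close> is irrelevant.
\<close>

definition eigval :: "('e, 'v) qgraph \<Rightarrow> nat \<Rightarrow> real" where
  "eigval \<Gamma> = (SOME s. eigenvalue_labeling \<Gamma> s)"


section \<open>Gluing of vertices with delta-type conditions\<close>

text \<open>
  The matrices at \<open>v\<close> encode the delta-type condition with parameter \<open>\<alpha>\<close>: the condition
  \<open>A F + B F' = 0\<close> says that all entries of \<open>F\<close> have a common value \<open>c = f(v)\<close> and the entries of
  \<open>F'\<close> sum to \<open>\<alpha> c\<close>.
\<close>

definition delta_type :: "('e, 'v) qgraph \<Rightarrow> 'v \<Rightarrow> real \<Rightarrow> bool" where
  "delta_type \<Gamma> v \<alpha> \<longleftrightarrow>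
     (let d = vdegree \<Gamma> v in
      \<forall>F\<in>carrier_vec d. \<forall>F'\<in>carrier_vec d.
        satisfies_condition d (cA \<Gamma> v) (cB \<Gamma> v) F F' \<longleftrightarrow>
        (\<exists>c. (\<forall>i<d. F $ i = c) \<and> (\<Sum>i<d. F' $ i) = of_real \<alpha> * c))"

text \<open>
  \<open>\<Gamma>'\<close> arises from \<open>\<Gamma>\<close> by gluing \<open>v0\<close> and \<open>v1\<close>.  The name \<open>v\<close> of the new vertex may be \<open>v0\<close>,
  \<open>v1\<close> or a fresh one.
\<close>

definition glued :: "('e, 'v) qgraph \<Rightarrow> ('e, 'v) qgraph \<Rightarrow> bool" where
  "glued \<Gamma> \<Gamma>' \<longleftrightarrow> quantum_graph \<Gamma> \<and> quantum_graph \<Gamma>' \<and>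
     edges \<Gamma>' = edges \<Gamma> \<and> len \<Gamma>' = len \<Gamma> \<and> pot \<Gamma>' = pot \<Gamma> \<and>
     (\<exists>v0 v1 v \<alpha>0 \<alpha>1.
        v0 \<in> verts \<Gamma> \<and> v1 \<in> verts \<Gamma> \<and> v0 \<noteq> v1 \<and>
        delta_type \<Gamma> v0 \<alpha>0 \<and> delta_type \<Gamma> v1 \<alpha>1 \<and>
        v \<notin> verts \<Gamma> - {v0, v1} \<and>
        verts \<Gamma>' = insert v (verts \<Gamma> - {v0, v1}) \<and>
        set (ends \<Gamma>' v) = set (ends \<Gamma> v0) \<union> set (ends \<Gamma> v1) \<and>
        delta_type \<Gamma>' v (\<alpha>0 + \<alpha>1) \<and>
        (\<forall>w \<in> verts \<Gamma> - {v0, v1}.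
           ends \<Gamma>' w = ends \<Gamma> w \<and> cA \<Gamma>' w = cA \<Gamma> w \<and> cB \<Gamma>' w = cB \<Gamma> w))"

end

theory Submission
  imports Defs "HOL-Complex_Analysis.Great_Picard"
begin

text \<open>
  The eigenvalues are described variationally.  A self-adjoint condition \<open>A F + B F' = 0\<close> is the same as
  \<open>F = B\<^sup>* y\<close>, \<open>F' = - A\<^sup>* y\<close> for some \<open>y\<close>, so it amounts to a subspace \<open>X\<close> of boundary values together with a
  Hermitian form \<open>b(F, G) = \<langle>F', G\<rangle>\<close> on \<open>X\<close>.  The operator then belongs to the form
  \<open>h(f, g) = \<Sum>\<^sub>e \<integral> f' g' + V f g + b(f, g)\<close> on the \<open>H\<^sup>1\<close> functions with boundary values in \<open>X\<close>, which is
  bounded below and compactly embedded in \<open>L\<^sub>2\<close>.  Minimizing \<open>h\<close> successively on orthogonal complements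
  yields all eigenvalues, and du Bois-Reymond's lemma turns weak eigenvectors into elements of the domain.

  Gluing \<open>v\<^sub>0\<close> and \<open>v\<^sub>1\<close> restricts the form domain by the single equation \<open>f(v\<^sub>0) = f(v\<^sub>1)\<close>, and the form
  itself does not change, because a \<open>\<delta>\<close>-type condition contributes \<open>\<alpha> |f(v)|\<^sup>2\<close> and the parameters are added.
  The min-max principle gives \<open>\<lambda>\<^sub>n(\<Gamma>) \<le> \<lambda>\<^sub>n(\<Gamma>') \<le> \<lambda>\<^sub>n\<^sub>+\<^sub>1(\<Gamma>)\<close>, and \<open>k\<close> gluings are \<open>k\<close> such steps.
\<close>

section \<open>Spectral theory of semibounded forms with compact embedding\<close>

text \<open>\<open>eigval\<close> is chosen by \<open>SOME\<close> among labelings that count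
  dimensions of strong eigenspaces, so nothing can be read off it before a labeling is known to
  exist and to be unique. Hence the variational sequence has to list every eigenvalue with its exact
  multiplicity (\<open>sp_dim\<close>), and weak eigenspaces have to coincide with strong ones
  (\<open>weak_eigenvector_iff\<close>). Two obstacles shape the form. The \<open>y\<close> in
  \<open>F = B^* y\<close> need not be unique, so \<open>b\<close> is well defined only because
  \<open>A B^*\<close> is self-adjoint; a linear choice \<open>sel\<close> of \<open>F'\<close> in
  terms of \<open>F\<close> turns \<open>b\<close> into a matrix. The boundary term and the
  potential have no sign; they are absorbed by the trace inequality
  \<open>weak_deriv_on_sup\<close>, in which the derivative carries an arbitrarily small factor.
  Both halves of the interlacing are then dimension counts by
  \<open>homogeneous_system_nontrivial\<close>.\<close>

lemma homogeneous_system_nontrivial: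
  fixes c :: "'i \<Rightarrow> 'j \<Rightarrow> 'a::field"
  assumes "finite I" "finite J" "card I < card J"
  shows "\<exists>a. (\<exists>j\<in>J. a j \<noteq> 0) \<and> (\<forall>i\<in>I. (\<Sum>j\<in>J. c i j * a j) = 0)"
  using assms
proof (induction I arbitrary: J c rule: finite_induct)
  case empty
  then have "J \<noteq> {}" by auto
  then show ?case by (intro exI[of _ "\<lambda>_. 1"]) auto
next
  case (insert i I)
  show ?case
  proof (cases "\<forall>j\<in>J. c i j = 0")
    case True
    have "card I < card J" using insert by simp
    from insert.IH[OF insert.prems(1) this, of c] True show ?thesis by auto
  next
    case False
    then obtain p where p: "p \<in> J" "c i p \<noteq> 0" by auto
    let ?J = "J - {p}"
    have "card I < card ?J" using insert p by simp
    \<comment> \<open>Gaussian elimination with the pivot \<open>c i p\<close>: the reduced system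
      arises by solving equation \<open>i\<close> for the unknown \<open>p\<close>, and
      \<open>b\<close> below restores that unknown.\<close>
    from insert.IH[OF _ this, of "\<lambda>k j. c k j - c k p * c i j / c i p"] insert.prems
    obtain a where a: "\<exists>j\<in>?J. a j \<noteq> 0"
      "\<And>k. k \<in> I \<Longrightarrow> (\<Sum>j\<in>?J. (c k j - c k p * c i j / c i p) * a j) = 0" by auto
    define b where "b = a(p := - (\<Sum>j\<in>?J. c i j * a j) / c i p)"
    have split: "(\<Sum>j\<in>J. c k j * b j) = (\<Sum>j\<in>?J. c k j * a j) - c k p * (\<Sum>j\<in>?J. c i j * a j) / c i p" for k
    proof -
      have "(\<Sum>j\<in>J. c k j * b j) = c k p * b p + (\<Sum>j\<in>?J. c k j * b j)"
        using p insert.prems by (simp add: sum.remove)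
      also have "(\<Sum>j\<in>?J. c k j * b j) = (\<Sum>j\<in>?J. c k j * a j)"
        by (rule sum.cong) (auto simp: b_def)
      finally show ?thesis by (simp add: b_def)
    qed
    have "(\<Sum>j\<in>J. c k j * b j) = 0" if "k \<in> insert i I" for k
    proof (cases "k = i")
      case True
      then show ?thesis using p by (simp add: split)
    next
      case False
      then have "k \<in> I" using that by simp
      have "(\<Sum>j\<in>J. c k j * b j) = (\<Sum>j\<in>?J. c k j * a j - c k p * c i j / c i p * a j)"
        unfolding split sum_subtractf by (simp add: sum_distrib_left sum_divide_distrib mult.assoc)
      also have "\<dots> = 0" using a(2)[OF \<open>k \<in> I\<close>] by (simp add: algebra_simps)
      finally show ?thesis .
    qed
    moreover have "\<exists>j\<in>J. b j \<noteq> 0" using a(1) by (auto simp: b_def)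
    ultimately show ?thesis by blast
  qed
qed

section \<open>Hermitian and positive semidefinite forms on a subspace\<close>

locale herm_form = vector_space scale
  for scale :: "complex \<Rightarrow> 'x::ab_group_add \<Rightarrow> 'x" +
  fixes Q :: "'x set" and h :: "'x \<Rightarrow> 'x \<Rightarrow> complex"
  assumes subQ: "subspace Q"
    and add_left: "\<lbrakk>f \<in> Q; g \<in> Q; k \<in> Q\<rbrakk> \<Longrightarrow> h (f + g) k = h f k + h g k"
    and scale_left: "\<lbrakk>f \<in> Q; g \<in> Q\<rbrakk> \<Longrightarrow> h (scale c f) g = c * h f g"
    and herm: "\<lbrakk>f \<in> Q; g \<in> Q\<rbrakk> \<Longrightarrow> h g f = cnj (h f g)"
begin

definition qf :: "'x \<Rightarrow> real" where "qf f = Re (h f f)"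

lemmas Q_add = subspace_add[OF subQ] and Q_scale = subspace_scale[OF subQ]
  and Q_diff = subspace_diff[OF subQ] and Q_zero = subspace_0[OF subQ] and Q_sum = subspace_sum[OF subQ]

lemma add_right: "\<lbrakk>f \<in> Q; g \<in> Q; k \<in> Q\<rbrakk> \<Longrightarrow> h f (g + k) = h f g + h f k"
  using herm[of "g + k" f] add_left[of g k f] herm[of g f] herm[of k f] Q_add by simp

lemma scale_right: "\<lbrakk>f \<in> Q; g \<in> Q\<rbrakk> \<Longrightarrow> h f (scale c g) = cnj c * h f g"
  using herm[of "scale c g" f] scale_left[of g f c] herm[of g f] Q_scale by simp

lemma zero_left: "g \<in> Q \<Longrightarrow> h 0 g = 0"
  using scale_left[of 0 g 0] Q_zero by simp

lemma diff_left: "\<lbrakk>f \<in> Q; g \<in> Q; k \<in> Q\<rbrakk> \<Longrightarrow> h (f - g) k = h f k - h g k"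
  using add_left[of "f - g" g k] Q_diff by simp

lemma diff_right: "\<lbrakk>f \<in> Q; g \<in> Q; k \<in> Q\<rbrakk> \<Longrightarrow> h f (g - k) = h f g - h f k"
  using add_right[of f "g - k" k] Q_diff by simp

lemma sum_left: "\<lbrakk>\<And>i. i \<in> I \<Longrightarrow> F i \<in> Q; g \<in> Q\<rbrakk> \<Longrightarrow> h (\<Sum>i\<in>I. F i) g = (\<Sum>i\<in>I. h (F i) g)"
proof (induction I rule: infinite_finite_induct)
  case (insert x I)
  then show ?case using add_left[of "F x" "\<Sum>i\<in>I. F i" g] Q_sum[of I F] by simp
qed (auto simp: zero_left)

lemma diag_real: "f \<in> Q \<Longrightarrow> h f f = of_real (qf f)"
  using herm[of f f] by (simp add: complex_eq_iff qf_def)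

lemma qf_scale: "f \<in> Q \<Longrightarrow> qf (scale c f) = (cmod c)\<^sup>2 * qf f"
proof -
  assume f: "f \<in> Q"
  have "h (scale c f) (scale c f) = (c * cnj c) * h f f"
    using f Q_scale by (simp add: scale_left scale_right)
  then show ?thesis
    unfolding qf_def by (simp add: complex_mult_cnj cmod_power2 mult.commute)
qed

lemma qf_add: "\<lbrakk>f \<in> Q; g \<in> Q\<rbrakk> \<Longrightarrow> qf (f + g) = qf f + 2 * Re (h f g) + qf g"
  using herm[of f g] by (simp add: qf_def Q_add add_left add_right)

lemma qf_diff: "\<lbrakk>f \<in> Q; g \<in> Q\<rbrakk> \<Longrightarrow> qf (f - g) = qf f - 2 * Re (h f g) + qf g"
  using herm[of f g] by (simp add: qf_def Q_diff diff_left diff_right)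

lemma parallelogram: "\<lbrakk>f \<in> Q; g \<in> Q\<rbrakk> \<Longrightarrow> qf (f - g) + qf (f + g) = 2 * qf f + 2 * qf g"
  by (simp add: qf_add qf_diff)

end

locale psd_form = herm_form +
  assumes pos: "f \<in> Q \<Longrightarrow> 0 \<le> qf f"
begin

lemma cauchy_schwarz:
  assumes "f \<in> Q" "g \<in> Q"
  shows "(cmod (h f g))\<^sup>2 \<le> qf f * qf g"
proof -
  \<comment> \<open>Nonnegativity of \<open>qf\<close> at \<open>f - t * h f g * g\<close>; the
    factor \<open>h f g\<close> makes the mixed term real.\<close>
  have *: "0 \<le> qf f - 2 * t * (cmod (h f g))\<^sup>2 + t\<^sup>2 * (cmod (h f g))\<^sup>2 * qf g" for t :: real
  proof -
    define c where "c = - of_real t * h f g"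
    have "h f (scale c g) = - of_real t * of_real ((cmod (h f g))\<^sup>2)"
      using assms by (subst scale_right) (auto simp: c_def complex_norm_square mult.commute simp del: of_real_power)
    then have "Re (h f (scale c g)) = - t * (cmod (h f g))\<^sup>2" by simp
    moreover have "qf (scale c g) = t\<^sup>2 * (cmod (h f g))\<^sup>2 * qf g"
      using qf_scale[OF assms(2), of c] by (simp add: c_def norm_mult power_mult_distrib del: scale_minus_left)
    ultimately show ?thesis
      using pos[of "f + scale c g"] assms by (simp add: qf_add Q_add Q_scale)
  qed
  show ?thesis
  proof (cases "qf g = 0")
    case True
    show ?thesis
    proof (rule ccontr)
      assume "\<not> ?thesis"
      then have "0 < (cmod (h f g))\<^sup>2" using True by simp
      \<comment> \<open>For \<open>qf g = 0\<close> the expression is affine in \<open>t\<close>,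
        and this \<open>t\<close> gives it the value \<open>- qf f - 2\<close>.\<close>
      then show False using *[of "(qf f + 1) / (cmod (h f g))\<^sup>2"] True pos[OF assms(1)] by simp
    qed
  next
    case False
    then have "0 < qf g" using pos[OF assms(2)] by simp
    then show ?thesis using *[of "1 / qf g"] by (simp add: field_simps power2_eq_square)
  qed
qed

text \<open>Null vectors of a semidefinite form lie in its radical. Applied to
  \<open>h - l * ip\<close> at a minimizer, this is the Euler-Lagrange equation.\<close>

lemma null_left: "\<lbrakk>f \<in> Q; g \<in> Q; qf f = 0\<rbrakk> \<Longrightarrow> h f g = 0"
  using cauchy_schwarz[of f g] by simp

lemma qf_diff_le: "\<lbrakk>f \<in> Q; g \<in> Q\<rbrakk> \<Longrightarrow> qf (f - g) \<le> 2 * qf f + 2 * qf g"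
  using parallelogram[of f g] pos[of "f + g"] Q_add by fastforce

lemma tendsto_left:
  assumes "\<And>n. G n \<in> Q" "f \<in> Q" "g \<in> Q" "(\<lambda>n. qf (G n - f)) \<longlonglongrightarrow> 0"
  shows "(\<lambda>n. h (G n) g) \<longlonglongrightarrow> h f g"
proof -
  have "(\<lambda>n. sqrt (qf (G n - f) * qf g)) \<longlonglongrightarrow> sqrt (0 * qf g)"
    by (intro tendsto_intros assms)
  then have lim: "(\<lambda>n. sqrt (qf (G n - f) * qf g)) \<longlonglongrightarrow> 0" by simp
  have "cmod (h (G n) g - h f g) \<le> sqrt (qf (G n - f) * qf g)" for n
    using cauchy_schwarz[of "G n - f" g] assms
    by (intro real_le_rsqrt) (simp add: Q_diff diff_left)
  then have "(\<lambda>n. h (G n) g - h f g) \<longlonglongrightarrow> 0"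
    by (intro Lim_null_comparison[OF _ lim] always_eventually) blast
  then show ?thesis by (simp add: LIM_zero_iff)
qed

lemma tendsto_qf:
  assumes "\<And>n. G n \<in> Q" "f \<in> Q" "(\<lambda>n. qf (G n - f)) \<longlonglongrightarrow> 0"
  shows "(\<lambda>n. qf (G n)) \<longlonglongrightarrow> qf f"
proof -
  have "(\<lambda>n. qf (G n - f) + 2 * Re (h (G n) f) - qf f) \<longlonglongrightarrow> 0 + 2 * Re (h f f) - qf f"
    by (intro tendsto_intros assms tendsto_left)
  moreover have "qf (G n - f) + 2 * Re (h (G n) f) - qf f = qf (G n)" for n
    using assms by (simp add: qf_diff)
  ultimately show ?thesis by (simp add: qf_def)
qed

end

text \<open>Indices start at 0. Maximality of the orthonormal family is implicit in the last two
  clauses: a nonzero vector orthogonal to all \<open>\<phi> n\<close> would have a Rayleigh quotient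
  above every \<open>s n\<close>.\<close>

definition spectral_seq ::
  "'x::ab_group_add set \<Rightarrow> ('x \<Rightarrow> 'x \<Rightarrow> complex) \<Rightarrow> ('x \<Rightarrow> 'x \<Rightarrow> complex) \<Rightarrow> (nat \<Rightarrow> 'x) \<Rightarrow> (nat \<Rightarrow> real) \<Rightarrow> bool" where
  "spectral_seq Q ip h \<phi> s \<longleftrightarrow>
     (\<forall>n. \<phi> n \<in> Q) \<and> (\<forall>m n. ip (\<phi> m) (\<phi> n) = (if m = n then 1 else 0)) \<and> mono s \<and>
     (\<forall>n. \<forall>g\<in>Q. h (\<phi> n) g = s n * ip (\<phi> n) g) \<and>
     (\<forall>n. \<forall>f\<in>Q. (\<forall>i<n. ip f (\<phi> i) = 0) \<longrightarrow> s n * Re (ip f f) \<le> Re (h f f)) \<and>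
     (\<forall>K. \<exists>n. K < s n)"

abbreviation double_null :: "(nat \<Rightarrow> nat \<Rightarrow> real) \<Rightarrow> bool" where
  "double_null a \<equiv> \<forall>\<epsilon>>0. \<exists>N. \<forall>m\<ge>N. \<forall>n\<ge>N. a m n < \<epsilon>"

text \<open>Compactness yields only an \<open>ip\<close>-Cauchy subsequence, because
  \<open>Q\<close> need not be complete for \<open>ip\<close>; limits exist in the form norm, by
  \<open>complete_form\<close>. By \<open>infinite_dim\<close> the successive minimization never
  runs out of vectors.\<close>

locale form_space = ip: herm_form scale Q ip + h: herm_form scale Q h
  for scale :: "complex \<Rightarrow> 'x::ab_group_add \<Rightarrow> 'x" and Q and ip h :: "'x \<Rightarrow> 'x \<Rightarrow> complex" +
  fixes C :: real
  assumes ip_pos: "\<lbrakk>f \<in> Q; f \<noteq> 0\<rbrakk> \<Longrightarrow> 0 < ip.qf f"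
    and lower: "f \<in> Q \<Longrightarrow> - C * ip.qf f \<le> h.qf f"
    and compact_emb: "\<And>(F :: nat \<Rightarrow> 'x) K. \<lbrakk>\<And>n. F n \<in> Q; \<And>n. ip.qf (F n) = 1; \<And>n. h.qf (F n) \<le> K\<rbrakk> \<Longrightarrow>
       \<exists>r::nat \<Rightarrow> nat. strict_mono r \<and> double_null (\<lambda>m n. ip.qf (F (r m) - F (r n)))"
    and complete_form: "\<And>F. \<lbrakk>\<And>n. F n \<in> Q;
       \<And>\<epsilon>. 0 < \<epsilon> \<Longrightarrow> \<exists>N. \<forall>m\<ge>N. \<forall>n\<ge>N. ip.qf (F m - F n) < \<epsilon> \<and> h.qf (F m - F n) < \<epsilon>\<rbrakk> \<Longrightarrow>
       \<exists>f\<in>Q. (\<lambda>n. ip.qf (F n - f)) \<longlonglongrightarrow> 0 \<and> (\<lambda>n. h.qf (F n - f)) \<longlonglongrightarrow> 0"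
    and infinite_dim: "\<exists>\<psi>. (\<forall>j::nat. \<psi> j \<in> Q) \<and>
       (\<forall>n a. (\<Sum>j\<le>n. scale (a j) (\<psi> j)) = 0 \<longrightarrow> (\<forall>j\<le>n. a j = 0))"
begin

lemma ip_qf_nonneg: "f \<in> Q \<Longrightarrow> 0 \<le> ip.qf f"
  using ip_pos[of f] ip.zero_left[OF ip.Q_zero] by (cases "f = 0") (auto simp: ip.qf_def)

sublocale ip: psd_form scale Q ip
  by unfold_locales (rule ip_qf_nonneg)

section \<open>Existence of the spectral sequence\<close>

definition perp :: "'x set \<Rightarrow> 'x set" where
  "perp S = {f \<in> Q. \<forall>\<phi>\<in>S. ip f \<phi> = 0}"

lemma perp_subset: "perp S \<subseteq> Q"
  by (auto simp: perp_def)

lemma subspace_perp: "S \<subseteq> Q \<Longrightarrow> ip.subspace (perp S)"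
  by (rule ip.subspaceI)
     (auto simp: perp_def ip.Q_zero ip.Q_add ip.Q_scale ip.zero_left ip.add_left ip.scale_left subset_iff)

text \<open>Orthogonality to \<open>S\<close> imposes \<open>card S\<close> equations on the
  combinations of \<open>card S + 1\<close> independent vectors.\<close>

lemma perp_nontrivial:
  assumes "finite S" "S \<subseteq> Q"
  shows "\<exists>f\<in>perp S. f \<noteq> 0"
proof -
  obtain \<psi> where \<psi>: "\<And>j::nat. \<psi> j \<in> Q"
    "\<And>n a. (\<Sum>j\<le>n. scale (a j) (\<psi> j)) = 0 \<Longrightarrow> (\<forall>j\<le>n. a j = 0)"
    using infinite_dim by blast
  obtain a where a: "\<exists>j\<in>{..card S}. a j \<noteq> 0" "\<And>\<phi>. \<phi> \<in> S \<Longrightarrow> (\<Sum>j\<in>{..card S}. ip (\<psi> j) \<phi> * a j) = 0"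
    using homogeneous_system_nontrivial[of S "{..card S}" "\<lambda>\<phi> j. ip (\<psi> j) \<phi>"] assms by auto
  let ?f = "\<Sum>j\<le>card S. scale (a j) (\<psi> j)"
  have "?f \<noteq> 0" using a(1) \<psi>(2)[of a "card S"] by auto
  moreover have "?f \<in> Q" by (intro ip.Q_sum ip.Q_scale \<psi>)
  moreover have "ip ?f \<phi> = 0" if "\<phi> \<in> S" for \<phi>
    using a(2)[OF that] that assms \<psi>(1)
    by (subst ip.sum_left) (auto simp: ip.Q_scale ip.scale_left mult.commute)
  ultimately show ?thesis by (auto simp: perp_def)
qed

lemma normalize:
  assumes "f \<in> Q" "f \<noteq> 0"
  shows "ip.qf (scale (of_real (1 / sqrt (ip.qf f))) f) = 1"
    "h.qf (scale (of_real (1 / sqrt (ip.qf f))) f) = h.qf f / ip.qf f"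
  using ip_pos[OF assms] assms
  by (auto simp: ip.qf_scale h.qf_scale norm_divide power_divide)

text \<open>The parallelogram law applied to \<open>h - \<lambda> ip\<close>, with \<open>\<lambda>\<close> the infimum, upgrades an
  \<open>ip\<close>-convergent minimizing sequence to one that is Cauchy in the form norm.\<close>

lemma minimizer:
  assumes S: "finite S" "S \<subseteq> Q"
  shows "\<exists>f\<in>perp S. ip.qf f = 1 \<and> (\<forall>g\<in>perp S. h f g = h.qf f * ip f g) \<and>
    (\<forall>g\<in>perp S. h.qf f * ip.qf g \<le> h.qf g)"
proof -
  let ?P = "perp S"
  note subP = subspace_perp[OF S(2)]
  define A where "A = {h.qf f | f. f \<in> ?P \<and> ip.qf f = 1}"
  define l where "l = Inf A"
  have bdd: "bdd_below A"
    using lower by (intro bdd_belowI[of _ "- C"]) (fastforce simp: A_def perp_def)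
  have quot: "h.qf f / ip.qf f \<in> A" if "f \<in> ?P" "f \<noteq> 0" for f
  proof -
    have "f \<in> Q" using that perp_subset by blast
    from normalize[OF this that(2)] ip.subspace_scale[OF subP that(1)] show ?thesis
      unfolding A_def by (metis (mono_tags, lifting) mem_Collect_eq)
  qed
  then have ne: "A \<noteq> {}" using perp_nontrivial[OF S] by blast
  have l_le: "l * ip.qf g \<le> h.qf g" if "g \<in> ?P" for g
  proof (cases "g = 0")
    case True
    then show ?thesis by (simp add: ip.qf_def h.qf_def ip.zero_left h.zero_left ip.Q_zero)
  next
    case False
    have "g \<in> Q" using that perp_subset by blast
    from ip_pos[OF this False] cInf_lower[OF quot[OF that False] bdd] show ?thesis
      by (simp add: l_def field_simps)
  qed
  have "\<exists>f. f \<in> ?P \<and> ip.qf f = 1 \<and> h.qf f < l + inverse (real (Suc n))" for n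
  proof -
    have "Inf A < l + inverse (real (Suc n))" by (simp add: l_def)
    then obtain y where "y \<in> A" "y < l + inverse (real (Suc n))"
      using cInf_lessD[OF ne] by blast
    then show ?thesis by (auto simp: A_def)
  qed
  then obtain F where F: "\<And>n. F n \<in> ?P" "\<And>n. ip.qf (F n) = 1"
    "\<And>n. h.qf (F n) < l + inverse (real (Suc n))"
    by metis
  have FQ: "F n \<in> Q" for n using F(1) perp_subset by blast
  have "h.qf (F n) \<le> l + 1" for n
    using F(3)[of n] inverse_le_1_iff[of "real (Suc n)"] by simp
  from compact_emb[of F, OF FQ F(2) this]
  obtain r :: "nat \<Rightarrow> nat" where r: "strict_mono r"
    "double_null (\<lambda>m n. ip.qf (F (r m) - F (r n)))" by blast
  define G where "G = (\<lambda>n. F (r n))"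
  define q where "q = (\<lambda>f g. h f g - of_real l * ip f g)"
  interpret q: herm_form scale ?P q
  proof
    fix f g assume "f \<in> ?P" "g \<in> ?P"
    then have "f \<in> Q" "g \<in> Q" using perp_subset by auto
    from h.herm[OF this] ip.herm[OF this] show "q g f = cnj (q f g)" by (simp add: q_def)
  qed (auto simp: subP q_def h.add_left ip.add_left h.scale_left ip.scale_left algebra_simps dest!: subsetD[OF perp_subset])
  have qf_eq: "q.qf f = h.qf f - l * ip.qf f" for f
    unfolding q.qf_def h.qf_def ip.qf_def by (simp add: q_def)
  interpret q: psd_form scale ?P q
    by unfold_locales (use l_le in \<open>simp add: qf_eq\<close>)
  have GP: "G n \<in> ?P" and GQ: "G n \<in> Q" for n using F(1) FQ by (auto simp: G_def)
  have qG: "q.qf (G n) \<le> inverse (real (Suc n))" for n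
  proof -
    have "inverse (real (Suc (r n))) \<le> inverse (real (Suc n))"
      using seq_suble[OF r(1), of n] by (intro le_imp_inverse_le) auto
    then show ?thesis unfolding qf_eq G_def F(2) using F(3)[of "r n"] by linarith
  qed
  have "\<exists>N. \<forall>m\<ge>N. \<forall>n\<ge>N. ip.qf (G m - G n) < \<epsilon> \<and> h.qf (G m - G n) < \<epsilon>" if "0 < \<epsilon>" for \<epsilon>
  proof -
    \<comment> \<open>Returning from \<open>q\<close> to \<open>h\<close> costs
      \<open>\<bar>l\<bar> * ip.qf\<close>; adding 1 to \<open>\<bar>l\<bar>\<close> covers
      \<open>l = 0\<close> and also bounds \<open>ip.qf\<close> itself.\<close>
    define \<delta> where "\<delta> = \<epsilon> / (2 * (\<bar>l\<bar> + 1))"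
    have \<delta>: "0 < \<delta>" "\<delta> \<le> \<epsilon> / 2" "\<bar>l\<bar> * \<delta> \<le> \<epsilon> / 2"
      using that by (auto simp: \<delta>_def field_simps)
    obtain N1 where N1: "\<And>m n. N1 \<le> m \<Longrightarrow> N1 \<le> n \<Longrightarrow> ip.qf (G m - G n) < \<delta>"
      using r(2) \<delta>(1) unfolding G_def by blast
    \<comment> \<open>The parallelogram law gives twice the sum of two \<open>q.qf\<close> values,
      so \<epsilon>/8 for each leaves \<epsilon>/2 in total.\<close>
    have "0 < \<epsilon> / 8" using that by simp
    from reals_Archimedean[OF this] obtain N2 where N2: "inverse (real (Suc N2)) < \<epsilon> / 8" by blast
    have "h.qf (G m - G n) < \<epsilon>" "ip.qf (G m - G n) < \<epsilon>" if mn: "max N1 N2 \<le> m" "max N1 N2 \<le> n" for m n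
    proof -
      have i: "inverse (real (Suc k)) \<le> inverse (real (Suc N2))" if "max N1 N2 \<le> k" for k
        using that by (intro le_imp_inverse_le) auto
      have "q.qf (G m - G n) \<le> 2 * q.qf (G m) + 2 * q.qf (G n)"
        by (intro q.qf_diff_le GP)
      then have 1: "q.qf (G m - G n) < \<epsilon> / 2"
        using qG[of m] qG[of n] i[OF mn(1)] i[OF mn(2)] N2 by linarith
      have 2: "ip.qf (G m - G n) < \<delta>" using mn N1 by simp
      have 3: "0 \<le> ip.qf (G m - G n)" by (intro ip_qf_nonneg ip.Q_diff GQ)
      have "l * ip.qf (G m - G n) \<le> \<bar>l\<bar> * \<delta>"
        using 2 3 by (intro mult_mono) auto
      then show "h.qf (G m - G n) < \<epsilon>" using 1 \<delta>(3) unfolding qf_eq by linarith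
      show "ip.qf (G m - G n) < \<epsilon>" using 2 \<delta>(2) \<open>0 < \<epsilon>\<close> by linarith
    qed
    then show ?thesis by blast
  qed
  from complete_form[of G, OF GQ this]
  obtain f where f: "f \<in> Q" "(\<lambda>n. ip.qf (G n - f)) \<longlonglongrightarrow> 0" "(\<lambda>n. h.qf (G n - f)) \<longlonglongrightarrow> 0"
    by blast
  have "ip f \<phi> = 0" if "\<phi> \<in> S" for \<phi>
  proof -
    have "(\<lambda>n. ip (G n) \<phi>) \<longlonglongrightarrow> ip f \<phi>"
      using that S by (intro ip.tendsto_left GQ f) auto
    moreover have "ip (G n) \<phi> = 0" for n using GP[of n] that by (simp add: perp_def)
    ultimately show ?thesis by (simp add: LIMSEQ_const_iff)
  qed
  then have fP: "f \<in> ?P" using f by (simp add: perp_def)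
  have "(\<lambda>n. ip.qf (G n)) \<longlonglongrightarrow> ip.qf f" by (intro ip.tendsto_qf GQ f)
  then have f1: "ip.qf f = 1" using F(2) by (simp add: G_def LIMSEQ_const_iff)
  have "(\<lambda>n. h.qf (G n - f) - l * ip.qf (G n - f)) \<longlonglongrightarrow> 0 - l * 0"
    by (intro tendsto_intros f)
  then have "(\<lambda>n. q.qf (G n)) \<longlonglongrightarrow> q.qf f"
    by (intro q.tendsto_qf GP fP) (simp add: qf_eq)
  moreover have "(\<lambda>n. q.qf (G n)) \<longlonglongrightarrow> 0"
    using q.pos[OF GP] qG by (intro real_tendsto_sandwich[OF _ _ tendsto_const LIMSEQ_inverse_real_of_nat]) auto
  ultimately have q0: "q.qf f = 0" by (rule LIMSEQ_unique)
  then have hl: "h.qf f = l" using f1 by (simp add: qf_eq)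
  have "h f g = l * ip f g" if "g \<in> ?P" for g
    using q.null_left[OF fP that q0] by (simp add: q_def)
  then show ?thesis using fP f1 hl l_le by auto
qed

theorem spectral_seq_exists: "\<exists>\<phi> s. spectral_seq Q ip h \<phi> s"
proof -
  define R where "R = (\<lambda>(\<phi>::nat \<Rightarrow> 'x) n f. f \<in> perp (\<phi> ` {..<n}) \<and> ip.qf f = 1 \<and>
    (\<forall>g\<in>perp (\<phi> ` {..<n}). h f g = h.qf f * ip f g) \<and>
    (\<forall>g\<in>perp (\<phi> ` {..<n}). h.qf f * ip.qf g \<le> h.qf g))"
  have "\<exists>\<phi>. \<forall>n. R \<phi> n (\<phi> n)"
  proof (rule dependent_wellorder_choice)
    show "R f n x = R g n x" if "\<And>y. y < n \<Longrightarrow> f y = g y" for f g n x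
    proof -
      have "f ` {..<n} = g ` {..<n}" using that by (intro image_cong) auto
      then show ?thesis by (simp add: R_def)
    qed
    show "\<exists>x. R f n x" if "\<And>y. y < n \<Longrightarrow> R f y (f y)" for f n
    proof -
      have "f ` {..<n} \<subseteq> Q" using that perp_subset unfolding R_def by blast
      from minimizer[OF _ this] show ?thesis by (auto simp: R_def)
    qed
  qed
  then obtain \<phi> where \<phi>: "\<And>n. R \<phi> n (\<phi> n)" by blast
  define s where "s = (\<lambda>n. h.qf (\<phi> n))"
  let ?P = "\<lambda>n. perp (\<phi> ` {..<n})"
  have P: "\<phi> n \<in> ?P n" and one: "ip.qf (\<phi> n) = 1"
    and eq: "\<And>g. g \<in> ?P n \<Longrightarrow> h (\<phi> n) g = s n * ip (\<phi> n) g"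
    and le: "\<And>g. g \<in> ?P n \<Longrightarrow> s n * ip.qf g \<le> h.qf g" for n
    using \<phi>[of n] by (auto simp: R_def s_def)
  have Q: "\<phi> n \<in> Q" for n using P perp_subset by blast
  have lt: "ip (\<phi> m) (\<phi> n) = 0" if "n < m" for m n
    using P[of m] that by (auto simp: perp_def)
  have on: "ip (\<phi> m) (\<phi> n) = (if m = n then 1 else 0)" for m n
    using lt[of n m] lt[of m n] ip.herm[OF Q Q, of m n] one[of n] ip.diag_real[OF Q, of n]
    by (cases m n rule: linorder_cases) auto
  have mono: "mono s"
  proof (rule monoI)
    fix m n :: nat assume "m \<le> n"
    then have "\<phi> n \<in> ?P m" using P[of n] by (auto simp: perp_def)
    from le[OF this] one show "s m \<le> s n" by (simp add: s_def)
  qed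
  \<comment> \<open>A minimizer satisfies its equation only against \<open>perp\<close>. Subtracting
    from \<open>g\<close> the projection \<open>p\<close> onto the predecessors reduces to that
    case, since \<open>h (\<phi> i) (\<phi> n) = 0\<close> for \<open>i < n\<close> by
    induction.\<close>
  have weak: "h (\<phi> n) g = s n * ip (\<phi> n) g" if "g \<in> Q" for n g
    using that
  proof (induction n arbitrary: g rule: less_induct)
    case (less n)
    define p where "p = (\<Sum>i<n. scale (ip g (\<phi> i)) (\<phi> i))"
    have pQ: "p \<in> Q" unfolding p_def by (intro ip.Q_sum ip.Q_scale Q)
    have "ip p (\<phi> j) = ip g (\<phi> j)" if "j < n" for j
      using that unfolding p_def
      by (subst ip.sum_left) (auto simp: Q ip.Q_scale ip.scale_left on if_distrib[of "\<lambda>x. _ * x"] cong: if_cong)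
    then have gp: "g - p \<in> ?P n"
      using less.prems pQ by (auto simp: perp_def ip.Q_diff ip.diff_left Q)
    have "h p (\<phi> n) = 0"
      unfolding p_def
      by (subst h.sum_left) (auto simp: Q h.Q_scale h.scale_left less.IH on)
    then have hp: "h (\<phi> n) p = 0" using h.herm[OF pQ Q, of n] by simp
    have "ip p (\<phi> n) = 0"
      unfolding p_def by (subst ip.sum_left) (auto simp: Q ip.Q_scale ip.scale_left on)
    then have ipp: "ip (\<phi> n) p = 0" using ip.herm[OF pQ Q, of n] by simp
    show ?case
      using eq[OF gp] less.prems pQ Q hp ipp by (simp add: h.diff_right ip.diff_right)
  qed
  \<comment> \<open>If \<open>s\<close> were bounded, compactness would extract a Cauchy subsequence
    from an orthonormal family, whose members have squared distance 2.\<close>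
  have unb: "\<exists>n. K < s n" for K
  proof (rule ccontr)
    assume "\<nexists>n. K < s n"
    then have "h.qf (\<phi> n) \<le> K" for n by (simp add: s_def not_less)
    from compact_emb[of \<phi>, OF Q one this]
    obtain r :: "nat \<Rightarrow> nat" where r: "strict_mono r"
      "double_null (\<lambda>m n. ip.qf (\<phi> (r m) - \<phi> (r n)))" by blast
    have "(0::real) < 1" by simp
    from r(2)[rule_format, OF this]
    obtain N where N: "\<forall>m\<ge>N. \<forall>n\<ge>N. ip.qf (\<phi> (r m) - \<phi> (r n)) < 1" by blast
    have "r N \<noteq> r (Suc N)" using r(1) by (simp add: strict_mono_eq)
    then have "ip.qf (\<phi> (r N) - \<phi> (r (Suc N))) = 2"
      by (simp add: ip.qf_diff Q one on)
    moreover have "ip.qf (\<phi> (r N) - \<phi> (r (Suc N))) < 1" using N by (meson le_SucI order_refl)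
    ultimately show False by simp
  qed
  have "s n * Re (ip f f) \<le> Re (h f f)" if "f \<in> Q" "\<forall>i<n. ip f (\<phi> i) = 0" for n f
    using le[of f n] that by (auto simp: perp_def ip.qf_def h.qf_def)
  then have "spectral_seq Q ip h \<phi> s"
    unfolding spectral_seq_def using Q on mono weak unb by blast
  then show ?thesis by blast
qed

section \<open>Rayleigh quotients and multiplicities along a spectral sequence\<close>

context
  fixes \<phi> s assumes sp: "spectral_seq Q ip h \<phi> s"
begin

lemma spQ: "\<phi> n \<in> Q" and sp_on: "ip (\<phi> m) (\<phi> n) = (if m = n then 1 else 0)" and sp_mono: "mono s"
  and sp_weak: "g \<in> Q \<Longrightarrow> h (\<phi> n) g = s n * ip (\<phi> n) g"
  and sp_ge: "\<lbrakk>f \<in> Q; \<And>i. i < n \<Longrightarrow> ip f (\<phi> i) = 0\<rbrakk> \<Longrightarrow> s n * ip.qf f \<le> h.qf f"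
  and sp_unb: "\<exists>n. K < s n"
  using sp unfolding spectral_seq_def ip.qf_def h.qf_def by blast+

lemma sp_span_eqs:
  fixes a :: "nat \<Rightarrow> complex"
  assumes "finite J"
  defines "f \<equiv> \<Sum>j\<in>J. scale (a j) (\<phi> j)"
  shows "f \<in> Q" "i \<in> J \<Longrightarrow> ip f (\<phi> i) = a i" "ip.qf f = (\<Sum>j\<in>J. (cmod (a j))\<^sup>2)"
    "h.qf f = (\<Sum>j\<in>J. s j * (cmod (a j))\<^sup>2)"
proof -
  show fQ: "f \<in> Q" unfolding f_def by (intro ip.Q_sum ip.Q_scale spQ)
  have co: "ip f (\<phi> i) = a i" if "i \<in> J" for i
    unfolding f_def using that assms(1)
    by (subst ip.sum_left) (auto simp: spQ ip.Q_scale ip.scale_left sp_on if_distrib[of "\<lambda>x. _ * x"] cong: if_cong)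
  show "i \<in> J \<Longrightarrow> ip f (\<phi> i) = a i" by (rule co)
  have co': "ip (\<phi> i) f = cnj (a i)" if "i \<in> J" for i
    using co[OF that] ip.herm[OF fQ spQ, of i] by simp
  have "ip f f = (\<Sum>j\<in>J. a j * ip (\<phi> j) f)"
    by (subst (1) f_def, subst ip.sum_left) (auto simp: spQ fQ ip.Q_scale ip.scale_left)
  also have "\<dots> = (\<Sum>j\<in>J. of_real ((cmod (a j))\<^sup>2))"
    by (intro sum.cong refl) (simp add: co' complex_norm_square del: of_real_power)
  finally show "ip.qf f = (\<Sum>j\<in>J. (cmod (a j))\<^sup>2)" by (simp add: ip.qf_def)
  have "h f f = (\<Sum>j\<in>J. a j * h (\<phi> j) f)"
    by (subst (1) f_def, subst h.sum_left) (auto simp: spQ fQ ip.Q_scale h.scale_left)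
  also have "\<dots> = (\<Sum>j\<in>J. of_real (s j * (cmod (a j))\<^sup>2))"
  proof (intro sum.cong refl)
    fix j assume "j \<in> J"
    have "a j * cnj (a j) = of_real ((cmod (a j))\<^sup>2)" by (simp add: complex_norm_square del: of_real_power)
    then show "a j * h (\<phi> j) f = of_real (s j * (cmod (a j))\<^sup>2)"
      using \<open>j \<in> J\<close> by (simp add: sp_weak[OF fQ] co' mult.left_commute)
  qed
  finally show "h.qf f = (\<Sum>j\<in>J. s j * (cmod (a j))\<^sup>2)" by (simp add: h.qf_def)
qed

text \<open>The upper half of the min-max principle, complementing \<open>sp_ge\<close>: since
  \<open>s\<close> is monotone, \<open>s n\<close> is the largest of the weights that occur in the
  span.\<close>

lemma sp_span_le:
  assumes "(\<exists>j\<le>n. a j \<noteq> 0)"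
  shows "0 < ip.qf (\<Sum>j\<le>n. scale (a j) (\<phi> j))"
    "h.qf (\<Sum>j\<le>n. scale (a j) (\<phi> j)) \<le> s n * ip.qf (\<Sum>j\<le>n. scale (a j) (\<phi> j))"
proof -
  show "0 < ip.qf (\<Sum>j\<le>n. scale (a j) (\<phi> j))"
    using assms by (subst sp_span_eqs(3)) (auto intro!: sum_pos2)
  show "h.qf (\<Sum>j\<le>n. scale (a j) (\<phi> j)) \<le> s n * ip.qf (\<Sum>j\<le>n. scale (a j) (\<phi> j))"
    using monoD[OF sp_mono]
    by (simp add: sp_span_eqs sum_distrib_left) (intro sum_mono mult_right_mono, auto)
qed

lemma sp_finite: "finite {n. s n = \<mu>}"
proof -
  obtain m where "\<mu> < s m" using sp_unb by blast
  then have "{n. s n = \<mu>} \<subseteq> {..<m}"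
    using monoD[OF sp_mono, of m] by (force simp: not_less[symmetric])
  then show ?thesis by (rule finite_subset) simp
qed

text \<open>The projection \<open>p\<close> of a weak eigenvector \<open>f\<close> onto the
  \<open>\<phi> j\<close> with \<open>s j = \<mu>\<close> exhausts \<open>f\<close>: the remainder
  is orthogonal to every \<open>\<phi> i\<close>, and such a vector vanishes because
  \<open>s\<close> is unbounded.\<close>

lemma sp_dim: "ip.dim {f \<in> Q. \<forall>g\<in>Q. h f g = complex_of_real \<mu> * ip f g} = card {n. s n = \<mu>}"
proof -
  let ?J = "{n. s n = \<mu>}"
  let ?E = "{f \<in> Q. \<forall>g\<in>Q. h f g = complex_of_real \<mu> * ip f g}"
  note fin = sp_finite[of \<mu>]
  have inj: "inj \<phi>"
    by (rule injI) (metis sp_on zero_neq_one)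
  have ind: "ip.independent (\<phi> ` ?J)"
  proof (rule ip.independent_if_scalars_zero)
    show "finite (\<phi> ` ?J)" using fin by simp
    fix c x assume c: "(\<Sum>x\<in>\<phi> ` ?J. scale (c x) x) = 0" "x \<in> \<phi> ` ?J"
    then obtain j where j: "j \<in> ?J" "x = \<phi> j" by auto
    have "(\<Sum>x\<in>\<phi> ` ?J. scale (c x) x) = (\<Sum>j\<in>?J. scale (c (\<phi> j)) (\<phi> j))"
      using inj by (subst sum.reindex) (auto intro: inj_on_subset)
    then show "c x = 0"
      using c(1) sp_span_eqs(2)[OF fin j(1), where a = "\<lambda>j. c (\<phi> j)"] ip.zero_left[OF spQ] j by simp
  qed
  have 1: "\<phi> ` ?J \<subseteq> ?E" using spQ sp_weak by auto
  have 2: "?E \<subseteq> ip.span (\<phi> ` ?J)"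
  proof
    fix f assume "f \<in> ?E"
    then have f: "f \<in> Q" "\<And>g. g \<in> Q \<Longrightarrow> h f g = complex_of_real \<mu> * ip f g" by auto
    define p where "p = (\<Sum>j\<in>?J. scale (ip f (\<phi> j)) (\<phi> j))"
    have p: "p \<in> Q" "\<And>j. j \<in> ?J \<Longrightarrow> ip p (\<phi> j) = ip f (\<phi> j)"
      unfolding p_def using sp_span_eqs(1,2)[OF fin, where a = "\<lambda>j. ip f (\<phi> j)"] by auto
    have hp: "h p g = complex_of_real \<mu> * ip p g" if "g \<in> Q" for g
      unfolding p_def using that
      by (subst h.sum_left, (auto simp: spQ ip.Q_scale)[2], subst ip.sum_left)
         (auto simp: spQ ip.Q_scale h.scale_left ip.scale_left sp_weak sum_distrib_left intro!: sum.cong)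
    have d: "f - p \<in> Q" using f p by (intro ip.Q_diff)
    have hd: "h (f - p) g = complex_of_real \<mu> * ip (f - p) g" if "g \<in> Q" for g
      using f p that hp by (simp add: h.diff_left ip.diff_left right_diff_distrib)
    have perp: "ip (f - p) (\<phi> i) = 0" for i
    proof (cases "i \<in> ?J")
      case True
      then show ?thesis using f p spQ by (simp add: ip.diff_left)
    next
      case False
      \<comment> \<open>Both \<open>\<phi> i\<close> and \<open>f - p\<close> satisfy an eigenvalue
        equation, so \<open>h (f - p) (\<phi> i)\<close> equals \<open>ip (f - p) (\<phi> i)\<close>
        times \<open>s i\<close> as well as times \<mu>, and these factors differ.\<close>
      have "h (f - p) (\<phi> i) = cnj (h (\<phi> i) (f - p))" by (rule h.herm[OF spQ d])
      also have "\<dots> = s i * ip (f - p) (\<phi> i)"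
        using sp_weak[OF d, of i] ip.herm[OF spQ d, of i] by simp
      finally show ?thesis using hd[OF spQ, of i] False by auto
    qed
    have "ip.qf (f - p) = 0"
    proof (rule ccontr)
      assume "ip.qf (f - p) \<noteq> 0"
      then have "0 < ip.qf (f - p)" using ip_qf_nonneg[OF d] by simp
      moreover obtain n where "h.qf (f - p) / ip.qf (f - p) < s n" using sp_unb by blast
      ultimately have "h.qf (f - p) < s n * ip.qf (f - p)" by (simp add: field_simps)
      with sp_ge[OF d, of n] perp show False by simp
    qed
    then have "f = p" using ip_pos[OF d] by force
    moreover have "p \<in> ip.span (\<phi> ` ?J)"
      unfolding p_def by (intro ip.span_sum ip.span_scale ip.span_base) simp
    ultimately show "f \<in> ip.span (\<phi> ` ?J)" by simp
  qed
  from ip.dim_unique[OF 1 2 ind refl] show ?thesis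
    using inj by (simp add: card_image inj_on_subset[OF inj])
qed

end

end

text \<open>Orthogonality to \<open>\<phi> 0, ..., \<phi> (n - 1)\<close> leaves a nonzero
  \<open>f\<close> in the span of the \<open>n + 1\<close> vectors
  \<open>\<phi>' 0, ..., \<phi>' n\<close>. Its Rayleigh quotient is at least \<open>s n\<close> and
  at most \<open>s' n\<close>.\<close>

lemma spectral_seq_le_subspace:
  fixes scale :: "complex \<Rightarrow> 'x::ab_group_add \<Rightarrow> 'x"
  assumes "form_space scale Q ip h C" "form_space scale Q' ip h' C'"
    and sub: "Q' \<subseteq> Q" and h': "\<And>f. f \<in> Q' \<Longrightarrow> h' f f = h f f"
    and sp: "spectral_seq Q ip h \<phi> s" and sp': "spectral_seq Q' ip h' \<phi>' s'"
  shows "s n \<le> s' n"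
proof -
  interpret A: form_space scale Q ip h C by fact
  interpret B: form_space scale Q' ip h' C' by fact
  obtain a where a: "\<exists>j\<in>{..n}. a j \<noteq> 0" "\<And>i. i \<in> {..<n} \<Longrightarrow> (\<Sum>j\<in>{..n}. ip (\<phi>' j) (\<phi> i) * a j) = 0"
    using homogeneous_system_nontrivial[of "{..<n}" "{..n}" "\<lambda>i j. ip (\<phi>' j) (\<phi> i)"] by auto
  define f where "f = (\<Sum>j\<le>n. scale (a j) (\<phi>' j))"
  have \<phi>'Q: "\<phi>' j \<in> Q" for j using B.spQ[OF sp'] sub by blast
  have fQ': "f \<in> Q'" unfolding f_def by (rule B.sp_span_eqs(1)[OF sp']) simp
  then have fQ: "f \<in> Q" using sub by blast
  have "ip f (\<phi> i) = 0" if "i < n" for i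
    unfolding f_def using a(2)[of i] that
    by (subst A.ip.sum_left) (auto simp: \<phi>'Q A.spQ[OF sp] A.ip.Q_scale A.ip.scale_left mult.commute)
  from A.sp_ge[OF sp fQ this] have "s n * A.ip.qf f \<le> A.h.qf f" .
  also have "A.h.qf f = B.h.qf f" using h'[OF fQ'] by (simp add: A.h.qf_def B.h.qf_def)
  also have "\<dots> \<le> s' n * B.ip.qf f"
    unfolding f_def using a(1) by (intro B.sp_span_le[OF sp']) auto
  finally have "s n * A.ip.qf f \<le> s' n * A.ip.qf f" .
  moreover have "0 < A.ip.qf f"
    unfolding f_def using a(1) B.sp_span_le(1)[OF sp', of n a] by auto
  ultimately show ?thesis by simp
qed

text \<open>The dimension count runs in the opposite direction: membership in \<open>Q'\<close>
  costs one further equation, so a span of \<open>n + 2\<close> vectors \<open>\<phi> j\<close> is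
  needed, which is where the index shifts by one.\<close>

lemma spectral_seq_le_codim_1:
  fixes scale :: "complex \<Rightarrow> 'x::ab_group_add \<Rightarrow> 'x"
  assumes "form_space scale Q ip h C" "form_space scale Q' ip h' C'"
    and Q': "Q' = {f \<in> Q. ell f = 0}" and h': "\<And>f. f \<in> Q' \<Longrightarrow> h' f f = h f f"
    and ell: "\<And>(a :: nat \<Rightarrow> complex) \<psi> n. (\<And>j. \<psi> j \<in> Q) \<Longrightarrow> ell (\<Sum>j\<le>n. scale (a j) (\<psi> j)) = (\<Sum>j\<le>n. ell (\<psi> j) * a j)"
    and sp: "spectral_seq Q ip h \<phi> s" and sp': "spectral_seq Q' ip h' \<phi>' s'"
  shows "s' n \<le> s (Suc n)"
proof -
  interpret A: form_space scale Q ip h C by fact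
  interpret B: form_space scale Q' ip h' C' by fact
  \<comment> \<open>Row \<open>n\<close> carries the constraint \<open>ell\<close>, the rows
    \<open>i < n\<close> the orthogonality to \<open>\<phi>' i\<close>.\<close>
  define c where "c = (\<lambda>i j. if i = n then ell (\<phi> j) else ip (\<phi> j) (\<phi>' i))"
  obtain a where a: "\<exists>j\<in>{..Suc n}. a j \<noteq> 0" "\<And>i. i \<in> {..n} \<Longrightarrow> (\<Sum>j\<in>{..Suc n}. c i j * a j) = 0"
    using homogeneous_system_nontrivial[of "{..n}" "{..Suc n}" c] by auto
  define f where "f = (\<Sum>j\<le>Suc n. scale (a j) (\<phi> j))"
  have fQ: "f \<in> Q" unfolding f_def by (rule A.sp_span_eqs(1)[OF sp]) simp
  have "ell f = 0"
    unfolding f_def by (subst ell) (use A.spQ[OF sp] a(2)[of n] in \<open>auto simp: c_def\<close>)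
  then have fQ': "f \<in> Q'" using fQ by (simp add: Q')
  have \<phi>'Q: "\<phi>' j \<in> Q" for j using B.spQ[OF sp'] Q' by blast
  have "ip f (\<phi>' i) = 0" if "i < n" for i
    unfolding f_def using a(2)[of i] that
    by (subst A.ip.sum_left)
       (auto simp: c_def \<phi>'Q A.spQ[OF sp] A.ip.Q_scale A.ip.scale_left mult.commute)
  from B.sp_ge[OF sp' fQ' this] have "s' n * B.ip.qf f \<le> B.h.qf f" .
  also have "B.h.qf f = A.h.qf f" using h'[OF fQ'] by (simp add: A.h.qf_def B.h.qf_def)
  also have "\<dots> \<le> s (Suc n) * A.ip.qf f"
    unfolding f_def using a(1) by (intro A.sp_span_le[OF sp]) auto
  finally have "s' n * A.ip.qf f \<le> s (Suc n) * A.ip.qf f" .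
  moreover have "0 < A.ip.qf f"
    unfolding f_def using a(1) by (intro A.sp_span_le[OF sp]) auto
  ultimately show ?thesis by simp
qed

section \<open>Square integrable functions and weak derivatives on an interval\<close>

abbreviation "Leb l \<equiv> lebesgue_on {0..l::real}"

definition sqn :: "real \<Rightarrow> (real \<Rightarrow> complex) \<Rightarrow> real" where
  "sqn l u = (LINT x|Leb l. (cmod (u x))\<^sup>2)"

lemma integral_mult_cnj_self: "(LINT x|Leb l. u x * cnj (u x)) = of_real (sqn l u)"
proof -
  have "(LINT x|Leb l. u x * cnj (u x)) = (LINT x|Leb l. complex_of_real ((cmod (u x))\<^sup>2))"
    by (intro Bochner_Integration.integral_cong) (auto simp: complex_norm_square simp del: of_real_power)
  then show ?thesis unfolding sqn_def by (simp only: integral_complex_of_real)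
qed

lemma sqn_nonneg: "0 \<le> sqn l u"
  unfolding sqn_def by (rule Bochner_Integration.integral_nonneg) simp

lemma finite_measure_lebesgue_on_interval: "finite_measure (lebesgue_on {a..b::real})"
  by (rule finite_measure_lebesgue_on) simp

lemma measure_lebesgue_on_interval: "a \<le> b \<Longrightarrow> measure (lebesgue_on {a..b::real}) {a..b} = b - a"
  by (simp add: measure_restrict_space)

lemma integrable_const_interval: "integrable (lebesgue_on {a..b::real}) (\<lambda>_. c :: 'a::{banach, second_countable_topology})"
  using finite_measure.integrable_const[OF finite_measure_lebesgue_on_interval] .

lemma integral_const_interval: "a \<le> b \<Longrightarrow> integral\<^sup>L (lebesgue_on {a..b::real}) (\<lambda>_. c :: real) = (b - a) * c"
  by (simp add: measure_lebesgue_on_interval)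

lemma integral_const_interval_complex: "a \<le> b \<Longrightarrow> integral\<^sup>L (lebesgue_on {a..b::real}) (\<lambda>_. c :: complex) = of_real (b - a) * c"
  by (simp add: measure_lebesgue_on_interval scaleR_conv_of_real)

lemma L2_onD: "L2_on l u \<Longrightarrow> u \<in> borel_measurable (Leb l)"
  "L2_on l u \<Longrightarrow> integrable (Leb l) (\<lambda>x. (norm (u x))\<^sup>2)"
  by (auto simp: L2_on_def)

lemma L2_on_bound:
  fixes u :: "real \<Rightarrow> complex"
  assumes "u \<in> borel_measurable (Leb l)" "integrable (Leb l) f"
    "\<And>x. x \<in> {0..l} \<Longrightarrow> (cmod (u x))\<^sup>2 \<le> f x"
  shows "L2_on l u"
  unfolding L2_on_def
proof
  show "integrable (Leb l) (\<lambda>x. (cmod (u x))\<^sup>2)"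
  proof (rule Bochner_Integration.integrable_bound[OF assms(2)])
    show "(\<lambda>x. (cmod (u x))\<^sup>2) \<in> borel_measurable (Leb l)"
      using assms(1) by measurable
    show "AE x in Leb l. norm ((cmod (u x))\<^sup>2) \<le> norm (f x)"
      using assms(3) by (intro AE_I2) (fastforce simp: space_restrict_space)
  qed
qed fact

lemma norm_add_squared_le: "(norm (a + b))\<^sup>2 \<le> 2 * (norm a)\<^sup>2 + 2 * (norm (b :: 'a::real_normed_vector))\<^sup>2"
proof -
  have "(norm (a + b))\<^sup>2 \<le> (norm a + norm b)\<^sup>2" by (intro power_mono norm_triangle_ineq) simp
  also have "\<dots> \<le> 2 * (norm a)\<^sup>2 + 2 * (norm b)\<^sup>2"
    using zero_le_power2[of "norm a - norm b"] by (simp add: power2_sum power2_diff)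
  finally show ?thesis .
qed

lemma L2_on_add:
  fixes u v :: "real \<Rightarrow> complex"
  assumes "L2_on l u" "L2_on l v"
  shows "L2_on l (\<lambda>x. u x + v x)"
proof (rule L2_on_bound)
  show "integrable (Leb l) (\<lambda>x. 2 * (cmod (u x))\<^sup>2 + 2 * (cmod (v x))\<^sup>2)"
    using assms by (auto simp: L2_on_def)
qed (use assms in \<open>auto simp: L2_on_def norm_add_squared_le\<close>)

lemma L2_on_scale:
  fixes u :: "real \<Rightarrow> complex"
  assumes "L2_on l u"
  shows "L2_on l (\<lambda>x. c * u x)"
  using assms by (auto simp: L2_on_def norm_mult power_mult_distrib)

lemma L2_on_diff:
  fixes u v :: "real \<Rightarrow> complex"
  assumes "L2_on l u" "L2_on l v"
  shows "L2_on l (\<lambda>x. u x - v x)"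
  using L2_on_add[OF assms(1) L2_on_scale[OF assms(2), of "-1"]] by simp

lemma L2_on_cnj:
  assumes "L2_on l u"
  shows "L2_on l (\<lambda>x. cnj (u x))"
  using assms borel_measurable_continuous_on[of cnj u] by (auto simp: L2_on_def intro: continuous_intros)

lemma L2_on_of_real: "L2_on l V \<Longrightarrow> L2_on l (\<lambda>x. complex_of_real (V x))"
  by (auto simp: L2_on_def)

lemma L2_on_const: "L2_on l (\<lambda>_. c :: complex)"
  by (auto simp: L2_on_def integrable_const_interval)

lemma continuous_measurable_interval:
  fixes u :: "real \<Rightarrow> 'a::euclidean_space"
  shows "continuous_on {a..b} u \<Longrightarrow> u \<in> borel_measurable (lebesgue_on {a..b})"
  by (rule borel_measurable_integrable[OF continuous_imp_integrable_real])

lemma continuous_bounded_interval: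
  fixes u :: "real \<Rightarrow> 'a::real_normed_vector"
  assumes "continuous_on {a..b} u"
  obtains B where "0 \<le> B" "\<And>x. x \<in> {a..b} \<Longrightarrow> norm (u x) \<le> B"
proof -
  have "bounded (u ` {a..b})"
    by (intro compact_imp_bounded compact_continuous_image assms) simp
  then obtain B where "0 < B" "\<forall>x\<in>u ` {a..b}. norm x \<le> B" by (auto simp: bounded_pos)
  then show thesis by (intro that[of B]) auto
qed

lemma L2_on_mult_continuous:
  fixes u v :: "real \<Rightarrow> complex"
  assumes "L2_on l u" "continuous_on {0..l} v"
  shows "L2_on l (\<lambda>x. u x * v x)"
proof -
  obtain B where B: "0 \<le> B" "\<And>x. x \<in> {0..l} \<Longrightarrow> cmod (v x) \<le> B"
    using continuous_bounded_interval[OF assms(2)] by blast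
  show ?thesis
  proof (rule L2_on_bound)
    show "integrable (Leb l) (\<lambda>x. (cmod (u x))\<^sup>2 * B\<^sup>2)"
      using assms(1) by (simp add: L2_on_def)
    show "(\<lambda>x. u x * v x) \<in> borel_measurable (Leb l)"
      using assms(1) continuous_measurable_interval[OF assms(2)] by (auto simp: L2_on_def)
    fix x assume "x \<in> {0..l}"
    then show "(cmod (u x * v x))\<^sup>2 \<le> (cmod (u x))\<^sup>2 * B\<^sup>2"
      unfolding norm_mult power_mult_distrib by (intro mult_left_mono power_mono B) auto
  qed
qed

lemma L2_on_continuous: "continuous_on {0..l} u \<Longrightarrow> L2_on l (u :: real \<Rightarrow> complex)"
  using L2_on_mult_continuous[OF L2_on_const, of l u 1] by simp

lemma L2_on_integrable_mult:
  fixes u v :: "real \<Rightarrow> complex"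
  assumes "L2_on l u" "L2_on l v"
  shows "integrable (Leb l) (\<lambda>x. u x * v x)"
proof (rule Bochner_Integration.integrable_bound)
  show "integrable (Leb l) (\<lambda>x. (cmod (u x))\<^sup>2 + (cmod (v x))\<^sup>2)"
    using assms by (auto simp: L2_on_def)
  show "AE x in Leb l. norm (u x * v x) \<le> norm ((cmod (u x))\<^sup>2 + (cmod (v x))\<^sup>2)"
  proof (rule AE_I2)
    fix x
    have "2 * cmod (u x) * cmod (v x) \<le> (cmod (u x))\<^sup>2 + (cmod (v x))\<^sup>2" by (rule sum_squares_bound)
    moreover have "0 \<le> cmod (u x) * cmod (v x)" by simp
    ultimately have "cmod (u x) * cmod (v x) \<le> (cmod (u x))\<^sup>2 + (cmod (v x))\<^sup>2" by linarith
    then show "norm (u x * v x) \<le> norm ((cmod (u x))\<^sup>2 + (cmod (v x))\<^sup>2)"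
      by (simp add: norm_mult)
  qed
qed (use assms in \<open>auto simp: L2_on_def\<close>)

lemma L2_on_integrable: "L2_on l (u :: real \<Rightarrow> complex) \<Longrightarrow> integrable (Leb l) u"
  using L2_on_integrable_mult[OF _ L2_on_const, of l u 1] by simp

lemma L2_on_cong_AE:
  fixes u v :: "real \<Rightarrow> complex"
  assumes "L2_on l u" "L2_on l v" "AE x in Leb l. u x = v x"
  shows "sqn l u = sqn l v"
  unfolding sqn_def using assms by (intro integral_cong_AE) (auto simp: L2_on_def)

lemma integral_subinterval_le:
  fixes f :: "real \<Rightarrow> real"
  assumes "integrable (lebesgue_on {a..b}) f" "\<And>x. x \<in> {a..b} \<Longrightarrow> 0 \<le> f x" "{c..d} \<subseteq> {a..b}"
  shows "integral\<^sup>L (lebesgue_on {c..d}) f \<le> integral\<^sup>L (lebesgue_on {a..b}) f"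
  using assms by (intro integral_mono_lebesgue_on_AE) (auto simp: space_restrict_space intro!: AE_I2)

text \<open>Cauchy-Schwarz against the constant 1: the integral of \<open>(cmod (w s) - t)^2\<close>
  is nonnegative, and \<open>t\<close> is taken to be the mean \<open>J / d\<close>.\<close>

lemma integral_interval_cauchy_schwarz:
  fixes w :: "real \<Rightarrow> complex"
  assumes w: "L2_on l w" and yx: "0 \<le> y" "y \<le> x" "x \<le> l"
  shows "(LINT s|lebesgue_on {y..x}. cmod (w s))\<^sup>2 \<le> (x - y) * sqn l w"
proof -
  let ?M = "lebesgue_on {y..x}"
  have sub: "{y..x} \<subseteq> {0..l}" using yx by auto
  have i1: "integrable ?M (\<lambda>s. cmod (w s))"
    using integrable_subinterval[OF L2_on_integrable[OF w] sub] by simp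
  have i2: "integrable ?M (\<lambda>s. (cmod (w s))\<^sup>2)"
    using integrable_subinterval[OF L2_onD(2)[OF w] sub] by simp
  define J where "J = (LINT s|?M. cmod (w s))"
  define S where "S = (LINT s|?M. (cmod (w s))\<^sup>2)"
  have "S \<le> sqn l w"
    unfolding S_def sqn_def by (intro integral_subinterval_le sub L2_onD(2)[OF w, simplified]) auto
  have *: "0 \<le> S - 2 * t * J + t\<^sup>2 * (x - y)" for t
  proof -
    have "(LINT s|?M. (cmod (w s) - t)\<^sup>2) = (LINT s|?M. (cmod (w s))\<^sup>2 - 2 * t * cmod (w s) + t\<^sup>2)"
      by (intro Bochner_Integration.integral_cong) (auto simp: power2_diff algebra_simps)
    also have "\<dots> = S - 2 * t * J + (x - y) * t\<^sup>2"
      using i1 i2 integrable_const_interval[of y x] integral_const_interval[OF yx(2)]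
      unfolding S_def J_def by (subst Bochner_Integration.integral_add) auto
    finally show ?thesis
      using Bochner_Integration.integral_nonneg[of ?M "\<lambda>s. (cmod (w s) - t)\<^sup>2"] by (simp add: mult.commute)
  qed
  show ?thesis
  proof (cases "y = x")
    case True
    then show ?thesis by (simp add: integral_eq_zero_null_sets)
  next
    case False
    define d where "d = x - y"
    have "0 < d" using False yx by (simp add: d_def)
    moreover have "0 \<le> S - 2 * (J / d) * J + (J / d)\<^sup>2 * d" using *[of "J / d"] by (simp add: d_def)
    ultimately have "J\<^sup>2 \<le> d * S" by (simp add: field_simps power2_eq_square)
    then have "J\<^sup>2 \<le> (x - y) * S" by (simp add: d_def)
    also have "\<dots> \<le> (x - y) * sqn l w"
      using \<open>S \<le> sqn l w\<close> yx by (intro mult_left_mono) auto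
    finally show ?thesis by (simp add: J_def)
  qed
qed

section \<open>Weak derivatives: Hoelder estimate, uniqueness, integration by parts\<close>

lemma weak_deriv_onD:
  assumes "weak_deriv_on l u u'"
  shows "L2_on l u'" "integrable (Leb l) u'"
    "x \<in> {0..l} \<Longrightarrow> u x = u 0 + integral\<^sup>L (lebesgue_on {0..x}) u'"
  using assms unfolding weak_deriv_on_def by (blast intro: L2_on_integrable)+

lemma weak_deriv_on_diff_eq:
  assumes "weak_deriv_on l u u'" "0 \<le> y" "y \<le> x" "x \<le> l"
  shows "u x - u y = integral\<^sup>L (lebesgue_on {y..x}) u'"
proof -
  have "integrable (lebesgue_on {0..x}) u'"
    using integrable_subinterval[OF weak_deriv_onD(2)[OF assms(1)]] assms by auto
  from integral_combine[OF this, of y] assms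
  show ?thesis
    using weak_deriv_onD(3)[OF assms(1), of x] weak_deriv_onD(3)[OF assms(1), of y] by simp
qed

text \<open>Cauchy-Schwarz on the segment between the two points. Continuity, equicontinuity in the
  compactness proof and the trace inequality all come from this estimate.\<close>

lemma weak_deriv_on_holder:
  assumes "weak_deriv_on l u u'" "x \<in> {0..l}" "y \<in> {0..l}"
  shows "(cmod (u x - u y))\<^sup>2 \<le> \<bar>x - y\<bar> * sqn l u'"
proof -
  have *: "(cmod (u x - u y))\<^sup>2 \<le> (x - y) * sqn l u'" if "0 \<le> y" "y \<le> x" "x \<le> l" for x y
  proof -
    have "cmod (u x - u y) \<le> (LINT s|lebesgue_on {y..x}. cmod (u' s))"
      unfolding weak_deriv_on_diff_eq[OF assms(1) that] by (rule integral_norm_bound)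
    then have "(cmod (u x - u y))\<^sup>2 \<le> (LINT s|lebesgue_on {y..x}. cmod (u' s))\<^sup>2"
      by (intro power_mono) auto
    also have "\<dots> \<le> (x - y) * sqn l u'"
      by (intro integral_interval_cauchy_schwarz weak_deriv_onD(1)[OF assms(1)] that)
    finally show ?thesis .
  qed
  show ?thesis
    using *[of y x] *[of x y] assms(2,3) by (cases "y \<le> x") (auto simp: norm_minus_commute)
qed

text \<open>The denominator \<open>K + 1\<close> covers \<open>K = 0\<close>. The modulus depends on
  \<open>u\<close> through \<open>K\<close> only, as equicontinuity requires.\<close>

lemma holder_modulus:
  fixes u :: "real \<Rightarrow> complex"
  assumes "\<And>x y. x \<in> S \<Longrightarrow> y \<in> S \<Longrightarrow> (cmod (u x - u y))\<^sup>2 \<le> \<bar>x - y\<bar> * K" "0 \<le> K" "0 < e"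
    "x \<in> S" "y \<in> S" "\<bar>x - y\<bar> < e\<^sup>2 / (K + 1)"
  shows "cmod (u x - u y) < e"
proof -
  have "(cmod (u x - u y))\<^sup>2 \<le> \<bar>x - y\<bar> * K" using assms by simp
  also have "\<dots> \<le> e\<^sup>2 / (K + 1) * K" using assms by (intro mult_right_mono) auto
  also have "\<dots> < e\<^sup>2" using assms by (simp add: field_simps)
  finally show ?thesis using assms by (simp add: power_less_imp_less_base)
qed

lemma weak_deriv_on_continuous:
  assumes "weak_deriv_on l u u'"
  shows "continuous_on {0..l} u"
  unfolding continuous_on_iff
proof (intro ballI allI impI)
  fix x e :: real assume x: "x \<in> {0..l}" and e: "0 < e"
  have "0 < e\<^sup>2 / (sqn l u' + 1)" using e sqn_nonneg[of l u'] by simp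
  moreover have "dist (u y) (u x) < e" if "y \<in> {0..l}" "dist y x < e\<^sup>2 / (sqn l u' + 1)" for y
    using holder_modulus[OF weak_deriv_on_holder[OF assms] sqn_nonneg e that(1) x] that(2)
    by (simp add: dist_norm)
  ultimately show "\<exists>d>0. \<forall>y\<in>{0..l}. dist y x < d \<longrightarrow> dist (u y) (u x) < e" by blast
qed

lemma weak_deriv_on_L2: "weak_deriv_on l u u' \<Longrightarrow> L2_on l u"
  by (intro L2_on_continuous weak_deriv_on_continuous)

lemma weak_deriv_on_add:
  assumes "weak_deriv_on l u u'" "weak_deriv_on l v v'"
  shows "weak_deriv_on l (\<lambda>x. u x + v x) (\<lambda>x. u' x + v' x)"
  unfolding weak_deriv_on_def
proof (intro conjI ballI)
  fix x assume x: "x \<in> {0..l}"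
  then have "integrable (lebesgue_on {0..x}) u'" "integrable (lebesgue_on {0..x}) v'"
    using assms[THEN weak_deriv_onD(2), THEN integrable_subinterval] by auto
  then show "u x + v x = u 0 + v 0 + (LINT x|lebesgue_on {0..x}. u' x + v' x)"
    using assms[THEN weak_deriv_onD(3), OF x] by simp
qed (use assms[THEN weak_deriv_onD(1)] in \<open>auto intro: L2_on_add\<close>)

lemma weak_deriv_on_scale:
  assumes "weak_deriv_on l u u'"
  shows "weak_deriv_on l (\<lambda>x. c * u x) (\<lambda>x. c * u' x)"
  unfolding weak_deriv_on_def
proof (intro conjI ballI)
  fix x assume x: "x \<in> {0..l}"
  then show "c * u x = c * u 0 + (LINT x|lebesgue_on {0..x}. c * u' x)"
    using weak_deriv_onD(3)[OF assms x] by (simp add: distrib_left)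
qed (use weak_deriv_onD(1)[OF assms] in \<open>auto intro: L2_on_scale\<close>)

lemma weak_deriv_on_diff:
  assumes "weak_deriv_on l u u'" "weak_deriv_on l v v'"
  shows "weak_deriv_on l (\<lambda>x. u x - v x) (\<lambda>x. u' x - v' x)"
  using weak_deriv_on_add[OF assms(1) weak_deriv_on_scale[OF assms(2), of "-1"]] by simp

lemma weak_deriv_on_cnj:
  assumes "weak_deriv_on l u u'"
  shows "weak_deriv_on l (\<lambda>x. cnj (u x)) (\<lambda>x. cnj (u' x))"
  unfolding weak_deriv_on_def
proof (intro conjI ballI)
  fix x assume x: "x \<in> {0..l}"
  then show "cnj (u x) = cnj (u 0) + (LINT x|lebesgue_on {0..x}. cnj (u' x))"
    using weak_deriv_onD(3)[OF assms x] by simp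
qed (use weak_deriv_onD(1)[OF assms] in \<open>auto intro: L2_on_cnj\<close>)

lemma weak_deriv_on_const: "weak_deriv_on l (\<lambda>_. c) (\<lambda>_. 0)"
  by (simp add: weak_deriv_on_def L2_on_const)

lemma weak_deriv_on_primitive:
  "L2_on l w \<Longrightarrow> weak_deriv_on l (\<lambda>x. c + integral\<^sup>L (lebesgue_on {0..x}) w) w"
  by (simp add: weak_deriv_on_def integral_eq_zero_null_sets)

lemma weak_deriv_on_cong:
  assumes "weak_deriv_on l u u'" "L2_on l v'" "AE x in Leb l. u' x = v' x"
    "\<And>x. x \<in> {0..l} \<Longrightarrow> v x = u x"
  shows "weak_deriv_on l v v'"
  unfolding weak_deriv_on_def
proof (intro conjI ballI)
  fix x assume x: "x \<in> {0..l}"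
  have ae: "AE x in lebesgue_on {0..x}. u' x = v' x"
    using assms(3) x by (auto simp: AE_restrict_space_iff elim!: eventually_mono)
  have "integral\<^sup>L (lebesgue_on {0..x}) u' = integral\<^sup>L (lebesgue_on {0..x}) v'"
    using x weak_deriv_onD(2)[OF assms(1), THEN integrable_subinterval, of 0 x]
      L2_on_integrable[OF assms(2), THEN integrable_subinterval, of 0 x] ae
    by (intro integral_cong_AE) auto
  then show "v x = v 0 + integral\<^sup>L (lebesgue_on {0..x}) v'"
    using weak_deriv_onD(3)[OF assms(1) x] assms(4)[OF x] assms(4)[of 0] x by simp
qed fact

text \<open>A Dynkin class argument: sets over which the integral vanishes include the half-lines
  and are closed under complements (the total integral is 0) and disjoint unions, hence include the
  Borel sets. Lebesgue sets differ from these by null sets, and \<open>density_zero\<close>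
  concludes.\<close>

lemma AE_zero_if_primitive_zero:
  fixes w :: "real \<Rightarrow> complex"
  assumes w: "integrable (Leb l) w"
    and zero: "\<And>x. x \<in> {0..l} \<Longrightarrow> integral\<^sup>L (lebesgue_on {0..x}) w = 0"
  shows "AE x in Leb l. w x = 0"
proof -
  \<comment> \<open>Extension by 0 to the whole line, where the sets \<open>{..a}\<close> form an
    intersection-stable generator of the Borel sets.\<close>
  define f where "f = (\<lambda>x. indicator {0..l} x *\<^sub>R w x)"
  have f: "integrable lebesgue f"
    using w unfolding f_def by (subst (asm) integrable_restrict_space) auto
  have si: "set_integrable lebesgue A f" if "A \<in> sets lebesgue" for A
    unfolding set_integrable_def using that f by (rule integrable_mult_indicator)
  have f0: "integral\<^sup>L lebesgue f = 0"
  proof (cases "0 \<le> l")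
    case True
    then show ?thesis
      using zero[of l] integral_restrict_space[of "{0..l}" lebesgue w] by (simp add: f_def)
  qed (simp add: f_def)
  have half: "set_lebesgue_integral lebesgue {..a} f = 0" for a
  proof -
    have *: "set_lebesgue_integral lebesgue {..a} f = integral\<^sup>L lebesgue (\<lambda>x. indicator ({..a} \<inter> {0..l}) x *\<^sub>R w x)"
      unfolding set_lebesgue_integral_def f_def
      by (intro Bochner_Integration.integral_cong) (auto simp: indicator_def)
    have "{..a} \<inter> {0..l} = {0..min a l}" by auto
    then have "set_lebesgue_integral lebesgue {..a} f = integral\<^sup>L (lebesgue_on {0..min a l}) w"
      unfolding * by (simp add: integral_restrict_space)
    also have "\<dots> = 0"
    proof (cases "0 \<le> min a l")
      case True
      then show ?thesis by (intro zero) auto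
    qed (simp add: integral_lebesgue_on_empty)
    finally show ?thesis .
  qed
  have sets_eq: "sigma_sets UNIV (range (\<lambda>a::real. {..a})) = sets borel"
    by (subst borel_eq_atMost) simp
  have IS: "Int_stable (range (\<lambda>a::real. {..a}))"
    by (auto simp: Int_stable_def)
  have PW: "range (\<lambda>a::real. {..a}) \<subseteq> Pow UNIV" by simp
  have borel: "set_lebesgue_integral lebesgue A f = 0" if "A \<in> sigma_sets UNIV (range (\<lambda>a::real. {..a}))" for A
    using IS PW that
  proof (induction rule: sigma_sets_induct_disjoint)
    case (basic A)
    then show ?case using half by auto
  next
    case empty
    show ?case by (simp add: set_lebesgue_integral_def)
  next
    case (compl A)
    have A: "A \<in> sets lebesgue" using compl.hyps sets_eq by simp
    have "(\<lambda>x. indicator (UNIV - A) x *\<^sub>R f x) = (\<lambda>x. f x - indicator A x *\<^sub>R f x)"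
      by (auto simp: indicator_def fun_eq_iff)
    then have "set_lebesgue_integral lebesgue (UNIV - A) f = integral\<^sup>L lebesgue f - set_lebesgue_integral lebesgue A f"
      unfolding set_lebesgue_integral_def
      using Bochner_Integration.integral_diff[OF f si[OF A, unfolded set_integrable_def]] by simp
    then show ?case using f0 compl by simp
  next
    case (union A)
    have A: "A i \<in> sets lebesgue" for i
      using union.hyps sets_eq by (auto simp: subset_eq)
    have "set_lebesgue_integral lebesgue (\<Union>i. A i) f = (\<Sum>i. set_lebesgue_integral lebesgue (A i) f)"
      using union.hyps A by (intro lebesgue_integral_countable_add si) (auto simp: disjoint_family_on_def)
    then show ?case using union by simp
  qed
  have leb: "set_lebesgue_integral lebesgue A f = 0" if A: "A \<in> sets lebesgue" for A
  proof -
    obtain S N N' where S: "A = S \<union> N" "N \<subseteq> N'" "N' \<in> null_sets lborel" "S \<in> sets lborel"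
      using A by (rule sets_completionE)
    have "N \<in> null_sets lebesgue"
      using S by (metis null_sets_completionI null_sets_completion_subset)
    then have "AE x in lebesgue. x \<notin> N" by (rule AE_not_in)
    then have "AE x in lebesgue. indicator A x *\<^sub>R f x = indicator S x *\<^sub>R f x"
      by eventually_elim (auto simp: S indicator_def)
    moreover have S': "S \<in> sets lebesgue" using S(4) by simp
    ultimately have "set_lebesgue_integral lebesgue A f = set_lebesgue_integral lebesgue S f"
      unfolding set_lebesgue_integral_def
      using si[OF A, unfolded set_integrable_def] si[OF S', unfolded set_integrable_def]
      by (intro integral_cong_AE) auto
    also have "\<dots> = 0"
      using S(4) by (intro borel) (simp add: sets_eq)
    finally show ?thesis .
  qed
  interpret finite_measure "Leb l" by (rule finite_measure_lebesgue_on_interval)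
  show ?thesis
  proof (rule density_zero[OF w])
    fix A assume "A \<in> sets (Leb l)"
    then have "A \<in> sets lebesgue" by (simp add: sets_restrict_space_iff)
    from leb[OF this] show "set_lebesgue_integral (Leb l) A w = 0"
      by (simp add: set_integral_restrict_space f_def)
  qed
qed

lemma weak_deriv_on_unique:
  assumes "weak_deriv_on l u u'" "weak_deriv_on l u v'"
  shows "AE x in Leb l. u' x = v' x"
proof -
  have "AE x in Leb l. u' x - v' x = 0"
  proof (rule AE_zero_if_primitive_zero)
    show "integrable (Leb l) (\<lambda>x. u' x - v' x)"
      using assms[THEN weak_deriv_onD(2)] by auto
    fix x assume x: "x \<in> {0..l}"
    then have "integrable (lebesgue_on {0..x}) u'" "integrable (lebesgue_on {0..x}) v'"
      using assms[THEN weak_deriv_onD(2), THEN integrable_subinterval] by auto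
    then show "(LINT x|lebesgue_on {0..x}. u' x - v' x) = 0"
      using assms[THEN weak_deriv_onD(3), OF x] by simp
  qed
  then show ?thesis by simp
qed

text \<open>On an equidistant subdivision of mesh \<open>d\<close> the increments of
  \<open>G\<close> telescope, so \<open>cmod (P l)\<close> is at most
  \<open>K * sqrt d * (G l - G 0)\<close>, which tends to 0 with the mesh.\<close>

lemma zero_if_increment_small:
  fixes P :: "real \<Rightarrow> complex" and G :: "real \<Rightarrow> real"
  assumes inc: "\<And>x y. 0 \<le> x \<Longrightarrow> x \<le> y \<Longrightarrow> y \<le> l \<Longrightarrow> cmod (P y - P x) \<le> K * sqrt (y - x) * (G y - G x)"
    and P0: "P 0 = 0" and l: "0 \<le> l"
  shows "P l = 0"
proof -
  have bound: "cmod (P l) \<le> K * sqrt (l * inverse (real (Suc n))) * (G l - G 0)" for n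
  proof -
    define d where "d = l * inverse (real (Suc n))"
    have d: "0 \<le> d" "real (Suc n) * d = l" using l by (auto simp: d_def field_simps)
    have "i \<le> Suc n \<Longrightarrow> cmod (P (real i * d)) \<le> K * sqrt d * (G (real i * d) - G 0)" for i
    proof (induction i)
      case (Suc i)
      have "real (Suc i) * d \<le> real (Suc n) * d" using Suc.prems d by (intro mult_right_mono) auto
      then have "cmod (P (real (Suc i) * d) - P (real i * d)) \<le>
          K * sqrt (real (Suc i) * d - real i * d) * (G (real (Suc i) * d) - G (real i * d))"
        using d by (intro inc) (auto intro: mult_right_mono)
      moreover have "real (Suc i) * d - real i * d = d" by (simp add: algebra_simps)
      moreover have "cmod (P (real (Suc i) * d)) \<le> cmod (P (real (Suc i) * d) - P (real i * d)) + cmod (P (real i * d))"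
        using norm_triangle_ineq[of "P (real (Suc i) * d) - P (real i * d)" "P (real i * d)"] by simp
      ultimately show ?case using Suc by (simp add: right_diff_distrib)
    qed (simp add: P0)
    from this[of "Suc n", OF order_refl] show ?thesis unfolding d(2) by (simp only: d_def)
  qed
  have "(\<lambda>n. K * sqrt (l * inverse (real (Suc n))) * (G l - G 0)) \<longlonglongrightarrow> K * sqrt (l * 0) * (G l - G 0)"
    by (intro tendsto_intros LIMSEQ_inverse_real_of_nat)
  then have "cmod (P l) \<le> K * sqrt (l * 0) * (G l - G 0)"
    using bound by (intro LIMSEQ_le_const) auto
  then show ?thesis by simp
qed

text \<open>\<open>P\<close> is the defect of the formula on \<open>{0..x}\<close>. Its increments
  are of smaller order than those of \<open>G\<close>, the primitive of
  \<open>cmod u' + cmod v'\<close>, so it vanishes by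
  \<open>zero_if_increment_small\<close>.\<close>

theorem weak_deriv_on_parts:
  assumes u: "weak_deriv_on l u u'" and v: "weak_deriv_on l v v'" and l: "0 \<le> l"
  shows "(LINT x|Leb l. u' x * v x) + (LINT x|Leb l. u x * v' x) = u l * v l - u 0 * v 0"
proof -
  have iu: "integrable (Leb l) (\<lambda>x. u' x * v x)" and iv: "integrable (Leb l) (\<lambda>x. u x * v' x)"
    by (intro L2_on_integrable_mult weak_deriv_onD(1)[OF u] weak_deriv_onD(1)[OF v] weak_deriv_on_L2[OF u] weak_deriv_on_L2[OF v])+
  define g where "g = (\<lambda>x. cmod (u' x) + cmod (v' x))"
  have ig: "integrable (Leb l) g"
    using u v by (auto simp: g_def weak_deriv_onD(2))
  define F where "F = (\<lambda>x. u' x * v x + u x * v' x)"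
  have iF: "integrable (Leb l) F" using iu iv by (simp add: F_def)
  define G where "G = (\<lambda>x. integral\<^sup>L (lebesgue_on {0..x}) g)"
  define P where "P = (\<lambda>x. u x * v x - u 0 * v 0 - integral\<^sup>L (lebesgue_on {0..x}) F)"
  define K where "K = sqrt (sqn l u') + sqrt (sqn l v')"
  have "P l = 0"
  proof (rule zero_if_increment_small[where K = K and G = G])
    fix x y :: real assume xy: "0 \<le> x" "x \<le> y" "y \<le> l"
    let ?M = "lebesgue_on {x..y}"
    have sub: "{x..y} \<subseteq> {0..l}" "{0..y} \<subseteq> {0..l}" using xy by auto
    note I = integrable_subinterval[OF _ sub(1)]
    have G: "G y - G x = integral\<^sup>L ?M g"
      unfolding G_def using integral_combine[OF integrable_subinterval[OF ig sub(2)] xy(1,2)] by simp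
    have F: "integral\<^sup>L (lebesgue_on {0..y}) F - integral\<^sup>L (lebesgue_on {0..x}) F = integral\<^sup>L ?M F"
      using integral_combine[OF integrable_subinterval[OF iF sub(2)] xy(1,2)] by simp
    have "P y - P x = (u y - u x) * v y + u x * (v y - v x) - integral\<^sup>L ?M F"
      unfolding P_def F[symmetric] by (simp add: algebra_simps)
    also have "\<dots> = (LINT s|?M. u' s * v y) + (LINT s|?M. u x * v' s) - integral\<^sup>L ?M F"
      using weak_deriv_on_diff_eq[OF u xy] weak_deriv_on_diff_eq[OF v xy] by simp
    \<comment> \<open>The terms of \<open>F\<close> are distributed so that each derivative is
      multiplied by an increment over part of \<open>{x..y}\<close>, which is at most
      \<open>K * sqrt (y - x)\<close>.\<close>
    also have "\<dots> = (LINT s|?M. u' s * (v y - v s) + (u x - u s) * v' s)"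
      using I[OF weak_deriv_onD(2)[OF u]] I[OF weak_deriv_onD(2)[OF v]] I[OF iF]
      by (subst Bochner_Integration.integral_add[symmetric], simp, simp,
          subst Bochner_Integration.integral_diff[symmetric])
         (auto simp: F_def algebra_simps intro!: Bochner_Integration.integral_cong)
    finally have "cmod (P y - P x) \<le> (LINT s|?M. cmod (u' s * (v y - v s) + (u x - u s) * v' s))"
      by (metis integral_norm_bound)
    also have "\<dots> \<le> (LINT s|?M. K * sqrt (y - x) * g s)"
    proof (rule integral_mono)
      show "integrable ?M (\<lambda>s. K * sqrt (y - x) * g s)" using I[OF ig] by simp
      have "integrable ?M (\<lambda>s. u' s * v y + u x * v' s - F s)"
        using I[OF weak_deriv_onD(2)[OF u]] I[OF weak_deriv_onD(2)[OF v]] I[OF iF] by simp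
      then show "integrable ?M (\<lambda>s. cmod (u' s * (v y - v s) + (u x - u s) * v' s))"
        by (intro integrable_norm) (simp add: F_def algebra_simps)
      fix s assume "s \<in> space ?M"
      then have s: "x \<le> s" "s \<le> y" by (auto simp: space_restrict_space)
      have h: "cmod (w a - w b) \<le> K * sqrt (y - x)"
        if "weak_deriv_on l w w'" "sqrt (sqn l w') \<le> K" "a \<in> {x..y}" "b \<in> {x..y}" for w w' a b
      proof -
        have "(cmod (w a - w b))\<^sup>2 \<le> \<bar>a - b\<bar> * sqn l w'"
          using that sub by (intro weak_deriv_on_holder) auto
        also have "\<dots> \<le> (y - x) * sqn l w'" using that by (intro mult_right_mono sqn_nonneg) auto
        finally have "cmod (w a - w b) \<le> sqrt ((y - x) * sqn l w')" by (rule real_le_rsqrt)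
        also have "\<dots> \<le> K * sqrt (y - x)"
          unfolding real_sqrt_mult mult.commute[of K] using that xy by (intro mult_left_mono) auto
        finally show ?thesis .
      qed
      have "cmod (u' s * (v y - v s) + (u x - u s) * v' s) \<le> cmod (u' s) * cmod (v y - v s) + cmod (u x - u s) * cmod (v' s)"
        by (metis norm_mult norm_triangle_ineq)
      also have "\<dots> \<le> cmod (u' s) * (K * sqrt (y - x)) + K * sqrt (y - x) * cmod (v' s)"
        using s xy sqn_nonneg[of l u'] sqn_nonneg[of l v']
        by (intro add_mono mult_left_mono mult_right_mono h[OF u] h[OF v]) (auto simp: K_def)
      finally show "cmod (u' s * (v y - v s) + (u x - u s) * v' s) \<le> K * sqrt (y - x) * g s"
        by (simp add: g_def algebra_simps)
    qed
    also have "\<dots> = K * sqrt (y - x) * (G y - G x)" unfolding G by simp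
    finally show "cmod (P y - P x) \<le> K * sqrt (y - x) * (G y - G x)" .
  qed (auto simp: P_def l integral_eq_zero_null_sets)
  then show ?thesis using iu iv by (simp add: P_def F_def)
qed

lemma weak_deriv_on_C1:
  assumes "\<And>x. x \<in> {0..l} \<Longrightarrow> (u has_vector_derivative u' x) (at x within {0..l})" "continuous_on {0..l} u'"
  shows "weak_deriv_on l u u'"
  unfolding weak_deriv_on_def
proof (intro conjI ballI)
  show "L2_on l u'" by (rule L2_on_continuous[OF assms(2)])
  fix x assume x: "x \<in> {0..l}"
  have "continuous_on {0..x} u'" using assms(2) x by (auto elim: continuous_on_subset)
  then have "integrable (lebesgue_on {0..x}) u'" by (rule continuous_imp_integrable_real)
  moreover have "(u' has_integral (u x - u 0)) {0..x}"
    using x by (intro fundamental_theorem_of_calculus)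
      (auto intro!: has_vector_derivative_within_subset[OF assms(1)])
  ultimately show "u x = u 0 + integral\<^sup>L (lebesgue_on {0..x}) u'"
    using lebesgue_integral_eq_integral[of "{0..x}" u'] by (simp add: integral_unique)
qed

text \<open>This links the one-sided classical derivatives in the vertex conditions with the
  boundary terms of integration by parts.\<close>

lemma weak_deriv_on_vector_derivative:
  assumes wd: "weak_deriv_on l u u'" and c: "continuous_on {0..l} u'" and x: "x \<in> {0..l}" and l: "0 < l"
  shows "vector_derivative u (at x within {0..l}) = u' x"
proof -
  have "((\<lambda>x. u 0 + integral {0..x} u') has_vector_derivative 0 + u' x) (at x within {0..l})"
    by (intro has_vector_derivative_add has_vector_derivative_const integral_has_vector_derivative c x)
  then have "(u has_vector_derivative 0 + u' x) (at x within {0..l})"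
  proof (rule has_vector_derivative_transform[OF x, rotated])
    fix y assume y: "y \<in> {0..l}"
    then have "integrable (lebesgue_on {0..y}) u'"
      using integrable_subinterval[OF weak_deriv_onD(2)[OF wd]] by auto
    then show "u y = u 0 + integral {0..y} u'"
      using weak_deriv_onD(3)[OF wd y] lebesgue_integral_eq_integral[of "{0..y}" u'] by simp
  qed
  then show ?thesis
    using x l by (intro vector_derivative_within_closed_interval) auto
qed

section \<open>Trace inequality, completeness and compactness\<close>

lemma sqn_le_sup:
  assumes "L2_on l u" "0 \<le> l" "\<And>x. x \<in> {0..l} \<Longrightarrow> (cmod (u x))\<^sup>2 \<le> B"
  shows "sqn l u \<le> l * B"
proof -
  have "sqn l u \<le> (LINT x|Leb l. B)"
    unfolding sqn_def using assms L2_onD(2)[OF assms(1)] integrable_const_interval[of 0 l B]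
    by (intro integral_mono) (auto simp: space_restrict_space)
  then show ?thesis unfolding integral_const_interval[OF assms(2)] by simp
qed

text \<open>The Hoelder estimate compares \<open>u x\<close> with \<open>u y\<close>, and the result
  is averaged over a window of length \<delta> around or next to \<open>x\<close>. Since \<delta> is
  free, the factor of the derivative can be made small; the semiboundedness of the form rests on
  this.\<close>

lemma weak_deriv_on_sup:
  assumes wd: "weak_deriv_on l u u'" and \<delta>: "0 < \<delta>" "\<delta> \<le> l" and x: "x \<in> {0..l}"
  shows "(cmod (u x))\<^sup>2 \<le> 2 / \<delta> * sqn l u + 2 * \<delta> * sqn l u'"
proof -
  \<comment> \<open>Left end of a window of length \<delta> that contains \<open>x\<close> and stays
    inside \<open>{0..l}\<close>.\<close>
  define a where "a = min x (l - \<delta>)"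
  have a: "0 \<le> a" "a \<le> x" "x \<le> a + \<delta>" "a + \<delta> \<le> l" using \<delta> x by (auto simp: a_def)
  let ?M = "lebesgue_on {a..a+\<delta>}"
  have sub: "{a..a+\<delta>} \<subseteq> {0..l}" using a by auto
  note L2 = L2_onD(2)[OF weak_deriv_on_L2[OF wd]]
  have i: "integrable ?M (\<lambda>y. (cmod (u y))\<^sup>2)" using integrable_subinterval[OF L2 sub] .
  have "\<delta> * (cmod (u x))\<^sup>2 = (LINT y|?M. (cmod (u x))\<^sup>2)"
    using \<delta> by (subst integral_const_interval) auto
  also have "\<dots> \<le> (LINT y|?M. 2 * (cmod (u y))\<^sup>2 + 2 * \<delta> * sqn l u')"
  proof (rule integral_mono)
    show "integrable ?M (\<lambda>y. (cmod (u x))\<^sup>2)" "integrable ?M (\<lambda>y. 2 * (cmod (u y))\<^sup>2 + 2 * \<delta> * sqn l u')"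
      using i by (auto intro: integrable_const_interval)
    fix y assume "y \<in> space ?M"
    then have y: "y \<in> {a..a+\<delta>}" by (simp add: space_restrict_space)
    have "(cmod (u x))\<^sup>2 \<le> 2 * (cmod (u y))\<^sup>2 + 2 * (cmod (u x - u y))\<^sup>2"
      using norm_add_squared_le[of "u y" "u x - u y"] by simp
    also have "(cmod (u x - u y))\<^sup>2 \<le> \<bar>x - y\<bar> * sqn l u'"
      using x y sub by (intro weak_deriv_on_holder[OF wd]) auto
    also have "\<dots> \<le> \<delta> * sqn l u'" using y a by (intro mult_right_mono sqn_nonneg) auto
    finally show "(cmod (u x))\<^sup>2 \<le> 2 * (cmod (u y))\<^sup>2 + 2 * \<delta> * sqn l u'" by simp
  qed
  also have "\<dots> = 2 * (LINT y|?M. (cmod (u y))\<^sup>2) + \<delta> * (2 * \<delta> * sqn l u')"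
    using i integral_const_interval[of a "a + \<delta>"] integrable_const_interval[of a "a + \<delta>"] \<delta>
    by (subst Bochner_Integration.integral_add) auto
  also have "(LINT y|?M. (cmod (u y))\<^sup>2) \<le> sqn l u"
    unfolding sqn_def by (intro integral_subinterval_le L2 sub) auto
  finally have "\<delta> * (cmod (u x))\<^sup>2 \<le> 2 * sqn l u + \<delta> * (2 * \<delta> * sqn l u')" by simp
  then show ?thesis using \<delta> by (simp add: field_simps)
qed

text \<open>The Riesz-Fischer argument: a subsequence converges almost everywhere, and Fatou's lemma
  shows that its limit is the limit in square mean of the whole sequence.\<close>

lemma L2_on_complete:
  fixes v :: "nat \<Rightarrow> real \<Rightarrow> complex"
  assumes v: "\<And>n. L2_on l (v n)" and l: "0 \<le> l"
    and cau: "\<And>\<epsilon>. 0 < \<epsilon> \<Longrightarrow> \<exists>N. \<forall>m\<ge>N. \<forall>n\<ge>N. sqn l (\<lambda>x. v m x - v n x) < \<epsilon>"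
  shows "\<exists>w. L2_on l w \<and> (\<lambda>n. sqn l (\<lambda>x. v n x - w x)) \<longlonglongrightarrow> 0"
proof -
  let ?M = "Leb l"
  have vm[measurable]: "v n \<in> borel_measurable ?M" for n using v by (rule L2_onD)
  \<comment> \<open>On a bounded interval square mean distance controls \<open>L1\<close> distance,
    which gives access to almost everywhere convergence along a subsequence.\<close>
  have cau1: "\<exists>N. \<forall>i\<ge>N. \<forall>j\<ge>N. (LINT x|?M. norm (v i x - v j x)) < e" if "0 < e" for e :: real
  proof -
    have "0 < e\<^sup>2 / (l + 1)" using that l by simp
    from cau[OF this] obtain N where N: "\<forall>m\<ge>N. \<forall>n\<ge>N. sqn l (\<lambda>x. v m x - v n x) < e\<^sup>2 / (l + 1)" by blast
    have "(LINT x|?M. norm (v i x - v j x)) < e" if "N \<le> i" "N \<le> j" for i j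
    proof -
      have "(LINT x|?M. norm (v i x - v j x))\<^sup>2 \<le> (l - 0) * sqn l (\<lambda>x. v i x - v j x)"
        using l by (intro integral_interval_cauchy_schwarz L2_on_diff v) auto
      also have "\<dots> \<le> l * (e\<^sup>2 / (l + 1))"
      proof -
        have "sqn l (\<lambda>x. v i x - v j x) \<le> e\<^sup>2 / (l + 1)" using N that by (intro less_imp_le) auto
        from mult_left_mono[OF this l] show ?thesis by simp
      qed
      also have "\<dots> = e\<^sup>2 / (l + 1) * l" by simp
      also have "\<dots> < e\<^sup>2" using \<open>0 < e\<close> l by (simp add: field_simps)
      finally show ?thesis using \<open>0 < e\<close> by (intro power_less_imp_less_base[of _ 2 e]) auto
    qed
    then show ?thesis by blast
  qed
  obtain r where r: "strict_mono r" "AE x in ?M. Cauchy (\<lambda>i. v (r i) x)"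
    using cauchy_L1_AE_cauchy_subseq[of ?M v] L2_on_integrable[OF v] cau1 by blast
  define w where "w = (\<lambda>x. lim (\<lambda>i. v (r i) x))"
  have wm[measurable]: "w \<in> borel_measurable ?M" unfolding w_def by measurable
  have lim: "AE x in ?M. (\<lambda>i. v (r i) x) \<longlonglongrightarrow> w x"
    using r(2) by eventually_elim (auto simp: w_def Cauchy_convergent_iff convergent_LIMSEQ_iff)
  \<comment> \<open>Fatou's lemma along \<open>r\<close>: the bound on \<open>v n - v (r i)\<close>
    survives the limit in \<open>i\<close> and yields integrability together with the
    estimate.\<close>
  have key: "L2_on l (\<lambda>x. v n x - w x) \<and> sqn l (\<lambda>x. v n x - w x) \<le> e"
    if e: "0 < e" and N: "\<forall>m\<ge>N. \<forall>n\<ge>N. sqn l (\<lambda>x. v m x - v n x) < e" and n: "N \<le> n" for e N n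
  proof -
    have "(\<integral>\<^sup>+x. ennreal ((cmod (v n x - w x))\<^sup>2) \<partial>?M) = (\<integral>\<^sup>+x. liminf (\<lambda>i. ennreal ((cmod (v n x - v (r i) x))\<^sup>2)) \<partial>?M)"
    proof (rule nn_integral_cong_AE, use lim in eventually_elim)
      fix x assume "(\<lambda>i. v (r i) x) \<longlonglongrightarrow> w x"
      then have "(\<lambda>i. ennreal ((cmod (v n x - v (r i) x))\<^sup>2)) \<longlonglongrightarrow> ennreal ((cmod (v n x - w x))\<^sup>2)"
        by (intro tendsto_intros tendsto_ennrealI)
      then show "ennreal ((cmod (v n x - w x))\<^sup>2) = liminf (\<lambda>i. ennreal ((cmod (v n x - v (r i) x))\<^sup>2))"
        by (rule lim_imp_Liminf[symmetric, OF trivial_limit_sequentially])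
    qed
    also have "\<dots> \<le> liminf (\<lambda>i. \<integral>\<^sup>+x. ennreal ((cmod (v n x - v (r i) x))\<^sup>2) \<partial>?M)"
      by (rule nn_integral_liminf) measurable
    also have "\<dots> \<le> liminf (\<lambda>i. ennreal e)"
    proof (rule Liminf_mono, rule eventually_sequentiallyI)
      fix i assume "N \<le> i"
      then have "N \<le> r i" using seq_suble[OF r(1), of i] by simp
      have "(\<integral>\<^sup>+x. ennreal ((cmod (v n x - v (r i) x))\<^sup>2) \<partial>?M) = ennreal (sqn l (\<lambda>x. v n x - v (r i) x))"
        unfolding sqn_def using L2_onD(2)[OF L2_on_diff[OF v v]] by (intro nn_integral_eq_integral) auto
      also have "\<dots> \<le> ennreal e" using N n \<open>N \<le> r i\<close> by (intro ennreal_leI less_imp_le) auto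
      finally show "(\<integral>\<^sup>+x. ennreal ((cmod (v n x - v (r i) x))\<^sup>2) \<partial>?M) \<le> ennreal e" .
    qed
    finally have nn: "(\<integral>\<^sup>+x. ennreal ((cmod (v n x - w x))\<^sup>2) \<partial>?M) \<le> ennreal e"
      by (simp add: Liminf_const)
    have int: "integrable ?M (\<lambda>x. (cmod (v n x - w x))\<^sup>2)"
      using le_less_trans[OF nn ennreal_less_top] by (intro integrableI_bounded) auto
    then have "ennreal (sqn l (\<lambda>x. v n x - w x)) \<le> ennreal e"
      using nn nn_integral_eq_integral[OF int] by (simp add: sqn_def)
    then have "sqn l (\<lambda>x. v n x - w x) \<le> e" using e by simp
    moreover have "L2_on l (\<lambda>x. v n x - w x)" using int by (simp add: L2_on_def)
    ultimately show ?thesis by simp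
  qed
  have "L2_on l w"
  proof -
    obtain N where "\<forall>m\<ge>N. \<forall>n\<ge>N. sqn l (\<lambda>x. v m x - v n x) < 1" using cau[of 1] by auto
    from key[OF _ this order_refl] have "L2_on l (\<lambda>x. v N x - w x)" by simp
    from L2_on_diff[OF v[of N] this] show ?thesis by simp
  qed
  moreover have "(\<lambda>n. sqn l (\<lambda>x. v n x - w x)) \<longlonglongrightarrow> 0"
  proof (rule LIMSEQ_I)
    fix e :: real assume e: "0 < e"
    then have "0 < e / 2" by simp
    from cau[OF this] obtain N where N: "\<forall>m\<ge>N. \<forall>n\<ge>N. sqn l (\<lambda>x. v m x - v n x) < e / 2" by blast
    have "norm (sqn l (\<lambda>x. v n x - w x) - 0) < e" if "N \<le> n" for n
      using key[OF \<open>0 < e / 2\<close> N that] e sqn_nonneg[of l "\<lambda>x. v n x - w x"] by simp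
    then show "\<exists>N. \<forall>n\<ge>N. norm (sqn l (\<lambda>x. v n x - w x) - 0) < e" by blast
  qed
  ultimately show ?thesis by blast
qed

text \<open>The limit is the primitive of the limit \<open>w'\<close> of the derivatives, with the
  limit of \<open>u n 0\<close> as initial value. The Hoelder estimate then bounds
  \<open>u n - w\<close> uniformly, so the end values converge too; this is what keeps boundary
  conditions closed.\<close>

lemma weak_deriv_on_complete:
  assumes l: "0 < l" and wd: "\<And>n. weak_deriv_on l (u n) (u' n)"
    and c1: "\<And>\<epsilon>. 0 < \<epsilon> \<Longrightarrow> \<exists>N. \<forall>m\<ge>N. \<forall>n\<ge>N. sqn l (\<lambda>x. u m x - u n x) < \<epsilon>"
    and c2: "\<And>\<epsilon>. 0 < \<epsilon> \<Longrightarrow> \<exists>N. \<forall>m\<ge>N. \<forall>n\<ge>N. sqn l (\<lambda>x. u' m x - u' n x) < \<epsilon>"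
  shows "\<exists>w w'. weak_deriv_on l w w' \<and> (\<lambda>n. sqn l (\<lambda>x. u n x - w x)) \<longlonglongrightarrow> 0 \<and>
    (\<lambda>n. sqn l (\<lambda>x. u' n x - w' x)) \<longlonglongrightarrow> 0 \<and> (\<forall>x\<in>{0..l}. (\<lambda>n. u n x) \<longlonglongrightarrow> w x)"
proof -
  obtain w' where w': "L2_on l w'" "(\<lambda>n. sqn l (\<lambda>x. u' n x - w' x)) \<longlonglongrightarrow> 0"
    using L2_on_complete[of l u'] weak_deriv_onD(1)[OF wd] l c2 by auto
  have "Cauchy (\<lambda>n. u n 0)"
  proof (rule CauchyI)
    fix e :: real assume e: "0 < e"
    \<comment> \<open>The divisor is the constant of \<open>weak_deriv_on_sup\<close> for
      \<open>\<delta> = l\<close>.\<close>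
    define \<eta> where "\<eta> = e\<^sup>2 / (2 / l + 2 * l)"
    have D: "0 < 2 / l + 2 * l" using l by (simp add: add_pos_pos)
    then have \<eta>: "0 < \<eta>" using e by (simp add: \<eta>_def)
    obtain N1 where N1: "\<forall>m\<ge>N1. \<forall>n\<ge>N1. sqn l (\<lambda>x. u m x - u n x) < \<eta>" using c1[OF \<eta>] by blast
    obtain N2 where N2: "\<forall>m\<ge>N2. \<forall>n\<ge>N2. sqn l (\<lambda>x. u' m x - u' n x) < \<eta>" using c2[OF \<eta>] by blast
    have "norm (u m 0 - u n 0) < e" if "max N1 N2 \<le> m" "max N1 N2 \<le> n" for m n
    proof -
      have "(cmod (u m 0 - u n 0))\<^sup>2 \<le> 2 / l * sqn l (\<lambda>x. u m x - u n x) + 2 * l * sqn l (\<lambda>x. u' m x - u' n x)"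
        using l weak_deriv_on_sup[OF weak_deriv_on_diff[OF wd[of m] wd[of n]], of l 0] by simp
      also have "\<dots> < 2 / l * \<eta> + 2 * l * \<eta>"
        using N1 N2 that l by (intro add_strict_mono mult_strict_left_mono) auto
      also have "\<dots> = (2 / l + 2 * l) * \<eta>" by (simp only: distrib_right)
      also have "\<dots> = e\<^sup>2" using D by (simp add: \<eta>_def)
      finally show ?thesis using e by (simp add: power_less_imp_less_base)
    qed
    then show "\<exists>M. \<forall>m\<ge>M. \<forall>n\<ge>M. norm (u m 0 - u n 0) < e" by blast
  qed
  then obtain c where c: "(\<lambda>n. u n 0) \<longlonglongrightarrow> c" using Cauchy_convergent convergent_def by blast
  define w where "w = (\<lambda>x. c + integral\<^sup>L (lebesgue_on {0..x}) w')"
  have ww: "weak_deriv_on l w w'" unfolding w_def by (rule weak_deriv_on_primitive[OF w'(1)])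
  have w0: "w 0 = c" by (simp add: w_def integral_eq_zero_null_sets)
  define b where "b = (\<lambda>n. 2 * (cmod (u n 0 - c))\<^sup>2 + 2 * (l * sqn l (\<lambda>x. u' n x - w' x)))"
  have "b \<longlonglongrightarrow> 2 * (cmod (c - c))\<^sup>2 + 2 * (l * 0)" unfolding b_def by (intro tendsto_intros c w')
  then have b: "b \<longlonglongrightarrow> 0" by simp
  have le: "(cmod (u n x - w x))\<^sup>2 \<le> b n" if x: "x \<in> {0..l}" for n x
  proof -
    have "(cmod ((u n x - w x) - (u n 0 - w 0)))\<^sup>2 \<le> \<bar>x - 0\<bar> * sqn l (\<lambda>x. u' n x - w' x)"
      using x l by (intro weak_deriv_on_holder[OF weak_deriv_on_diff[OF wd ww]]) auto
    also have "\<dots> \<le> l * sqn l (\<lambda>x. u' n x - w' x)" using x by (intro mult_right_mono sqn_nonneg) auto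
    finally show ?thesis
      using norm_add_squared_le[of "u n 0 - w 0" "(u n x - w x) - (u n 0 - w 0)"] by (simp add: b_def w0)
  qed
  have "(\<lambda>n. u n x) \<longlonglongrightarrow> w x" if x: "x \<in> {0..l}" for x
  proof -
    have "(\<lambda>n. sqrt (b n)) \<longlonglongrightarrow> sqrt 0" by (intro tendsto_intros b)
    then have s: "(\<lambda>n. sqrt (b n)) \<longlonglongrightarrow> 0" by simp
    have "(\<lambda>n. u n x - w x) \<longlonglongrightarrow> 0"
      by (rule Lim_null_comparison[OF always_eventually s]) (use le[OF x] in \<open>auto intro: real_le_rsqrt\<close>)
    then show ?thesis by (simp add: LIM_zero_iff)
  qed
  moreover have "(\<lambda>n. sqn l (\<lambda>x. u n x - w x)) \<longlonglongrightarrow> 0"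
  proof (rule real_tendsto_sandwich[of "\<lambda>_. 0" _ _ "\<lambda>n. l * b n"])
    have "sqn l (\<lambda>x. u n x - w x) \<le> l * b n" for n
      using l le by (intro sqn_le_sup weak_deriv_on_L2[OF weak_deriv_on_diff[OF wd ww]]) auto
    then show "\<forall>\<^sub>F n in sequentially. sqn l (\<lambda>x. u n x - w x) \<le> l * b n" by simp
    have "(\<lambda>n. l * b n) \<longlonglongrightarrow> l * 0" by (intro tendsto_intros b)
    then show "(\<lambda>n. l * b n) \<longlonglongrightarrow> 0" by simp
  qed (auto simp: sqn_nonneg)
  ultimately show ?thesis using ww w'(2) by blast
qed

text \<open>Rellich's theorem in one dimension: the trace inequality gives a uniform bound, the
  Hoelder estimate gives equicontinuity, and Arzela-Ascoli gives a uniformly convergent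
  subsequence.\<close>

lemma weak_deriv_on_compact:
  assumes l: "0 < l" and wd: "\<And>n. weak_deriv_on l (u n) (u' n)"
    and K: "\<And>n. sqn l (u n) \<le> K" "\<And>n. sqn l (u' n) \<le> K"
  shows "\<exists>r::nat \<Rightarrow> nat. strict_mono r \<and>
    double_null (\<lambda>m n. sqn l (\<lambda>x. u (r m) x - u (r n) x))"
proof -
  have K0: "0 \<le> K" using K(1)[of 0] sqn_nonneg order_trans by blast
  have holder: "(cmod (u n x - u n y))\<^sup>2 \<le> \<bar>x - y\<bar> * K" if "x \<in> {0..l}" "y \<in> {0..l}" for n x y
    using weak_deriv_on_holder[OF wd that] mult_left_mono[OF K(2), of "\<bar>x - y\<bar>" n] by (meson abs_ge_zero order_trans)
  have bound: "norm (u n x) \<le> sqrt (2 / l * K + 2 * l * K)" if "x \<in> {0..l}" for n x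
  proof (rule real_le_rsqrt)
    have "(cmod (u n x))\<^sup>2 \<le> 2 / l * sqn l (u n) + 2 * l * sqn l (u' n)"
      using l that by (intro weak_deriv_on_sup[OF wd]) auto
    also have "\<dots> \<le> 2 / l * K + 2 * l * K" using l by (intro add_mono mult_left_mono K) auto
    finally show "(cmod (u n x))\<^sup>2 \<le> 2 / l * K + 2 * l * K" .
  qed
  have equi: "\<exists>d>0. \<forall>n y. y \<in> {0..l} \<and> norm (x - y) < d \<longrightarrow> norm (u n x - u n y) < e"
    if "x \<in> {0..l}" "0 < e" for x e
  proof (intro exI conjI allI impI)
    show "0 < e\<^sup>2 / (K + 1)" using that K0 by simp
    fix n y assume "y \<in> {0..l} \<and> norm (x - y) < e\<^sup>2 / (K + 1)"
    then show "norm (u n x - u n y) < e"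
      using that K0 by (intro holder_modulus[of "{0..l}" "u n" K]) (auto intro: holder)
  qed
  obtain g and k :: "nat \<Rightarrow> nat" where g: "continuous_on {0..l} g" and k: "strict_mono k"
    and unif: "\<And>e. 0 < e \<Longrightarrow> \<exists>N. \<forall>n x. n \<ge> N \<and> x \<in> {0..l} \<longrightarrow> norm (u (k n) x - g x) < e"
    using Arzela_Ascoli[of "{0..l}" u, OF compact_Icc bound equi] by blast
  have "\<exists>N. \<forall>m\<ge>N. \<forall>n\<ge>N. sqn l (\<lambda>x. u (k m) x - u (k n) x) < \<epsilon>" if "0 < \<epsilon>" for \<epsilon>
  proof -
    \<comment> \<open>Two members are within \<open>2 * e\<close> of each other, so their
      \<open>sqn\<close> distance is at most \<open>l * (2 * e)^2\<close>, which is
      \<epsilon>/2.\<close>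
    define e where "e = sqrt (\<epsilon> / (8 * l))"
    have e: "0 < e" "e\<^sup>2 = \<epsilon> / (8 * l)" using that l by (auto simp: e_def)
    obtain N where N: "\<And>n x. N \<le> n \<Longrightarrow> x \<in> {0..l} \<Longrightarrow> norm (u (k n) x - g x) < e"
      using unif[OF e(1)] by blast
    have "sqn l (\<lambda>x. u (k m) x - u (k n) x) < \<epsilon>" if mn: "N \<le> m" "N \<le> n" for m n
    proof -
      have "sqn l (\<lambda>x. u (k m) x - u (k n) x) \<le> l * (2 * e)\<^sup>2"
      proof (rule sqn_le_sup)
        show "L2_on l (\<lambda>x. u (k m) x - u (k n) x)" by (intro L2_on_diff weak_deriv_on_L2[OF wd])
        fix x assume x: "x \<in> {0..l}"
        have "cmod (u (k m) x - u (k n) x) \<le> cmod (u (k m) x - g x) + cmod (u (k n) x - g x)"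
          using norm_triangle_ineq4[of "u (k m) x - g x" "u (k n) x - g x"] by simp
        also have "\<dots> \<le> 2 * e" using N[OF mn(1) x] N[OF mn(2) x] by simp
        finally show "(cmod (u (k m) x - u (k n) x))\<^sup>2 \<le> (2 * e)\<^sup>2" by (intro power_mono) auto
      qed (use l in simp)
      also have "\<dots> = \<epsilon> / 2" using l by (simp add: power_mult_distrib e(2))
      finally show ?thesis using \<open>0 < \<epsilon>\<close> by simp
    qed
    then show ?thesis by blast
  qed
  then show ?thesis using k by blast
qed

text \<open>The lemma of du Bois-Reymond: the test functions are the primitives of \<open>u' - W - m\<close>, where \<open>W\<close>
  is a primitive of \<open>F\<close> and \<open>m\<close> is the mean of \<open>u' - W\<close>.\<close>

lemma weak_deriv_on_if_weak_form:
  assumes l: "0 < l" and wd: "weak_deriv_on l u u'" and F: "L2_on l F"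
    and test: "\<And>g g'. \<lbrakk>weak_deriv_on l g g'; g 0 = 0; g l = 0\<rbrakk> \<Longrightarrow>
      (LINT x|Leb l. u' x * cnj (g' x)) + (LINT x|Leb l. F x * cnj (g x)) = 0"
  shows "\<exists>w. weak_deriv_on l u w \<and> weak_deriv_on l w F"
proof -
  let ?M = "Leb l"
  define W where "W = (\<lambda>x. 0 + integral\<^sup>L (lebesgue_on {0..x}) F)"
  have W: "weak_deriv_on l W F" unfolding W_def by (rule weak_deriv_on_primitive[OF F])
  define d where "d = (\<lambda>x. u' x - W x)"
  have d: "L2_on l d" unfolding d_def by (intro L2_on_diff weak_deriv_onD(1)[OF wd] weak_deriv_on_L2[OF W])
  define m where "m = integral\<^sup>L ?M d / of_real l"
  define p where "p = (\<lambda>x. d x - m)"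
  have p: "L2_on l p" unfolding p_def by (intro L2_on_diff d L2_on_const)
  define g where "g = (\<lambda>x. 0 + integral\<^sup>L (lebesgue_on {0..x}) p)"
  have g: "weak_deriv_on l g p" unfolding g_def by (rule weak_deriv_on_primitive[OF p])
  have g0: "g 0 = 0" by (simp add: g_def integral_eq_zero_null_sets)
  have ip: "integral\<^sup>L ?M p = 0"
    unfolding p_def using l L2_on_integrable[OF d] integrable_const_interval[of 0 l m]
      integral_const_interval_complex[of 0 l m] by (simp add: m_def)
  then have gl: "g l = 0" by (simp add: g_def)
  note cp = L2_on_cnj[OF p]
  have "(LINT x|?M. F x * cnj (g x)) + (LINT x|?M. W x * cnj (p x)) = 0"
    using weak_deriv_on_parts[OF W weak_deriv_on_cnj[OF g]] l g0 gl by simp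
  then have 1: "(LINT x|?M. u' x * cnj (p x)) - (LINT x|?M. W x * cnj (p x)) = 0"
    using test[OF g g0 gl] by (simp add: add_eq_0_iff2)
  have i1: "integrable ?M (\<lambda>x. u' x * cnj (p x))" "integrable ?M (\<lambda>x. W x * cnj (p x))" "integrable ?M (\<lambda>x. m * cnj (p x))"
    using L2_on_integrable_mult[OF weak_deriv_onD(1)[OF wd] cp] L2_on_integrable_mult[OF weak_deriv_on_L2[OF W] cp]
      L2_on_integrable[OF cp] by auto
  \<comment> \<open>\<open>p\<close> has mean 0, so the constant \<open>m\<close> drops out; the
    remaining difference vanishes by the test identity and integration by parts for
    \<open>W\<close>.\<close>
  have "(LINT x|?M. p x * cnj (p x)) = (LINT x|?M. u' x * cnj (p x) - W x * cnj (p x) - m * cnj (p x))"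
    by (intro Bochner_Integration.integral_cong) (auto simp: p_def d_def algebra_simps)
  also have "\<dots> = - m * cnj (integral\<^sup>L ?M p)"
    using i1 1 by simp
  finally have "(LINT x|?M. p x * cnj (p x)) = 0" using ip by simp
  then have "sqn l p = 0" by (simp add: integral_mult_cnj_self)
  then have "AE x in ?M. (cmod (p x))\<^sup>2 = 0"
    unfolding sqn_def using L2_onD(2)[OF p] by (subst (asm) integral_nonneg_eq_0_iff_AE) auto
  then have ae: "AE x in ?M. u' x = W x + m"
    by eventually_elim (simp add: p_def d_def algebra_simps)
  have wW: "weak_deriv_on l (\<lambda>x. W x + m) (\<lambda>x. F x + 0)"
    by (intro weak_deriv_on_add W weak_deriv_on_const)
  have "weak_deriv_on l u (\<lambda>x. W x + m)"
    by (rule weak_deriv_on_cong[OF wd weak_deriv_on_L2[OF wW] ae]) simp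
  then show ?thesis using wW by auto
qed

section \<open>The quadratic form of a metric graph\<close>

text \<open>The choice is determined only up to null sets. It is therefore linear in
  \<open>u\<close> only under integrals, and only for \<open>u\<close> that have a weak
  derivative.\<close>

definition wderiv :: "real \<Rightarrow> (real \<Rightarrow> complex) \<Rightarrow> real \<Rightarrow> complex" where
  "wderiv l u = (SOME u'. weak_deriv_on l u u')"

text \<open>The default 0 off the graph lets boundary vectors be compared as functions on the whole
  type.\<close>

definition etrace :: "'e set \<Rightarrow> ('e \<Rightarrow> real) \<Rightarrow> ('e \<Rightarrow> real \<Rightarrow> complex) \<Rightarrow> 'e \<times> bool \<Rightarrow> complex" where
  "etrace E l f a = (if fst a \<in> E then f (fst a) (if snd a then l (fst a) else 0) else 0)"

definition dtrace :: "('e \<Rightarrow> real) \<Rightarrow> ('e \<Rightarrow> real \<Rightarrow> complex) \<Rightarrow> 'e \<times> bool \<Rightarrow> complex" where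
  "dtrace l f a = (if snd a then - vector_derivative (f (fst a)) (at (l (fst a)) within {0..l (fst a)})
     else vector_derivative (f (fst a)) (at 0 within {0..l (fst a)}))"

text \<open>The pairing of the derivative data \<open>T F\<close> with the values \<open>G\<close>,
  taken over all edge-ends.\<close>

definition bform :: "'e set \<Rightarrow> ('e \<times> bool \<Rightarrow> 'e \<times> bool \<Rightarrow> complex) \<Rightarrow>
    ('e \<times> bool \<Rightarrow> complex) \<Rightarrow> ('e \<times> bool \<Rightarrow> complex) \<Rightarrow> complex" where
  "bform E T F G = (\<Sum>a\<in>E \<times> UNIV. \<Sum>c\<in>E \<times> UNIV. T a c * F c * cnj (G a))"

definition h1_space :: "'e set \<Rightarrow> ('e \<Rightarrow> real) \<Rightarrow> ('e \<times> bool \<Rightarrow> complex) set \<Rightarrow> ('e \<Rightarrow> real \<Rightarrow> complex) set" where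
  "h1_space E l X = {f. (\<forall>e x. \<not> (e \<in> E \<and> x \<in> {0..l e}) \<longrightarrow> f e x = 0) \<and>
     (\<forall>e\<in>E. \<exists>u'. weak_deriv_on (l e) (f e) u') \<and> etrace E l f \<in> X}"

definition graph_ip :: "'e set \<Rightarrow> ('e \<Rightarrow> real) \<Rightarrow> ('e \<Rightarrow> real \<Rightarrow> complex) \<Rightarrow> ('e \<Rightarrow> real \<Rightarrow> complex) \<Rightarrow> complex" where
  "graph_ip E l f g = (\<Sum>e\<in>E. LINT x|lebesgue_on {0..l e}. f e x * cnj (g e x))"

definition graph_form :: "'e set \<Rightarrow> ('e \<Rightarrow> real) \<Rightarrow> ('e \<Rightarrow> real \<Rightarrow> real) \<Rightarrow> ('e \<times> bool \<Rightarrow> 'e \<times> bool \<Rightarrow> complex) \<Rightarrow>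
    ('e \<Rightarrow> real \<Rightarrow> complex) \<Rightarrow> ('e \<Rightarrow> real \<Rightarrow> complex) \<Rightarrow> complex" where
  "graph_form E l V T f g = (\<Sum>e\<in>E. (LINT x|lebesgue_on {0..l e}. wderiv (l e) (f e) x * cnj (wderiv (l e) (g e) x)) +
      (LINT x|lebesgue_on {0..l e}. of_real (V e x) * f e x * cnj (g e x))) +
    bform E T (etrace E l f) (etrace E l g)"

lemma weak_deriv_on_wderiv: "weak_deriv_on l u u' \<Longrightarrow> weak_deriv_on l u (wderiv l u)"
  unfolding wderiv_def by (rule someI[of "weak_deriv_on l u"])

lemma wderiv_AE: "weak_deriv_on l u u' \<Longrightarrow> AE x in Leb l. wderiv l u x = u' x"
  by (intro weak_deriv_on_unique[of l u]) (auto intro: weak_deriv_on_wderiv)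

lemma sqn_wderiv: "weak_deriv_on l u u' \<Longrightarrow> sqn l (wderiv l u) = sqn l u'"
  by (intro L2_on_cong_AE wderiv_AE weak_deriv_onD(1)[OF weak_deriv_on_wderiv] weak_deriv_onD(1))

lemma integral_mult_cnj_commute:
  "(LINT x|N. g x * cnj (f x)) = cnj (LINT x|N. f x * cnj (g x :: complex))"
proof -
  have "(\<lambda>x. g x * cnj (f x)) = (\<lambda>x. cnj (f x * cnj (g x)))" by (simp add: mult.commute)
  then show ?thesis by (simp only: Bochner_Integration.integral_cnj)
qed

lemma sum_fun_apply2: "(\<Sum>i\<in>I. F i) e x = (\<Sum>i\<in>I. F i e x)"
  by (induction I rule: infinite_finite_induct) auto

lemma integral_wderiv_left:
  assumes "weak_deriv_on l u u'" "L2_on l w"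
  shows "(LINT x|Leb l. wderiv l u x * cnj (w x)) = (LINT x|Leb l. u' x * cnj (w x))"
proof (rule integral_cong_AE)
  note w = L2_on_cnj[OF assms(2)]
  show "(\<lambda>x. wderiv l u x * cnj (w x)) \<in> borel_measurable (Leb l)"
    "(\<lambda>x. u' x * cnj (w x)) \<in> borel_measurable (Leb l)"
    by (intro borel_measurable_integrable L2_on_integrable_mult w
        weak_deriv_onD(1)[OF weak_deriv_on_wderiv[OF assms(1)]] weak_deriv_onD(1)[OF assms(1)])+
  show "AE x in Leb l. wderiv l u x * cnj (w x) = u' x * cnj (w x)"
    using wderiv_AE[OF assms(1)] by eventually_elim simp
qed

lemma integral_wderiv_right:
  assumes "weak_deriv_on l u u'" "L2_on l w"
  shows "(LINT x|Leb l. w x * cnj (wderiv l u x)) = (LINT x|Leb l. w x * cnj (u' x))"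
  using integral_wderiv_left[OF assms] integral_mult_cnj_commute[where g = w] by simp

lemma sum_cauchy:
  fixes a :: "'i \<Rightarrow> nat \<Rightarrow> nat \<Rightarrow> real"
  assumes "finite I" "\<And>i \<epsilon>. i \<in> I \<Longrightarrow> 0 < \<epsilon> \<Longrightarrow> \<exists>N. \<forall>m\<ge>N. \<forall>n\<ge>N. a i m n < \<epsilon>" "0 < \<epsilon>"
  shows "\<exists>N. \<forall>m\<ge>N. \<forall>n\<ge>N. (\<Sum>i\<in>I. a i m n) < \<epsilon>"
  using assms
proof (induction I arbitrary: \<epsilon> rule: finite_induct)
  case (insert i I)
  have \<epsilon>: "0 < \<epsilon> / 2" using insert.prems by simp
  obtain N1 where N1: "\<forall>m\<ge>N1. \<forall>n\<ge>N1. a i m n < \<epsilon> / 2" using insert.prems(1)[OF _ \<epsilon>] by blast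
  obtain N2 where N2: "\<forall>m\<ge>N2. \<forall>n\<ge>N2. (\<Sum>i\<in>I. a i m n) < \<epsilon> / 2"
    using insert.IH[OF _ \<epsilon>] insert.prems(1) by auto
  have "(\<Sum>i\<in>insert i I. a i m n) < \<epsilon>" if "max N1 N2 \<le> m" "max N1 N2 \<le> n" for m n
  proof -
    have "a i m n < \<epsilon> / 2" "(\<Sum>i\<in>I. a i m n) < \<epsilon> / 2" using N1 N2 that by auto
    then show ?thesis using insert.hyps by simp
  qed
  then show ?case by blast
qed simp

text \<open>Vertices enter only through the admissible boundary values \<open>X\<close> and the
  boundary matrix \<open>T\<close>. Closedness of \<open>X\<close> under pointwise limits is what
  makes the form domain complete, and \<open>T\<close> has to be Hermitian on \<open>X\<close>
  only.\<close>

locale metric_graph_form =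
  fixes E :: "'e set" and l :: "'e \<Rightarrow> real" and V :: "'e \<Rightarrow> real \<Rightarrow> real"
    and X :: "('e \<times> bool \<Rightarrow> complex) set" and T :: "'e \<times> bool \<Rightarrow> 'e \<times> bool \<Rightarrow> complex"
  assumes finE: "finite E" and neE: "E \<noteq> {}"
    and lpos: "e \<in> E \<Longrightarrow> 0 < l e" and VL2: "e \<in> E \<Longrightarrow> L2_on (l e) (V e)"
    and X_supp: "\<lbrakk>F \<in> X; fst a \<notin> E\<rbrakk> \<Longrightarrow> F a = 0"
    and X_zero: "(\<lambda>_. 0) \<in> X"
    and X_add: "\<lbrakk>F \<in> X; G \<in> X\<rbrakk> \<Longrightarrow> (\<lambda>a. F a + G a) \<in> X"
    and X_scale: "F \<in> X \<Longrightarrow> (\<lambda>a. c * F a) \<in> X"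
    and X_closed: "\<lbrakk>\<And>n::nat. Fs n \<in> X; \<And>a. (\<lambda>n. Fs n a) \<longlonglongrightarrow> F a\<rbrakk> \<Longrightarrow> F \<in> X"
    and T_herm: "\<lbrakk>F \<in> X; G \<in> X\<rbrakk> \<Longrightarrow> bform E T G F = cnj (bform E T F G)"
begin

abbreviation "Q \<equiv> h1_space E l X"
abbreviation "ip \<equiv> graph_ip E l"
abbreviation "hf \<equiv> graph_form E l V T"
abbreviation "tr \<equiv> etrace E l"
abbreviation "M e \<equiv> lebesgue_on {0..l e}"
abbreviation "egrad e f g \<equiv> LINT x|M e. wderiv (l e) (f e) x * cnj (wderiv (l e) (g e) x)"
abbreviation "epot e f g \<equiv> LINT x|M e. of_real (V e x) * f e x * cnj (g e x)"
abbreviation "eip e f g \<equiv> LINT x|M e. f e x * cnj (g e x)"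

definition nsq :: "('e \<Rightarrow> real \<Rightarrow> complex) \<Rightarrow> real" where
  "nsq f = (\<Sum>e\<in>E. sqn (l e) (f e))"
definition dsq :: "('e \<Rightarrow> real \<Rightarrow> complex) \<Rightarrow> real" where
  "dsq f = (\<Sum>e\<in>E. sqn (l e) (wderiv (l e) (f e)))"

lemma QD:
  assumes "f \<in> Q"
  shows "\<not> (e \<in> E \<and> x \<in> {0..l e}) \<Longrightarrow> f e x = 0" "e \<in> E \<Longrightarrow> weak_deriv_on (l e) (f e) (wderiv (l e) (f e))"
    "tr f \<in> X"
  using assms by (auto simp: h1_space_def intro: weak_deriv_on_wderiv)

lemma QI:
  assumes "\<And>e x. \<not> (e \<in> E \<and> x \<in> {0..l e}) \<Longrightarrow> f e x = 0" "\<And>e. e \<in> E \<Longrightarrow> weak_deriv_on (l e) (f e) (u' e)"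
    "tr f \<in> X"
  shows "f \<in> Q"
  using assms unfolding h1_space_def by blast

lemma Q_L2: "f \<in> Q \<Longrightarrow> e \<in> E \<Longrightarrow> L2_on (l e) (f e)"
  "f \<in> Q \<Longrightarrow> e \<in> E \<Longrightarrow> L2_on (l e) (wderiv (l e) (f e))"
  using weak_deriv_on_L2[OF QD(2)] weak_deriv_onD(1)[OF QD(2)] by auto

lemma VL2_mult: "f \<in> Q \<Longrightarrow> e \<in> E \<Longrightarrow> L2_on (l e) (\<lambda>x. of_real (V e x) * f e x)"
  by (intro L2_on_mult_continuous L2_on_of_real VL2 weak_deriv_on_continuous[OF QD(2)])

lemma etrace_zero: "tr 0 = (\<lambda>_. 0)"
  by (auto simp: etrace_def fun_eq_iff)

lemma etrace_add: "tr (f + g) = (\<lambda>a. tr f a + tr g a)"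
  by (auto simp: etrace_def fun_eq_iff)

lemma etrace_scale: "tr (fscale c f) = (\<lambda>a. c * tr f a)"
  by (auto simp: etrace_def fun_eq_iff fscale_def)

lemma Q_add_weak: "\<lbrakk>f \<in> Q; g \<in> Q; e \<in> E\<rbrakk> \<Longrightarrow>
    weak_deriv_on (l e) ((f + g) e) (\<lambda>x. wderiv (l e) (f e) x + wderiv (l e) (g e) x)"
  using weak_deriv_on_add[OF QD(2) QD(2), of f e g] by (simp add: plus_fun_def)

lemma Q_diff_weak: "\<lbrakk>f \<in> Q; g \<in> Q; e \<in> E\<rbrakk> \<Longrightarrow>
    weak_deriv_on (l e) ((f - g) e) (\<lambda>x. wderiv (l e) (f e) x - wderiv (l e) (g e) x)"
  using weak_deriv_on_diff[OF QD(2) QD(2), of f e g] by (simp add: fun_diff_def)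

lemma Q_scale_weak: "\<lbrakk>f \<in> Q; e \<in> E\<rbrakk> \<Longrightarrow>
    weak_deriv_on (l e) (fscale c f e) (\<lambda>x. c * wderiv (l e) (f e) x)"
  using weak_deriv_on_scale[OF QD(2), of f e c] by (simp add: fscale_def)

lemma subspace_Q: "fun_space.subspace Q"
proof (rule fun_space.subspaceI)
  show "0 \<in> Q"
  proof (rule QI)
    show "tr 0 \<in> X" using X_zero by (simp add: etrace_zero)
    show "weak_deriv_on (l e) (0 e) (\<lambda>_. 0)" for e using weak_deriv_on_const[of "l e" 0] by (simp add: zero_fun_def)
  qed simp
  show "f + g \<in> Q" if "f \<in> Q" "g \<in> Q" for f g
  proof (rule QI)
    show "tr (f + g) \<in> X" unfolding etrace_add by (intro X_add QD(3) that)
    show "weak_deriv_on (l e) ((f + g) e) (\<lambda>x. wderiv (l e) (f e) x + wderiv (l e) (g e) x)" if "e \<in> E" for e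
      by (rule Q_add_weak[OF \<open>f \<in> Q\<close> \<open>g \<in> Q\<close> that])
    show "(f + g) e x = 0" if "\<not> (e \<in> E \<and> x \<in> {0..l e})" for e x
      using QD(1)[OF \<open>f \<in> Q\<close> that] QD(1)[OF \<open>g \<in> Q\<close> that] by simp
  qed
  show "fscale c f \<in> Q" if "f \<in> Q" for c f
  proof (rule QI)
    show "tr (fscale c f) \<in> X" unfolding etrace_scale by (intro X_scale QD(3) that)
    show "weak_deriv_on (l e) (fscale c f e) (\<lambda>x. c * wderiv (l e) (f e) x)" if "e \<in> E" for e
      by (rule Q_scale_weak[OF \<open>f \<in> Q\<close> that])
    show "fscale c f e x = 0" if "\<not> (e \<in> E \<and> x \<in> {0..l e})" for e x
      using QD(1)[OF \<open>f \<in> Q\<close> that] by (simp add: fscale_def)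
  qed
qed

lemma integrable_ip: "f \<in> Q \<Longrightarrow> g \<in> Q \<Longrightarrow> e \<in> E \<Longrightarrow> integrable (M e) (\<lambda>x. f e x * cnj (g e x))"
  by (intro L2_on_integrable_mult L2_on_cnj Q_L2)

lemma integrable_pot: "f \<in> Q \<Longrightarrow> g \<in> Q \<Longrightarrow> e \<in> E \<Longrightarrow> integrable (M e) (\<lambda>x. of_real (V e x) * f e x * cnj (g e x))"
  by (intro L2_on_integrable_mult L2_on_cnj Q_L2 VL2_mult)

lemma integrable_grad: "f \<in> Q \<Longrightarrow> g \<in> Q \<Longrightarrow> e \<in> E \<Longrightarrow>
    integrable (M e) (\<lambda>x. wderiv (l e) (f e) x * cnj (wderiv (l e) (g e) x))"
  by (intro L2_on_integrable_mult L2_on_cnj Q_L2)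

sublocale ip: herm_form fscale Q ip
proof
  fix f g k assume fgk: "f \<in> Q" "g \<in> Q" "k \<in> Q"
  show "ip (f + g) k = ip f k + ip g k"
    unfolding graph_ip_def sum.distrib[symmetric] using fgk integrable_ip
    by (intro sum.cong refl) (simp add: distrib_right)
next
  fix f g c assume fg: "f \<in> Q" "g \<in> Q"
  show "ip (fscale c f) g = c * ip f g"
    unfolding graph_ip_def sum_distrib_left by (intro sum.cong refl) (simp add: fscale_def mult.assoc)
next
  fix f g assume fg: "f \<in> Q" "g \<in> Q"
  show "ip g f = cnj (ip f g)"
    unfolding graph_ip_def cnj_sum by (intro sum.cong refl integral_mult_cnj_commute)
qed (rule subspace_Q)

sublocale hf: herm_form fscale Q hf
proof
  fix f g k assume fgk: "f \<in> Q" "g \<in> Q" "k \<in> Q"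
  have "egrad e (f + g) k + epot e (f + g) k =
    (egrad e f k + epot e f k) +
    (egrad e g k + epot e g k)"
    if e: "e \<in> E" for e
    using integral_wderiv_left[OF Q_add_weak[OF fgk(1,2) e] Q_L2(2)[OF fgk(3) e]]
      integrable_pot[OF fgk(1,3) e] integrable_pot[OF fgk(2,3) e] integrable_grad[OF fgk(1,3) e] integrable_grad[OF fgk(2,3) e]
    by (simp add: distrib_right distrib_left)
  moreover have "bform E T (tr (f + g)) (tr k) = bform E T (tr f) (tr k) + bform E T (tr g) (tr k)"
    unfolding bform_def etrace_add sum.distrib[symmetric] by (simp add: distrib_right distrib_left)
  ultimately show "hf (f + g) k = hf f k + hf g k"
    unfolding graph_form_def by (simp add: sum.distrib)
next
  fix f g c assume fg: "f \<in> Q" "g \<in> Q"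
  have "egrad e (fscale c f) g + epot e (fscale c f) g =
    c * (egrad e f g + epot e f g)"
    if e: "e \<in> E" for e
    using integral_wderiv_left[OF Q_scale_weak[OF fg(1) e] Q_L2(2)[OF fg(2) e]]
    by (simp add: distrib_left fscale_def mult.assoc mult.left_commute[of _ c])
  moreover have "bform E T (tr (fscale c f)) (tr g) = c * bform E T (tr f) (tr g)"
    unfolding bform_def etrace_scale sum_distrib_left by (simp add: mult.left_commute mult.assoc)
  ultimately show "hf (fscale c f) g = c * hf f g"
    unfolding graph_form_def by (simp add: sum_distrib_left distrib_left)
next
  fix f g assume fg: "f \<in> Q" "g \<in> Q"
  have pot: "epot e g f = cnj (epot e f g)" for e
    using integral_mult_cnj_commute[where N = "M e" and g = "\<lambda>x. of_real (V e x) * g e x" and f = "f e"]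
    by (simp add: mult_ac)
  show "hf g f = cnj (hf f g)"
    unfolding graph_form_def complex_cnj_add cnj_sum pot T_herm[OF QD(3)[OF fg(1)] QD(3)[OF fg(2)]]
    by (simp only: integral_mult_cnj_commute[where g = "wderiv (l _) (g _)"])
qed (rule subspace_Q)

section \<open>Semiboundedness, compact embedding and completeness of the graph form\<close>

lemma ip_qf: "f \<in> Q \<Longrightarrow> ip.qf f = nsq f"
  by (simp add: ip.qf_def graph_ip_def nsq_def integral_mult_cnj_self)

lemma dsq_nonneg: "0 \<le> dsq f"
  by (auto simp: dsq_def intro!: sum_nonneg sqn_nonneg)

lemma hf_qf:
  assumes "f \<in> Q"
  shows "hf.qf f = dsq f + Re (\<Sum>e\<in>E. LINT x|M e. of_real (V e x) * f e x * cnj (f e x)) + Re (bform E T (tr f) (tr f))"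
  by (simp add: hf.qf_def graph_form_def dsq_def sum.distrib integral_mult_cnj_self)

lemma bform_bound:
  "cmod (bform E T F F) \<le> (\<Sum>a\<in>E \<times> UNIV. \<Sum>c\<in>E \<times> UNIV. cmod (T a c)) * (\<Sum>a\<in>E \<times> UNIV. (cmod (F a))\<^sup>2)"
proof -
  let ?S = "\<Sum>a\<in>E \<times> UNIV. (cmod (F a))\<^sup>2"
  have "cmod (T a c * F c * cnj (F a)) \<le> cmod (T a c) * ?S" if "a \<in> E \<times> UNIV" "c \<in> E \<times> UNIV" for a c
  proof -
    have fin: "finite (E \<times> (UNIV :: bool set))" using finE by simp
    have m: "(cmod (F a))\<^sup>2 \<le> ?S" "(cmod (F c))\<^sup>2 \<le> ?S"
      using that fin by (auto intro: member_le_sum)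
    have "2 * cmod (F c) * cmod (F a) \<le> (cmod (F c))\<^sup>2 + (cmod (F a))\<^sup>2" by (rule sum_squares_bound)
    then have "cmod (F c) * cmod (F a) \<le> ?S" using m by linarith
    then show ?thesis by (simp add: norm_mult mult.assoc mult_left_mono)
  qed
  then have "cmod (bform E T F F) \<le> (\<Sum>a\<in>E \<times> UNIV. \<Sum>c\<in>E \<times> UNIV. cmod (T a c) * ?S)"
    unfolding bform_def by (intro sum_norm_le) blast
  then show ?thesis by (simp add: sum_distrib_right)
qed

text \<open>The boundary form and the potential are both dominated by the suprema of
  \<open>(cmod f)^2\<close> on the edges, the potential through its \<open>L1\<close> norm. By the
  trace inequality these cost only a small multiple of \<open>dsq\<close>.\<close>

lemma form_bound: "\<exists>C\<ge>0. \<forall>f\<in>Q. \<bar>hf.qf f - dsq f\<bar> \<le> dsq f / 2 + C * nsq f"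
proof -
  define t where "t = (\<Sum>a\<in>E \<times> UNIV. \<Sum>c\<in>E \<times> UNIV. cmod (T a c))"
  define v where "v = (\<Sum>e\<in>E. LINT x|M e. \<bar>V e x\<bar>)"
  \<comment> \<open>The trace inequality contributes a factor 2 to both terms, and the two ends of
    an edge double the boundary term. The parameter \<delta> must fit into every edge and satisfy
    \<open>k * \<delta> \<le> 1 / 2\<close>.\<close>
  define k where "k = 4 * t + 2 * v"
  define \<delta> where "\<delta> = min (Min (l ` E)) (1 / (2 * k + 1))"
  have t0: "0 \<le> t" unfolding t_def by (intro sum_nonneg) simp
  have vle: "(LINT x|M e. \<bar>V e x\<bar>) \<le> v" if "e \<in> E" for e
    unfolding v_def using that finE by (intro member_le_sum) auto
  have v0: "0 \<le> v" unfolding v_def by (intro sum_nonneg) simp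
  have k0: "0 \<le> k" using t0 v0 by (simp add: k_def)
  have \<delta>0: "0 < \<delta>" unfolding \<delta>_def using finE neE lpos k0 by simp
  have \<delta>l: "\<delta> \<le> l e" if "e \<in> E" for e
    unfolding \<delta>_def using finE that by (simp add: min.coboundedI1)
  have k\<delta>: "k * \<delta> \<le> 1 / 2"
  proof -
    have "k * \<delta> \<le> k * (1 / (2 * k + 1))" unfolding \<delta>_def using k0 by (intro mult_left_mono) auto
    also have "\<dots> \<le> 1 / 2" using k0 by (simp add: field_simps)
    finally show ?thesis .
  qed
  define C where "C = k / \<delta>"
  have "\<bar>hf.qf f - dsq f\<bar> \<le> dsq f / 2 + C * nsq f" if f: "f \<in> Q" for f
  proof -
    define s where "s = (\<lambda>e. 2 / \<delta> * sqn (l e) (f e) + 2 * \<delta> * sqn (l e) (wderiv (l e) (f e)))"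
    have s0: "0 \<le> s e" for e unfolding s_def using \<delta>0 by (intro add_nonneg_nonneg mult_nonneg_nonneg sqn_nonneg) auto
    have sup: "(cmod (f e x))\<^sup>2 \<le> s e" if "e \<in> E" "x \<in> {0..l e}" for e x
      unfolding s_def using that by (intro weak_deriv_on_sup QD(2)[OF f] \<delta>0 \<delta>l)
    have ssum: "(\<Sum>e\<in>E. s e) = 2 / \<delta> * nsq f + 2 * \<delta> * dsq f"
      by (simp add: s_def nsq_def dsq_def sum.distrib sum_distrib_left)
    have "(\<Sum>a\<in>E \<times> UNIV. (cmod (tr f a))\<^sup>2) \<le> (\<Sum>a\<in>E \<times> (UNIV :: bool set). s (fst a))"
    proof (intro sum_mono)
      fix a assume "a \<in> E \<times> (UNIV :: bool set)"
      then have "fst a \<in> E" by auto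
      then show "(cmod (tr f a))\<^sup>2 \<le> s (fst a)"
        using lpos[of "fst a"] sup[of "fst a" 0] sup[of "fst a" "l (fst a)"] by (simp add: etrace_def)
    qed
    also have "\<dots> = (\<Sum>e\<in>E. \<Sum>b\<in>(UNIV :: bool set). s e)"
      unfolding sum.cartesian_product by (simp add: case_prod_beta)
    also have "\<dots> = 2 * (\<Sum>e\<in>E. s e)" by (simp add: sum_distrib_left)
    finally have "cmod (bform E T (tr f) (tr f)) \<le> t * (2 * (\<Sum>e\<in>E. s e))"
      using bform_bound[of "tr f"] t0 unfolding t_def[symmetric] by (meson mult_left_mono order_trans)
    moreover have "cmod (\<Sum>e\<in>E. LINT x|M e. of_real (V e x) * f e x * cnj (f e x)) \<le> v * (\<Sum>e\<in>E. s e)"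
      unfolding sum_distrib_left
    proof (rule sum_norm_le)
      fix e assume e: "e \<in> E"
      have iV: "integrable (M e) (\<lambda>x. \<bar>V e x\<bar>)"
        using integrable_norm[OF L2_on_integrable[OF L2_on_of_real[OF VL2[OF e]]]] by simp
      have "cmod (epot e f f) \<le> (LINT x|M e. cmod (of_real (V e x) * f e x * cnj (f e x)))"
        by (rule integral_norm_bound)
      also have "\<dots> \<le> (LINT x|M e. \<bar>V e x\<bar> * s e)"
      proof (rule integral_mono)
        show "integrable (M e) (\<lambda>x. cmod (of_real (V e x) * f e x * cnj (f e x)))"
          using integrable_pot[OF f f e] by simp
        show "integrable (M e) (\<lambda>x. \<bar>V e x\<bar> * s e)" using iV by simp
        fix x assume "x \<in> space (M e)"
        then show "cmod (of_real (V e x) * f e x * cnj (f e x)) \<le> \<bar>V e x\<bar> * s e"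
          using sup[OF e, of x] by (simp add: norm_mult mult.assoc space_restrict_space power2_eq_square mult_left_mono)
      qed
      also have "\<dots> = (LINT x|M e. \<bar>V e x\<bar>) * s e" by simp
      also have "\<dots> \<le> v * s e" by (intro mult_right_mono vle e s0)
      finally show "cmod (epot e f f) \<le> v * s e" .
    qed
    ultimately have "\<bar>hf.qf f - dsq f\<bar> \<le> t * (2 * (\<Sum>e\<in>E. s e)) + v * (\<Sum>e\<in>E. s e)"
      unfolding hf_qf[OF f] using abs_Re_le_cmod[of "bform E T (tr f) (tr f)"]
        abs_Re_le_cmod[of "\<Sum>e\<in>E. LINT x|M e. of_real (V e x) * f e x * cnj (f e x)"] by linarith
    also have "\<dots> = k * \<delta> * dsq f + C * nsq f"
      unfolding ssum k_def C_def using \<delta>0 by (simp add: field_simps)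
    also have "\<dots> \<le> 1 / 2 * dsq f + C * nsq f"
      using k\<delta> dsq_nonneg by (intro add_right_mono mult_right_mono) auto
    finally show ?thesis by simp
  qed
  moreover have "0 \<le> C" using k0 \<delta>0 by (simp add: C_def)
  ultimately show ?thesis by blast
qed

definition C0 :: real where
  "C0 = (SOME C. 0 \<le> C \<and> (\<forall>f\<in>Q. \<bar>hf.qf f - dsq f\<bar> \<le> dsq f / 2 + C * nsq f))"

lemma C0: "0 \<le> C0" "f \<in> Q \<Longrightarrow> \<bar>hf.qf f - dsq f\<bar> \<le> dsq f / 2 + C0 * nsq f"
proof -
  have "\<exists>C. 0 \<le> C \<and> (\<forall>f\<in>Q. \<bar>hf.qf f - dsq f\<bar> \<le> dsq f / 2 + C * nsq f)" using form_bound by blast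
  from someI_ex[OF this] show "0 \<le> C0" "f \<in> Q \<Longrightarrow> \<bar>hf.qf f - dsq f\<bar> \<le> dsq f / 2 + C0 * nsq f"
    unfolding C0_def by auto
qed

text \<open>Coercivity: bounds and Cauchy estimates for \<open>hf\<close> and \<open>nsq\<close>
  pass to the derivatives.\<close>

lemma dsq_le: "f \<in> Q \<Longrightarrow> dsq f \<le> 2 * hf.qf f + 2 * C0 * nsq f"
  using C0(2)[of f] by linarith

lemma sqn_le_nsq: "e \<in> E \<Longrightarrow> sqn (l e) (f e) \<le> nsq f"
  unfolding nsq_def using finE by (intro member_le_sum[of e E "\<lambda>e. sqn (l e) (f e)"] sqn_nonneg) auto

lemma sqn_le_dsq: "e \<in> E \<Longrightarrow> sqn (l e) (wderiv (l e) (f e)) \<le> dsq f"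
  unfolding dsq_def using finE by (intro member_le_sum[of e E "\<lambda>e. sqn (l e) (wderiv (l e) (f e))"] sqn_nonneg) auto

text \<open>Elements of \<open>Q\<close> are continuous on the edges and 0 elsewhere, so a vanishing
  norm means vanishing everywhere: with \<open>sqn = 0\<close> the trace inequality bounds
  \<open>(cmod (f e x))^2\<close> by a multiple of an arbitrary small \<delta>.\<close>

lemma nsq_pos:
  assumes f: "f \<in> Q" and "f \<noteq> 0"
  shows "0 < nsq f"
proof (rule ccontr)
  assume "\<not> 0 < nsq f"
  have "f e x = 0" for e x
  proof (cases "e \<in> E \<and> x \<in> {0..l e}")
    case True
    then have e: "e \<in> E" and x: "x \<in> {0..l e}" by auto
    have s0: "sqn (l e) (f e) = 0" using sqn_le_nsq[OF e, of f] sqn_nonneg[of "l e" "f e"] \<open>\<not> 0 < nsq f\<close> by simp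
    let ?d = "sqn (l e) (wderiv (l e) (f e))"
    have b: "(cmod (f e x))\<^sup>2 \<le> 2 * \<delta> * ?d" if "0 < \<delta>" "\<delta> \<le> l e" for \<delta>
      using weak_deriv_on_sup[OF QD(2)[OF f e] that x] s0 by simp
    show ?thesis
    proof (rule ccontr)
      assume "f e x \<noteq> 0"
      then have p: "0 < (cmod (f e x))\<^sup>2" by simp
      \<comment> \<open>Makes \<open>2 * \<delta> * ?d\<close> at most half of
        \<open>(cmod (f e x))^2\<close>; \<open>?d + 1\<close> avoids a division by 0.\<close>
      define \<delta> where "\<delta> = min (l e) ((cmod (f e x))\<^sup>2 / (4 * (?d + 1)))"
      have d0: "0 \<le> ?d" by (rule sqn_nonneg)
      then have "0 < \<delta>" using p lpos[OF e] by (simp add: \<delta>_def)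
      then have "(cmod (f e x))\<^sup>2 \<le> 2 * \<delta> * ?d" by (intro b) (simp_all add: \<delta>_def)
      also have "\<dots> \<le> 2 * ((cmod (f e x))\<^sup>2 / (4 * (?d + 1))) * (?d + 1)"
        using d0 \<open>0 < \<delta>\<close> by (intro mult_mono) (auto simp: \<delta>_def)
      also have "\<dots> = (cmod (f e x))\<^sup>2 / 2"
      proof -
        define D where "D = ?d + 1"
        have "0 < D" using d0 by (simp add: D_def)
        then show ?thesis unfolding D_def[symmetric] by simp
      qed
      finally show False using p by simp
    qed
  next
    case False
    then show ?thesis by (rule QD(1)[OF f])
  qed
  then have "f = 0" by (simp add: fun_eq_iff)
  then show False using assms by simp
qed

text \<open>Subsequences are thinned out one edge at a time; the Cauchy property on the edges
  already treated persists along a further subsequence.\<close>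

lemma compact_edges:
  assumes F: "\<And>n::nat. F n \<in> Q" and K: "\<And>n. nsq (F n) \<le> K" "\<And>n. dsq (F n) \<le> K" and "finite I" "I \<subseteq> E"
  shows "\<exists>r::nat \<Rightarrow> nat. strict_mono r \<and>
    (\<forall>e\<in>I. double_null (\<lambda>m n. sqn (l e) (\<lambda>x. F (r m) e x - F (r n) e x)))"
  using assms(4,5)
proof (induction I rule: finite_induct)
  case empty
  show ?case by (intro exI[of _ id]) (auto simp: strict_mono_def)
next
  case (insert e I)
  then obtain r :: "nat \<Rightarrow> nat" where r: "strict_mono r"
    "\<forall>e\<in>I. double_null (\<lambda>m n. sqn (l e) (\<lambda>x. F (r m) e x - F (r n) e x))" by auto
  have e: "e \<in> E" using insert.prems by simp
  have "sqn (l e) (F (r n) e) \<le> K" "sqn (l e) (wderiv (l e) (F (r n) e)) \<le> K" for n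
    using sqn_le_nsq[OF e] sqn_le_dsq[OF e] K order_trans by blast+
  from weak_deriv_on_compact[of "l e" "\<lambda>n. F (r n) e" "\<lambda>n. wderiv (l e) (F (r n) e)" K, OF lpos[OF e] QD(2)[OF F e] this]
  obtain p :: "nat \<Rightarrow> nat" where p: "strict_mono p"
    "double_null (\<lambda>m n. sqn (l e) (\<lambda>x. F (r (p m)) e x - F (r (p n)) e x))" by blast
  have "\<exists>N. \<forall>m\<ge>N. \<forall>n\<ge>N. sqn (l e') (\<lambda>x. F ((r \<circ> p) m) e' x - F ((r \<circ> p) n) e' x) < \<epsilon>"
    if e': "e' \<in> insert e I" and \<epsilon>: "0 < \<epsilon>" for e' \<epsilon>
  proof (cases "e' = e")
    case True
    then show ?thesis using p(2) \<epsilon> by simp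
  next
    case False
    then obtain N where "\<forall>m\<ge>N. \<forall>n\<ge>N. sqn (l e') (\<lambda>x. F (r m) e' x - F (r n) e' x) < \<epsilon>"
      using r(2) e' \<epsilon> by blast
    then show ?thesis using seq_suble[OF p(1)] by (intro exI[of _ N]) (auto intro: order_trans)
  qed
  then show ?case using strict_mono_o[OF r(1) p(1)] by blast
qed

text \<open>The edgewise limits also converge at the end points, so \<open>X_closed\<close> places
  the trace of the limit in \<open>X\<close>.\<close>

lemma complete_edges:
  assumes F: "\<And>n::nat. F n \<in> Q"
    and c: "\<And>\<epsilon>. 0 < \<epsilon> \<Longrightarrow> \<exists>N. \<forall>m\<ge>N. \<forall>n\<ge>N. nsq (F m - F n) < \<epsilon> \<and> dsq (F m - F n) < \<epsilon>"
  shows "\<exists>f\<in>Q. (\<lambda>n. nsq (F n - f)) \<longlonglongrightarrow> 0 \<and> (\<lambda>n. dsq (F n - f)) \<longlonglongrightarrow> 0"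
proof -
  define R where "R = (\<lambda>e w w'. weak_deriv_on (l e) w w' \<and> (\<lambda>n. sqn (l e) (\<lambda>x. F n e x - w x)) \<longlonglongrightarrow> 0 \<and>
      (\<lambda>n. sqn (l e) (\<lambda>x. wderiv (l e) (F n e) x - w' x)) \<longlonglongrightarrow> 0 \<and> (\<forall>x\<in>{0..l e}. (\<lambda>n. F n e x) \<longlonglongrightarrow> w x))"
  have ex: "\<exists>w w'. R e w w'" if e: "e \<in> E" for e
    unfolding R_def
  proof (rule weak_deriv_on_complete[OF lpos[OF e] QD(2)[OF F e]])
    fix \<epsilon> :: real assume "0 < \<epsilon>"
    from c[OF this] obtain N where N: "\<forall>m\<ge>N. \<forall>n\<ge>N. nsq (F m - F n) < \<epsilon> \<and> dsq (F m - F n) < \<epsilon>" by blast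
    have "sqn (l e) (\<lambda>x. F m e x - F n e x) \<le> nsq (F m - F n)" for m n
      using sqn_le_nsq[OF e, of "F m - F n"] by (simp add: fun_diff_def)
    then show "\<exists>N. \<forall>m\<ge>N. \<forall>n\<ge>N. sqn (l e) (\<lambda>x. F m e x - F n e x) < \<epsilon>"
      using N le_less_trans by blast
    have "sqn (l e) (\<lambda>x. wderiv (l e) (F m e) x - wderiv (l e) (F n e) x) \<le> dsq (F m - F n)" for m n
      using sqn_le_dsq[OF e, of "F m - F n"] sqn_wderiv[OF Q_diff_weak[OF F F e]] by simp
    then show "\<exists>N. \<forall>m\<ge>N. \<forall>n\<ge>N. sqn (l e) (\<lambda>x. wderiv (l e) (F m e) x - wderiv (l e) (F n e) x) < \<epsilon>"
      using N le_less_trans by blast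
  qed
  define w where "w = (\<lambda>e. SOME w. \<exists>w'. R e w w')"
  define w' where "w' = (\<lambda>e. SOME w'. R e (w e) w')"
  have R: "R e (w e) (w' e)" if "e \<in> E" for e
  proof -
    have "\<exists>w'. R e (w e) w'" unfolding w_def by (rule someI_ex[OF ex[OF that]])
    then show ?thesis unfolding w'_def by (rule someI_ex)
  qed
  have w: "weak_deriv_on (l e) (w e) (w' e)" "(\<lambda>n. sqn (l e) (\<lambda>x. F n e x - w e x)) \<longlonglongrightarrow> 0"
    "(\<lambda>n. sqn (l e) (\<lambda>x. wderiv (l e) (F n e) x - w' e x)) \<longlonglongrightarrow> 0"
    "x \<in> {0..l e} \<Longrightarrow> (\<lambda>n. F n e x) \<longlonglongrightarrow> w e x" if "e \<in> E" for e x
    using R[OF that] unfolding R_def by blast+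
  define f where "f = (\<lambda>e x. if e \<in> E \<and> x \<in> {0..l e} then w e x else 0)"
  have wd: "weak_deriv_on (l e) (f e) (w' e)" if "e \<in> E" for e
    by (rule weak_deriv_on_cong[OF w(1)[OF that] weak_deriv_onD(1)[OF w(1)[OF that]]]) (auto simp: f_def that)
  have fQ: "f \<in> Q"
  proof (rule QI[OF _ wd])
    show "tr f \<in> X"
    proof (rule X_closed[OF QD(3)[OF F]])
      fix a :: "'e \<times> bool"
      show "(\<lambda>n. tr (F n) a) \<longlonglongrightarrow> tr f a"
        using lpos by (auto simp: etrace_def f_def intro!: w(4) less_imp_le)
    qed
  qed (auto simp: f_def)
  have 1: "sqn (l e) (F n e - f e) = sqn (l e) (\<lambda>x. F n e x - w e x)" if "e \<in> E" for e n
    unfolding sqn_def using that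
    by (intro Bochner_Integration.integral_cong) (auto simp: f_def space_restrict_space)
  have 2: "sqn (l e) (wderiv (l e) (F n e - f e)) = sqn (l e) (\<lambda>x. wderiv (l e) (F n e) x - w' e x)" if "e \<in> E" for e n
    using sqn_wderiv[OF weak_deriv_on_diff[OF QD(2)[OF F that] wd[OF that]]] by (simp add: fun_diff_def)
  have "(\<lambda>n. \<Sum>e\<in>E. sqn (l e) (\<lambda>x. F n e x - w e x)) \<longlonglongrightarrow> (\<Sum>e\<in>E. 0)"
    by (intro tendsto_sum w(2))
  then have "(\<lambda>n. nsq (F n - f)) \<longlonglongrightarrow> 0" unfolding nsq_def by (simp add: 1)
  moreover have "(\<lambda>n. \<Sum>e\<in>E. sqn (l e) (\<lambda>x. wderiv (l e) (F n e) x - w' e x)) \<longlonglongrightarrow> (\<Sum>e\<in>E. 0)"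
    by (intro tendsto_sum w(3))
  then have "(\<lambda>n. dsq (F n - f)) \<longlonglongrightarrow> 0" unfolding dsq_def by (simp add: 2)
  ultimately show ?thesis using fQ by blast
qed

text \<open>The polynomials \<open>x ^ Suc j * (l e0 - x)\<close> on one edge have zero trace, hence
  lie in \<open>Q\<close> for any \<open>X\<close>. A vanishing combination, divided by
  \<open>x * (l e0 - x)\<close>, is a polynomial with infinitely many roots.\<close>

lemma infinite_dim_Q: "\<exists>\<psi>. (\<forall>j::nat. \<psi> j \<in> Q) \<and>
    (\<forall>n a. (\<Sum>j\<le>n. fscale (a j) (\<psi> j)) = 0 \<longrightarrow> (\<forall>j\<le>n. a j = 0))"
proof -
  obtain e0 where e0: "e0 \<in> E" using neE by blast
  define p where "p = (\<lambda>(j::nat) x. x ^ Suc j * (l e0 - x))"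
  define \<psi> where "\<psi> = (\<lambda>j e x. if e = e0 \<and> x \<in> {0..l e0} then complex_of_real (p j x) else 0)"
  have "\<psi> j \<in> Q" for j
  proof -
    define p' where "p' = (\<lambda>x. real (Suc j) * x ^ j * (l e0 - x) - x ^ Suc j)"
    have "(p j has_real_derivative p' x) (at x within {0..l e0})" for x
    proof -
      have 1: "((\<lambda>x. x ^ Suc j) has_real_derivative real (Suc j) * x ^ j) (at x within {0..l e0})"
        using DERIV_pow[of "Suc j" x] by simp
      have 2: "((\<lambda>x. l e0 - x) has_real_derivative - 1) (at x within {0..l e0})"
        by (auto intro!: derivative_eq_intros)
      from DERIV_mult[OF 1 2] show ?thesis by (simp add: p_def p'_def)
    qed
    then have "((\<lambda>x. complex_of_real (p j x)) has_vector_derivative complex_of_real (p' x)) (at x within {0..l e0})" for x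
      by (rule has_vector_derivative_of_real)
    then have *: "weak_deriv_on (l e0) (\<lambda>x. complex_of_real (p j x)) (\<lambda>x. complex_of_real (p' x))"
      by (rule weak_deriv_on_C1) (auto simp: p'_def intro!: continuous_intros)
    have "weak_deriv_on (l e) (\<psi> j e) (if e = e0 then (\<lambda>x. complex_of_real (p' x)) else (\<lambda>_. 0))" for e
      using weak_deriv_on_cong[OF * weak_deriv_onD(1)[OF *], of "\<psi> j e0"] weak_deriv_on_const[of "l e" 0]
      by (auto simp: \<psi>_def)
    moreover have "tr (\<psi> j) = (\<lambda>_. 0)" by (auto simp: etrace_def \<psi>_def p_def fun_eq_iff)
    ultimately show ?thesis
      using e0 X_zero by (intro QI[where u' = "\<lambda>e. if e = e0 then (\<lambda>x. complex_of_real (p' x)) else (\<lambda>_. 0)"]) (auto simp: \<psi>_def)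
  qed
  moreover have "\<forall>j\<le>n. a j = 0" if z: "(\<Sum>j\<le>n. fscale (a j) (\<psi> j)) = 0" for n a
  proof (rule ccontr)
    assume "\<not> (\<forall>j\<le>n. a j = 0)"
    then obtain j where "j \<le> n" "a j \<noteq> 0" by blast
    then have fin: "finite {z. (\<Sum>j\<le>n. a j * z ^ j) = 0}"
      using polyfun_rootbound_finite by blast
    have "complex_of_real ` {0<..<l e0} \<subseteq> {z. (\<Sum>j\<le>n. a j * z ^ j) = 0}"
    proof
      fix y assume "y \<in> complex_of_real ` {0<..<l e0}"
      then obtain x where x: "y = of_real x" "0 < x" "x < l e0" by auto
      have "0 = (\<Sum>j\<le>n. fscale (a j) (\<psi> j)) e0 x" using z by simp
      also have "\<dots> = (\<Sum>j\<le>n. a j * of_real (p j x))"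
        unfolding sum_fun_apply2 using x by (intro sum.cong) (auto simp: fscale_def \<psi>_def)
      also have "\<dots> = of_real (x * (l e0 - x)) * (\<Sum>j\<le>n. a j * y ^ j)"
        unfolding sum_distrib_left by (intro sum.cong) (auto simp: p_def x(1) mult_ac)
      finally show "y \<in> {z. (\<Sum>j\<le>n. a j * z ^ j) = 0}" using x by auto
    qed
    then have "finite (complex_of_real ` {0<..<l e0})" using fin finite_subset by blast
    then have "finite {0<..<l e0}" by (rule finite_imageD) (simp add: inj_on_def)
    then show False using infinite_Ioo[OF lpos[OF e0]] by simp
  qed
  ultimately show ?thesis by blast
qed

sublocale form_space fscale Q ip hf C0
proof
  show "0 < ip.qf f" if "f \<in> Q" "f \<noteq> 0" for f using nsq_pos[OF that] that by (simp add: ip_qf)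
  show "- C0 * ip.qf f \<le> hf.qf f" if "f \<in> Q" for f
    using C0(2)[OF that] dsq_nonneg[of f] that by (simp add: ip_qf)
next
  fix F :: "nat \<Rightarrow> 'e \<Rightarrow> real \<Rightarrow> complex" and K
  assume F: "\<And>n. F n \<in> Q" and 1: "\<And>n. ip.qf (F n) = 1" and K: "\<And>n. hf.qf (F n) \<le> K"
  have n1: "nsq (F n) = 1" for n using 1 F by (simp add: ip_qf)
  define K' where "K' = max 1 (2 * K + 2 * C0)"
  have nK: "nsq (F n) \<le> K'" for n using n1[of n] by (simp add: K'_def)
  have dK: "dsq (F n) \<le> K'" for n using dsq_le[OF F[of n]] K[of n] n1[of n] by (simp add: K'_def)
  from compact_edges[of F K' E, OF F nK dK finE order_refl]
  obtain r :: "nat \<Rightarrow> nat" where r: "strict_mono r"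
    "\<forall>e\<in>E. double_null (\<lambda>m n. sqn (l e) (\<lambda>x. F (r m) e x - F (r n) e x))" by blast
  have eq: "ip.qf (F m - F n) = (\<Sum>e\<in>E. sqn (l e) (\<lambda>x. F m e x - F n e x))" for m n
    using ip_qf[OF ip.Q_diff[OF F F], of m n] by (simp add: nsq_def fun_diff_def)
  have "\<exists>N. \<forall>m\<ge>N. \<forall>n\<ge>N. ip.qf (F (r m) - F (r n)) < \<epsilon>" if "0 < \<epsilon>" for \<epsilon>
    unfolding eq using sum_cauchy[OF finE _ that, of "\<lambda>e m n. sqn (l e) (\<lambda>x. F (r m) e x - F (r n) e x)"] r(2) by blast
  then show "\<exists>r::nat \<Rightarrow> nat. strict_mono r \<and> double_null (\<lambda>m n. ip.qf (F (r m) - F (r n)))"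
    using r(1) by blast
next
  fix F :: "nat \<Rightarrow> 'e \<Rightarrow> real \<Rightarrow> complex"
  assume F: "\<And>n. F n \<in> Q"
    and c: "\<And>\<epsilon>. 0 < \<epsilon> \<Longrightarrow> \<exists>N. \<forall>m\<ge>N. \<forall>n\<ge>N. ip.qf (F m - F n) < \<epsilon> \<and> hf.qf (F m - F n) < \<epsilon>"
  have "\<exists>N. \<forall>m\<ge>N. \<forall>n\<ge>N. nsq (F m - F n) < \<epsilon> \<and> dsq (F m - F n) < \<epsilon>" if \<epsilon>: "0 < \<epsilon>" for \<epsilon>
  proof -
    \<comment> \<open>Both summands on the right of \<open>dsq_le\<close>, \<open>2 * hf.qf\<close>
      and \<open>2 * C0 * nsq\<close>, are thereby held to \<epsilon>/2.\<close>
    define \<eta> where "\<eta> = \<epsilon> / (4 * (C0 + 1))"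
    have \<eta>: "0 < \<eta>" "\<eta> \<le> \<epsilon> / 4" "C0 * \<eta> \<le> \<epsilon> / 4" using \<epsilon> C0(1) by (auto simp: \<eta>_def field_simps)
    obtain N where N: "\<forall>m\<ge>N. \<forall>n\<ge>N. ip.qf (F m - F n) < \<eta> \<and> hf.qf (F m - F n) < \<eta>" using c[OF \<eta>(1)] by blast
    have "nsq (F m - F n) < \<epsilon> \<and> dsq (F m - F n) < \<epsilon>" if "N \<le> m" "N \<le> n" for m n
    proof -
      have d: "F m - F n \<in> Q" by (intro ip.Q_diff F)
      have "ip.qf (F m - F n) < \<eta> \<and> hf.qf (F m - F n) < \<eta>" using N that by blast
      then have n: "nsq (F m - F n) < \<eta>" and h: "hf.qf (F m - F n) < \<eta>" using ip_qf[OF d] by auto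
      have "C0 * nsq (F m - F n) \<le> C0 * \<eta>" using n C0(1) by (intro mult_left_mono) auto
      then show ?thesis using dsq_le[OF d] n h \<eta> \<epsilon> by linarith
    qed
    then show ?thesis by blast
  qed
  from complete_edges[OF F this] obtain f where f: "f \<in> Q" "(\<lambda>n. nsq (F n - f)) \<longlonglongrightarrow> 0" "(\<lambda>n. dsq (F n - f)) \<longlonglongrightarrow> 0" by blast
  have d: "F n - f \<in> Q" for n by (intro ip.Q_diff F f)
  have "(\<lambda>n. hf.qf (F n - f)) \<longlonglongrightarrow> 0"
  proof (rule Lim_null_comparison[OF always_eventually])
    show "\<forall>n. norm (hf.qf (F n - f)) \<le> 3 / 2 * dsq (F n - f) + C0 * nsq (F n - f)"
    proof
      fix n
      show "norm (hf.qf (F n - f)) \<le> 3 / 2 * dsq (F n - f) + C0 * nsq (F n - f)"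
        using C0(2)[OF d[of n]] dsq_nonneg[of "F n - f"] unfolding real_norm_def by linarith
    qed
    have "(\<lambda>n. 3 / 2 * dsq (F n - f) + C0 * nsq (F n - f)) \<longlonglongrightarrow> 3 / 2 * 0 + C0 * 0"
      by (intro tendsto_intros f)
    then show "(\<lambda>n. 3 / 2 * dsq (F n - f) + C0 * nsq (F n - f)) \<longlonglongrightarrow> 0" by simp
  qed
  moreover have "(\<lambda>n. ip.qf (F n - f)) \<longlonglongrightarrow> 0" unfolding ip_qf[OF d] by (rule f(2))
  ultimately show "\<exists>f\<in>Q. (\<lambda>n. ip.qf (F n - f)) \<longlonglongrightarrow> 0 \<and> (\<lambda>n. hf.qf (F n - f)) \<longlonglongrightarrow> 0"
    using f(1) by blast
qed (rule infinite_dim_Q)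

end

section \<open>Weak eigenvectors and natural boundary conditions\<close>

context metric_graph_form
begin

lemma sum_ends: "(\<Sum>a\<in>E \<times> (UNIV :: bool set). \<phi> a) = (\<Sum>e\<in>E. \<phi> (e, False) + \<phi> (e, True))"
proof -
  have "(\<Sum>a\<in>E \<times> (UNIV :: bool set). \<phi> a) = (\<Sum>e\<in>E. \<Sum>b\<in>UNIV. \<phi> (e, b))"
    unfolding sum.cartesian_product by (simp add: case_prod_beta)
  then show ?thesis by (simp add: UNIV_bool add.commute)
qed

text \<open>Integration by parts on every edge cancels the interior terms by the differential
  equation. The end terms carry a minus sign because \<open>dtrace\<close> takes derivatives into
  the edge.\<close>

lemma green:
  assumes f: "f \<in> Q" and g: "g \<in> Q"
    and w: "\<And>e. e \<in> E \<Longrightarrow> weak_deriv_on (l e) (f e) (w e)" "\<And>e. e \<in> E \<Longrightarrow> weak_deriv_on (l e) (w e) (F e)"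
    and ae: "\<And>e. e \<in> E \<Longrightarrow> AE x in M e. F e x = (of_real (V e x) - of_real \<mu>) * f e x"
  shows "hf f g - of_real \<mu> * ip f g = bform E T (tr f) (tr g) -
    (\<Sum>a\<in>E \<times> UNIV. dtrace l f a * cnj (tr g a))"
proof -
  have key: "egrad e f g + epot e f g -
      of_real \<mu> * eip e f g =
      - (dtrace l f (e, False) * cnj (tr g (e, False)) + dtrace l f (e, True) * cnj (tr g (e, True)))"
    if e: "e \<in> E" for e
  proof -
    note gd = QD(2)[OF g e]
    have iF: "integrable (M e) (\<lambda>x. F e x * cnj (g e x))"
      by (intro L2_on_integrable_mult weak_deriv_onD(1)[OF w(2)[OF e]] L2_on_cnj Q_L2 g e)
    have "eip e F g = (LINT x|M e. of_real (V e x) * f e x * cnj (g e x) - of_real \<mu> * (f e x * cnj (g e x)))"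
    proof (rule integral_cong_AE)
      show "(\<lambda>x. of_real (V e x) * f e x * cnj (g e x) - of_real \<mu> * (f e x * cnj (g e x))) \<in> borel_measurable (M e)"
        using integrable_pot[OF f g e] integrable_ip[OF f g e] by (intro borel_measurable_integrable) simp
      show "AE x in M e. F e x * cnj (g e x) = of_real (V e x) * f e x * cnj (g e x) - of_real \<mu> * (f e x * cnj (g e x))"
        using ae[OF e]
      proof eventually_elim
        fix x assume F: "F e x = (of_real (V e x) - of_real \<mu>) * f e x"
        show "F e x * cnj (g e x) = of_real (V e x) * f e x * cnj (g e x) - of_real \<mu> * (f e x * cnj (g e x))"
          unfolding F by (simp add: algebra_simps)
      qed
    qed (use iF in simp)
    also have "\<dots> = epot e f g - of_real \<mu> * eip e f g"
      using integrable_pot[OF f g e] integrable_ip[OF f g e] by simp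
    finally have 1: "eip e F g = epot e f g - of_real \<mu> * eip e f g" .
    have 2: "egrad e f g = (LINT x|M e. w e x * cnj (wderiv (l e) (g e) x))"
      by (rule integral_wderiv_left[OF w(1)[OF e] Q_L2(2)[OF g e]])
    have 3: "eip e F g + (LINT x|M e. w e x * cnj (wderiv (l e) (g e) x)) =
        w e (l e) * cnj (g e (l e)) - w e 0 * cnj (g e 0)"
      using weak_deriv_on_parts[OF w(2)[OF e] weak_deriv_on_cnj[OF gd]] lpos[OF e] by simp
    have 4: "vector_derivative (f e) (at x within {0..l e}) = w e x" if "x \<in> {0..l e}" for x
      by (rule weak_deriv_on_vector_derivative[OF w(1)[OF e] weak_deriv_on_continuous[OF w(2)[OF e]] that lpos[OF e]])
    have 5: "dtrace l f (e, False) = w e 0" "dtrace l f (e, True) = - w e (l e)"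
      "tr g (e, False) = g e 0" "tr g (e, True) = g e (l e)"
      using lpos[OF e] e 4[of 0] 4[of "l e"] by (auto simp: dtrace_def etrace_def)
    have "egrad e f g + epot e f g -
        of_real \<mu> * eip e f g =
      eip e F g + (LINT x|M e. w e x * cnj (wderiv (l e) (g e) x))"
      unfolding 1 2 by simp
    also note 3
    finally show ?thesis unfolding 5 by simp
  qed
  have "hf f g - of_real \<mu> * ip f g - bform E T (tr f) (tr g) =
      (\<Sum>e\<in>E. egrad e f g + epot e f g -
      of_real \<mu> * eip e f g)"
    unfolding graph_form_def graph_ip_def by (simp add: sum_subtractf sum_distrib_left)
  also have "\<dots> = (\<Sum>e\<in>E. - (dtrace l f (e, False) * cnj (tr g (e, False)) + dtrace l f (e, True) * cnj (tr g (e, True))))"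
    by (intro sum.cong refl key)
  also have "\<dots> = - (\<Sum>a\<in>E \<times> UNIV. dtrace l f a * cnj (tr g a))"
    unfolding sum_ends by (simp only: sum_negf)
  finally show ?thesis by (simp add: algebra_simps)
qed

text \<open>Affine interpolation on each edge. Every boundary vector in \<open>X\<close> thus
  becomes available as a test.\<close>

lemma trace_surj:
  assumes G: "G \<in> X"
  shows "\<exists>g\<in>Q. tr g = G"
proof -
  define k where "k = (\<lambda>e. (G (e, True) - G (e, False)) / of_real (l e))"
  define g where "g = (\<lambda>e x. if e \<in> E \<and> x \<in> {0..l e} then G (e, False) + k e * of_real x else 0)"
  have wd: "weak_deriv_on (l e) (g e) (\<lambda>_. k e)" if "e \<in> E" for e
  proof (rule weak_deriv_on_cong[OF weak_deriv_on_C1[where u = "\<lambda>x. G (e, False) + k e * of_real x" and u' = "\<lambda>_. k e"]])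
    show "((\<lambda>x. G (e, False) + k e * of_real x) has_vector_derivative k e) (at x within {0..l e})" for x
    proof -
      have "((\<lambda>x. of_real x :: complex) has_vector_derivative of_real 1) (at x within {0..l e})"
        by (intro has_vector_derivative_of_real) simp
      from has_vector_derivative_add[OF has_vector_derivative_const has_vector_derivative_mult_right[OF this]]
      show ?thesis by simp
    qed
  qed (auto simp: g_def that L2_on_const)
  have "tr g = G"
    using lpos X_supp[OF G] by (auto simp: etrace_def g_def k_def fun_eq_iff less_imp_le order_less_imp_not_eq2)
  then show ?thesis using G wd
    by (intro bexI[of _ g] QI[where u' = "\<lambda>e _. k e"]) (auto simp: g_def)
qed

text \<open>A function on one edge that vanishes at both ends extends by 0 to a test function with
  zero trace, for which the boundary form drops out and the du Bois-Reymond lemma applies.\<close>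

lemma weak_eigenvector_edge:
  assumes f: "f \<in> Q" and weak: "\<And>g. g \<in> Q \<Longrightarrow> hf f g = of_real \<mu> * ip f g" and e: "e \<in> E"
  shows "\<exists>w. weak_deriv_on (l e) (f e) w \<and> weak_deriv_on (l e) w (\<lambda>x. (of_real (V e x) - of_real \<mu>) * f e x)"
proof (rule weak_deriv_on_if_weak_form[OF lpos[OF e] QD(2)[OF f e]])
  have eq: "(\<lambda>x. (of_real (V e x) - of_real \<mu>) * f e x) = (\<lambda>x. of_real (V e x) * f e x - of_real \<mu> * f e x)"
    by (simp add: left_diff_distrib)
  show "L2_on (l e) (\<lambda>x. (of_real (V e x) - of_real \<mu>) * f e x)"
    unfolding eq by (intro L2_on_diff L2_on_scale VL2_mult Q_L2 f e)
  fix g g' assume g: "weak_deriv_on (l e) g g'" "g 0 = 0" "g (l e) = 0"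
  define G where "G = (\<lambda>e' x. if e' = e \<and> x \<in> {0..l e} then g x else 0)"
  have Ge: "weak_deriv_on (l e) (G e) g'"
    by (rule weak_deriv_on_cong[OF g(1) weak_deriv_onD(1)[OF g(1)]]) (auto simp: G_def)
  have Gne: "G e' = (\<lambda>_. 0)" if "e' \<noteq> e" for e' using that by (auto simp: G_def)
  have wd: "weak_deriv_on (l e') (G e') (if e' = e then g' else (\<lambda>_. 0))" for e'
    using Ge Gne weak_deriv_on_const[of "l e'" 0] by auto
  have tr: "tr G = (\<lambda>_. 0)" using g by (auto simp: etrace_def G_def fun_eq_iff)
  have GQ: "G \<in> Q"
  proof (rule QI[OF _ wd])
    show "tr G \<in> X" unfolding tr by (rule X_zero)
  qed (use e in \<open>auto simp: G_def\<close>)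
  have zero: "egrad e' f G = 0"
    if "e' \<in> E" "e' \<noteq> e" for e'
    using integral_wderiv_right[OF wd Q_L2(2)[OF f that(1)]] that by simp
  have edge: "egrad e' f G + epot e' f G =
    (if e' = e then (LINT x|M e. wderiv (l e) (f e) x * cnj (g' x)) + epot e f G else 0)"
    if "e' \<in> E" for e'
  proof (cases "e' = e")
    case True
    then show ?thesis using integral_wderiv_right[OF Ge Q_L2(2)[OF f e]] by simp
  next
    case False
    show ?thesis unfolding zero[OF that False] using False by (simp add: Gne)
  qed
  have "bform E T (tr f) (\<lambda>_. 0) = 0" by (simp add: bform_def)
  then have "hf f G = (\<Sum>e'\<in>E. if e' = e then (LINT x|M e. wderiv (l e) (f e) x * cnj (g' x)) + epot e f G else 0)"
    unfolding graph_form_def tr by (simp add: edge)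
  then have 1: "hf f G = (LINT x|M e. wderiv (l e) (f e) x * cnj (g' x)) + epot e f G"
    using finE e by simp
  have "ip f G = (\<Sum>e'\<in>E. if e' = e then eip e f G else 0)"
    unfolding graph_ip_def by (auto simp: Gne intro!: sum.cong)
  then have 2: "ip f G = eip e f G" using finE e by simp
  have "(LINT x|M e. (of_real (V e x) - of_real \<mu>) * f e x * cnj (g x)) =
      (LINT x|M e. of_real (V e x) * f e x * cnj (G e x) - of_real \<mu> * (f e x * cnj (G e x)))"
    by (intro Bochner_Integration.integral_cong) (auto simp: G_def space_restrict_space algebra_simps)
  also have "\<dots> = epot e f G - of_real \<mu> * eip e f G"
    using integrable_pot[OF f GQ e] integrable_ip[OF f GQ e] by simp
  finally show "(LINT x|M e. wderiv (l e) (f e) x * cnj (g' x)) +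
      (LINT x|M e. (of_real (V e x) - of_real \<mu>) * f e x * cnj (g x)) = 0"
    using weak[OF GQ] unfolding 1 2 by (simp add: add_diff_eq)
qed

text \<open>Tests supported inside an edge give the differential equation. Once it holds, Green's
  formula leaves boundary terms only, and tests with arbitrary trace turn these into the condition
  on \<open>dtrace\<close>. The converse reads Green's formula backwards.\<close>

theorem weak_eigenvector_iff:
  "f \<in> Q \<and> (\<forall>g\<in>Q. hf f g = complex_of_real \<mu> * ip f g) \<longleftrightarrow>
   (\<forall>e x. \<not> (e \<in> E \<and> x \<in> {0..l e}) \<longrightarrow> f e x = 0) \<and>
   (\<forall>e\<in>E. \<exists>u''. weak_deriv2_on (l e) (f e) u'' \<and>
      (AE x in M e. complex_of_real \<mu> * f e x = - u'' x + of_real (V e x) * f e x)) \<and>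
   tr f \<in> X \<and>
   (\<forall>G\<in>X. (\<Sum>a\<in>E \<times> UNIV. dtrace l f a * cnj (G a)) = bform E T (tr f) G)"
  (is "?weak \<longleftrightarrow> ?strong")
proof
  assume ?weak
  then have f: "f \<in> Q" and weak: "\<And>g. g \<in> Q \<Longrightarrow> hf f g = of_real \<mu> * ip f g" by auto
  define F where "F = (\<lambda>e x. (of_real (V e x) - of_real \<mu>) * f e x)"
  have "\<forall>e\<in>E. \<exists>w. weak_deriv_on (l e) (f e) w \<and> weak_deriv_on (l e) w (F e)"
    unfolding F_def using weak_eigenvector_edge[OF f weak] by blast
  from bchoice[OF this] obtain w where w: "\<And>e. e \<in> E \<Longrightarrow> weak_deriv_on (l e) (f e) (w e)"
    "\<And>e. e \<in> E \<Longrightarrow> weak_deriv_on (l e) (w e) (F e)" by blast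
  have d2: "\<exists>u''. weak_deriv2_on (l e) (f e) u'' \<and> (AE x in M e. complex_of_real \<mu> * f e x = - u'' x + of_real (V e x) * f e x)"
    if "e \<in> E" for e
    using w[OF that] by (intro exI[of _ "F e"]) (auto simp: weak_deriv2_on_def F_def algebra_simps)
  have "(\<Sum>a\<in>E \<times> UNIV. dtrace l f a * cnj (G a)) = bform E T (tr f) G" if GX: "G \<in> X" for G
  proof -
    obtain g where g: "g \<in> Q" "tr g = G" using trace_surj[OF GX] by blast
    from green[OF f g(1) w, of \<mu>] weak[OF g(1)] show ?thesis by (simp add: g(2) F_def)
  qed
  then show ?strong using QD(1,3)[OF f] d2 by blast
next
  assume strong: ?strong
  then have "\<forall>e\<in>E. \<exists>u'' w. weak_deriv_on (l e) (f e) w \<and> weak_deriv_on (l e) w u'' \<and>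
      (AE x in M e. complex_of_real \<mu> * f e x = - u'' x + of_real (V e x) * f e x)"
    unfolding weak_deriv2_on_def by blast
  from bchoice[OF this] obtain F where "\<forall>e\<in>E. \<exists>w. weak_deriv_on (l e) (f e) w \<and> weak_deriv_on (l e) w (F e) \<and>
      (AE x in M e. complex_of_real \<mu> * f e x = - F e x + of_real (V e x) * f e x)" by blast
  from bchoice[OF this] obtain w where w: "\<And>e. e \<in> E \<Longrightarrow> weak_deriv_on (l e) (f e) (w e)"
    "\<And>e. e \<in> E \<Longrightarrow> weak_deriv_on (l e) (w e) (F e)"
    and ae: "\<And>e. e \<in> E \<Longrightarrow> AE x in M e. complex_of_real \<mu> * f e x = - F e x + of_real (V e x) * f e x" by blast
  have f: "f \<in> Q" by (rule QI[OF _ w(1)]) (use strong in auto)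
  have ae': "AE x in M e. F e x = (of_real (V e x) - of_real \<mu>) * f e x" if "e \<in> E" for e
    using ae[OF that] by eventually_elim (simp add: algebra_simps)
  have "hf f g = of_real \<mu> * ip f g" if "g \<in> Q" for g
    using green[OF f that w ae'] strong QD(3)[OF that] by simp
  then show ?weak using f by blast
qed

end

section \<open>Self-adjoint vertex conditions\<close>

text \<open>Adjoining \<open>- z\<close> as an additional column gives \<open>d\<close> equations in
  \<open>d + 1\<close> unknowns. Injectivity forces the last unknown of a nontrivial solution to be
  nonzero, so it can be normalized to 1.\<close>

lemma square_injective_imp_surjective:
  fixes c :: "nat \<Rightarrow> nat \<Rightarrow> complex"
  assumes inj: "\<And>y. \<forall>i<d. (\<Sum>j<d. c i j * y j) = 0 \<Longrightarrow> \<forall>j<d. y j = 0"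
  shows "\<exists>y. \<forall>i<d. (\<Sum>j<d. c i j * y j) = z i"
proof -
  let ?c = "\<lambda>i j. if j = d then - z i else c i j"
  obtain a where a: "\<exists>j\<in>{..d}. a j \<noteq> 0" "\<And>i. i \<in> {..<d} \<Longrightarrow> (\<Sum>j\<in>{..d}. ?c i j * a j) = 0"
    using homogeneous_system_nontrivial[of "{..<d}" "{..d}" ?c] by auto
  have eq: "(\<Sum>j<d. c i j * a j) = z i * a d" if "i < d" for i
  proof -
    have "{..d} = insert d {..<d}" by auto
    then have "(\<Sum>j\<in>{..d}. ?c i j * a j) = - z i * a d + (\<Sum>j<d. ?c i j * a j)" by simp
    also have "(\<Sum>j<d. ?c i j * a j) = (\<Sum>j<d. c i j * a j)" by (intro sum.cong) auto
    finally show ?thesis using a(2)[of i] that by simp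
  qed
  have "a d \<noteq> 0"
  proof
    assume "a d = 0"
    have "\<forall>j<d. a j = 0" by (rule inj) (simp add: eq \<open>a d = 0\<close>)
    then show False using a(1) \<open>a d = 0\<close> by (auto simp: le_less)
  qed
  then have "\<forall>i<d. (\<Sum>j<d. c i j * (a j / a d)) = z i"
    using eq by (simp add: sum_divide_distrib[symmetric])
  then show ?thesis by (intro exI[of _ "\<lambda>j. a j / a d"])
qed

text \<open>Solutions for the unit vectors form a right inverse \<open>r\<close>. As
  \<open>r\<close> is injective, it is surjective, so \<open>H = r z\<close> and
  \<open>z = c H = 0\<close>.\<close>

lemma square_surjective_imp_injective:
  fixes c :: "nat \<Rightarrow> nat \<Rightarrow> complex"
  assumes surj: "\<And>z. \<exists>y. \<forall>i<d. (\<Sum>j<d. c i j * y j) = z i"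
    and H: "\<forall>i<d. (\<Sum>j<d. c i j * H j) = 0"
  shows "\<forall>j<d. H j = 0"
proof -
  have "\<forall>k. \<exists>y. \<forall>i<d. (\<Sum>j<d. c i j * y j) = (if i = k then 1 else 0)"
    by (intro allI surj)
  from choice[OF this] obtain r where r: "\<And>k i. i < d \<Longrightarrow> (\<Sum>j<d. c i j * r k j) = (if i = k then 1 else 0)" by blast
  have cr: "(\<Sum>j<d. c i j * (\<Sum>k<d. r k j * z k)) = z i" if "i < d" for i z
  proof -
    have "(\<Sum>j<d. c i j * (\<Sum>k<d. r k j * z k)) = (\<Sum>k<d. (\<Sum>j<d. c i j * r k j) * z k)"
      unfolding sum_distrib_left sum_distrib_right by (subst sum.swap) (simp add: mult.assoc)
    also have "\<dots> = (\<Sum>k<d. if i = k then z k else 0)" using that by (intro sum.cong) (auto simp: r)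
    finally show ?thesis using that by simp
  qed
  have "\<exists>z. \<forall>j<d. (\<Sum>k<d. r k j * z k) = H j"
  proof (rule square_injective_imp_surjective)
    fix z assume "\<forall>j<d. (\<Sum>k<d. r k j * z k) = 0"
    then show "\<forall>i<d. z i = 0" using cr[of _ z] by simp
  qed
  then obtain z where z: "\<And>j. j < d \<Longrightarrow> (\<Sum>k<d. r k j * z k) = H j" by blast
  have "z i = 0" if "i < d" for i
    using cr[OF that, of z] H that by (simp add: z)
  then show ?thesis using z by force
qed

text \<open>\<open>sym\<close> is \<open>A B^* = B A^*\<close>. \<open>full_rank\<close> expresses
  rank \<open>d\<close> of \<open>(A B)\<close> by the triviality of the common kernel of
  \<open>A^*\<close> and \<open>B^*\<close>.\<close>

locale sa_pair =
  fixes d :: nat and a b :: "nat \<Rightarrow> nat \<Rightarrow> complex"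
  assumes sym: "\<lbrakk>i < d; k < d\<rbrakk> \<Longrightarrow> (\<Sum>j<d. a i j * cnj (b k j)) = (\<Sum>j<d. b i j * cnj (a k j))"
    and full_rank: "\<forall>j<d. (\<Sum>i<d. cnj (a i j) * y i) = 0 \<and> (\<Sum>i<d. cnj (b i j) * y i) = 0 \<Longrightarrow> \<forall>i<d. y i = 0"
begin

abbreviation "app c u i \<equiv> \<Sum>j<d. c i j * u j"

definition As :: "(nat \<Rightarrow> complex) \<Rightarrow> nat \<Rightarrow> complex" where "As y j = (\<Sum>i<d. cnj (a i j) * y i)"
definition Bs :: "(nat \<Rightarrow> complex) \<Rightarrow> nat \<Rightarrow> complex" where "Bs y j = (\<Sum>i<d. cnj (b i j) * y i)"

lemma comp_adjoint: "(\<Sum>j<d. c j * (\<Sum>k<d. cnj (e k j) * y k)) = (\<Sum>k<d. (\<Sum>j<d. c j * cnj (e k j)) * y k)"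
  for c :: "nat \<Rightarrow> complex" and e :: "nat \<Rightarrow> nat \<Rightarrow> complex"
  unfolding sum_distrib_left sum_distrib_right by (subst sum.swap) (simp add: mult.assoc)

lemma A_Bs: "i < d \<Longrightarrow> app a (Bs y) i = app b (As y) i"
  unfolding As_def Bs_def comp_adjoint by (intro sum.cong) (auto simp: sym)

lemma adjoint_eq: "(\<Sum>j<d. u j * cnj (\<Sum>i<d. cnj (e i j) * z i)) = (\<Sum>i<d. cnj (z i) * (\<Sum>j<d. e i j * u j))"
  for u z :: "nat \<Rightarrow> complex" and e :: "nat \<Rightarrow> nat \<Rightarrow> complex"
  unfolding cnj_sum sum_distrib_left by (subst sum.swap) (simp add: mult_ac)

lemma Bs_As_symmetric: "(\<Sum>j<d. Bs y j * cnj (As z j)) = (\<Sum>j<d. As y j * cnj (Bs z j))"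
  unfolding As_def[of z] Bs_def[of z] adjoint_eq by (intro sum.cong) (auto simp: A_Bs)

definition Mm :: "(nat \<Rightarrow> complex) \<Rightarrow> nat \<Rightarrow> complex" where
  "Mm y i = app a (As y) i + app b (Bs y) i"

text \<open>\<open>Mm\<close> is \<open>A A^* + B B^*\<close>. Its quadratic form at
  \<open>y\<close> is the sum of the squared norms of \<open>A^* y\<close> and \<open>B^* y\<close>,
  which vanishes only for \<open>y = 0\<close> by \<open>full_rank\<close>.\<close>

lemma Mm_surj: "\<exists>y. \<forall>i<d. Mm y i = z i"
proof -
  define m where "m = (\<lambda>i k. (\<Sum>j<d. a i j * cnj (a k j)) + (\<Sum>j<d. b i j * cnj (b k j)))"
  have m: "(\<Sum>k<d. m i k * y k) = Mm y i" for i y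
    unfolding m_def Mm_def As_def Bs_def comp_adjoint by (simp add: distrib_right sum.distrib)
  have "\<exists>y. \<forall>i<d. (\<Sum>k<d. m i k * y k) = z i"
  proof (rule square_injective_imp_surjective)
    fix y assume "\<forall>i<d. (\<Sum>k<d. m i k * y k) = 0"
    then have "0 = (\<Sum>i<d. cnj (y i) * Mm y i)" by (simp add: m)
    also have "\<dots> = (\<Sum>i<d. cnj (y i) * app a (As y) i) + (\<Sum>i<d. cnj (y i) * app b (Bs y) i)"
      unfolding Mm_def by (simp only: distrib_left sum.distrib)
    also have "\<dots> = (\<Sum>j<d. As y j * cnj (As y j)) + (\<Sum>j<d. Bs y j * cnj (Bs y j))"
      unfolding adjoint_eq[symmetric] As_def[symmetric] Bs_def[symmetric] by simp
    also have "\<dots> = of_real (\<Sum>j<d. (cmod (As y j))\<^sup>2 + (cmod (Bs y j))\<^sup>2)"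
      by (simp add: sum.distrib complex_norm_square del: of_real_power)
    finally have "(\<Sum>j<d. (cmod (As y j))\<^sup>2 + (cmod (Bs y j))\<^sup>2) = 0"
      by (metis of_real_eq_0_iff)
    then have "\<forall>j\<in>{..<d}. (cmod (As y j))\<^sup>2 + (cmod (Bs y j))\<^sup>2 = 0"
      by (subst (asm) sum_nonneg_eq_0_iff) auto
    then have "\<forall>j<d. As y j = 0 \<and> Bs y j = 0" by (simp add: sum_power2_eq_zero_iff)
    then show "\<forall>i<d. y i = 0" unfolding As_def Bs_def by (rule full_rank)
  qed
  then show ?thesis by (simp add: m)
qed

text \<open>The matrices \<open>A \<plusminus> i B\<close> are invertible, as \<open>(A \<plusminus> i B) (A \<plusminus> i B)\<^sup>* = A A\<^sup>* + B B\<^sup>*\<close>.\<close>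

lemma combination_injective:
  assumes s: "s = \<i> \<or> s = - \<i>" and H: "\<forall>i<d. (\<Sum>j<d. (a i j + s * b i j) * H j) = 0"
  shows "\<forall>j<d. H j = 0"
proof (rule square_surjective_imp_injective[OF _ H])
  fix z
  obtain y where y: "\<And>i. i < d \<Longrightarrow> Mm y i = z i" using Mm_surj by blast
  have ss: "s * s = - 1" using s by auto
  have "(\<Sum>j<d. (a i j + s * b i j) * (As y j - s * Bs y j)) = z i" if "i < d" for i
  proof -
    have "(\<Sum>j<d. (a i j + s * b i j) * (As y j - s * Bs y j)) =
        app a (As y) i - (s * s) * app b (Bs y) i + s * (app b (As y) i - app a (Bs y) i)"
      unfolding sum_distrib_left right_diff_distrib sum_subtractf[symmetric] sum.distrib[symmetric]
      by (intro sum.cong) (auto simp: algebra_simps)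
    then show ?thesis using y[OF that] A_Bs[OF that, of y] unfolding ss Mm_def by simp
  qed
  then show "\<exists>y. \<forall>i<d. (\<Sum>j<d. (a i j + s * b i j) * y j) = z i"
    by (intro exI[of _ "\<lambda>j. As y j - s * Bs y j"]) blast
qed

text \<open>The pairs \<open>(B^* y, - A^* y)\<close> satisfy the condition by symmetry. Conversely,
  such a pair is subtracted from \<open>(F, F')\<close> so that the remainder is annihilated by both
  invertible combinations.\<close>

lemma condition_iff:
  "(\<forall>i<d. app a F i + app b F' i = 0) \<longleftrightarrow> (\<exists>y. \<forall>j<d. F j = Bs y j \<and> F' j = - As y j)"
proof
  assume C: "\<forall>i<d. app a F i + app b F' i = 0"
  \<comment> \<open>If \<open>F = B^* y\<close> and \<open>F' = - A^* y\<close>, then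
    \<open>B F - A F' = Mm y\<close>, so this is the only candidate.\<close>
  obtain y where y: "\<And>i. i < d \<Longrightarrow> Mm y i = app b F i - app a F' i"
    using Mm_surj[of "\<lambda>i. app b F i - app a F' i"] by blast
  define G where "G = (\<lambda>j. F j - Bs y j)"
  define G' where "G' = (\<lambda>j. F' j + As y j)"
  have 1: "app a G i + app b G' i = 0" if "i < d" for i
    using C A_Bs[OF that, of y] that by (simp add: G_def G'_def right_diff_distrib distrib_left sum_subtractf sum.distrib)
  have 2: "app b G i - app a G' i = 0" if "i < d" for i
    using y[OF that] by (simp add: Mm_def G_def G'_def right_diff_distrib distrib_left sum_subtractf sum.distrib algebra_simps)
  \<comment> \<open>Since \<open>s * s = - 1\<close>, the relations \<open>1\<close> and
    \<open>2\<close> combine to \<open>(A + s B) (G - s G') = 0\<close>; the two signs of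
    \<open>s\<close> together give \<open>G = G' = 0\<close>.\<close>
  have H: "\<forall>j<d. G j - s * G' j = 0" if s: "s = \<i> \<or> s = - \<i>" for s
  proof (rule combination_injective[OF s], intro allI impI)
    fix i assume i: "i < d"
    have ss: "s * s = - 1" using s by auto
    have "(\<Sum>j<d. (a i j + s * b i j) * (G j - s * G' j)) =
        (app a G i - (s * s) * app b G' i) + s * (app b G i - app a G' i)"
      unfolding sum_distrib_left right_diff_distrib sum_subtractf[symmetric] sum.distrib[symmetric]
      by (intro sum.cong) (auto simp: algebra_simps)
    then show "(\<Sum>j<d. (a i j + s * b i j) * (G j - s * G' j)) = 0"
      unfolding ss using 1[OF i] 2[OF i] by simp
  qed
  have "G j = 0 \<and> G' j = 0" if "j < d" for j
  proof -
    have "G j - \<i> * G' j = 0" "G j + \<i> * G' j = 0" using H[of \<i>] H[of "- \<i>"] that by auto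
    then have "2 * G j = 0" by (simp add: algebra_simps)
    with \<open>G j - \<i> * G' j = 0\<close> show ?thesis by simp
  qed
  then show "\<exists>y. \<forall>j<d. F j = Bs y j \<and> F' j = - As y j"
    by (intro exI[of _ y]) (auto simp: G_def G'_def eq_neg_iff_add_eq_0)
next
  assume "\<exists>y. \<forall>j<d. F j = Bs y j \<and> F' j = - As y j"
  then obtain y where "\<And>j. j < d \<Longrightarrow> F j = Bs y j" "\<And>j. j < d \<Longrightarrow> F' j = - As y j" by blast
  then show "\<forall>i<d. app a F i + app b F' i = 0"
    using A_Bs[of _ y] by (simp add: sum_negf)
qed

end

section \<open>All vertices together: the space and the form of boundary values\<close>

lemma linear_right_inverse:
  fixes \<beta> :: "('i \<Rightarrow> complex) \<Rightarrow> 'a \<Rightarrow> complex"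
  assumes "\<And>x y. \<beta> (x + y) = \<beta> x + \<beta> y" "\<And>c x. \<beta> (\<lambda>i. c * x i) = (\<lambda>a. c * \<beta> x a)"
  shows "\<exists>g. (\<forall>x y. g (x + y) = g x + g y) \<and> (\<forall>c x. g (\<lambda>a. c * x a) = (\<lambda>i. c * g x i)) \<and> (\<forall>v\<in>range \<beta>. \<beta> (g v) = v)"
proof -
  interpret vector_space_pair "\<lambda>c (x :: 'i \<Rightarrow> complex) i. c * x i" "\<lambda>c (x :: 'a \<Rightarrow> complex) i. c * x i"
    by unfold_locales (auto simp: fun_eq_iff algebra_simps)
  have "Vector_Spaces.linear (\<lambda>c (x :: 'i \<Rightarrow> complex) i. c * x i) (\<lambda>c (x :: 'a \<Rightarrow> complex) i. c * x i) \<beta>"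
    by unfold_locales (use assms in auto)
  from linear_exists_right_inverse_on[OF this vs1.subspace_UNIV]
  obtain g where g: "Vector_Spaces.linear (\<lambda>c (x :: 'a \<Rightarrow> complex) i. c * x i) (\<lambda>c (x :: 'i \<Rightarrow> complex) i. c * x i) g"
    "\<forall>v\<in>range \<beta>. \<beta> (g v) = v" by blast
  interpret g: Vector_Spaces.linear "\<lambda>c (x :: 'a \<Rightarrow> complex) i. c * x i" "\<lambda>c (x :: 'i \<Rightarrow> complex) i. c * x i" g by (rule g(1))
  show ?thesis using g(2) g.add g.scale by blast
qed

locale vertex_system =
  fixes E :: "'e set" and W :: "'v set" and en :: "'v \<Rightarrow> ('e \<times> bool) list"
    and a b :: "'v \<Rightarrow> nat \<Rightarrow> nat \<Rightarrow> complex"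
  assumes finE: "finite E" and finW: "finite W"
    and dist: "w \<in> W \<Longrightarrow> distinct (en w)"
    and cover: "(\<Union>w\<in>W. set (en w)) = E \<times> UNIV"
    and disj: "\<lbrakk>w \<in> W; w' \<in> W; w \<noteq> w'\<rbrakk> \<Longrightarrow> set (en w) \<inter> set (en w') = {}"
    and sa: "w \<in> W \<Longrightarrow> sa_pair (length (en w)) (a w) (b w)"
begin

abbreviation "d w \<equiv> length (en w)"
abbreviation "N \<equiv> E \<times> (UNIV :: bool set)"

definition cond_at :: "'v \<Rightarrow> ('e \<times> bool \<Rightarrow> complex) \<Rightarrow> ('e \<times> bool \<Rightarrow> complex) \<Rightarrow> bool" where
  "cond_at w F F' \<longleftrightarrow> (\<forall>i<d w. (\<Sum>j<d w. a w i j * F (en w ! j)) + (\<Sum>j<d w. b w i j * F' (en w ! j)) = 0)"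

definition cond :: "('e \<times> bool \<Rightarrow> complex) \<Rightarrow> ('e \<times> bool \<Rightarrow> complex) \<Rightarrow> bool" where
  "cond F F' \<longleftrightarrow> (\<forall>w\<in>W. cond_at w F F')"

text \<open>The projection to the values \<open>F\<close> of the Lagrangian subspace described by
  \<open>cond\<close>. The support condition matches the default of \<open>etrace\<close>.\<close>

definition bspace :: "('e \<times> bool \<Rightarrow> complex) set" where
  "bspace = {F. (\<forall>x. fst x \<notin> E \<longrightarrow> F x = 0) \<and> (\<exists>F'. cond F F')}"

lemma finN: "finite N" using finE by simp

lemma sum_vertices: "(\<Sum>x\<in>N. \<phi> x) = (\<Sum>w\<in>W. \<Sum>j<d w. \<phi> (en w ! j))" for \<phi> :: "'e \<times> bool \<Rightarrow> complex"
proof -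
  have "(\<Sum>x\<in>N. \<phi> x) = (\<Sum>w\<in>W. \<Sum>x\<in>set (en w). \<phi> x)"
    unfolding cover[symmetric] by (rule sum.UNION_disjoint) (auto simp: finW dest: disj)
  also have "\<dots> = (\<Sum>w\<in>W. \<Sum>j<d w. \<phi> (en w ! j))"
    using dist by (intro sum.cong refl) (auto simp: sum.reindex_bij_betw[OF bij_betw_nth, symmetric])
  finally show ?thesis .
qed

definition vert :: "'e \<times> bool \<Rightarrow> 'v" where "vert x = (SOME w. w \<in> W \<and> x \<in> set (en w))"
definition idx :: "'e \<times> bool \<Rightarrow> nat" where "idx x = (SOME j. j < d (vert x) \<and> en (vert x) ! j = x)"

lemma vert_nth:
  assumes "w \<in> W" "j < d w"
  shows "vert (en w ! j) = w" "idx (en w ! j) = j" "en w ! j \<in> N"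
proof -
  have "vert (en w ! j) \<in> W \<and> en w ! j \<in> set (en (vert (en w ! j)))"
    unfolding vert_def by (rule someI[of _ w]) (use assms in auto)
  then show v: "vert (en w ! j) = w"
    using disj[OF assms(1), of "vert (en w ! j)"] nth_mem[OF assms(2)] by (metis IntI empty_iff)
  have "idx (en w ! j) < d w \<and> en w ! idx (en w ! j) = en w ! j"
    unfolding idx_def v by (rule someI[of _ j]) (use assms in auto)
  then show "idx (en w ! j) = j" using dist[OF assms(1)] assms(2) nth_eq_iff_index_eq by blast
  show "en w ! j \<in> N" unfolding cover[symmetric] using assms nth_mem by blast
qed

text \<open>The blocks \<open>B^*\<close> of all vertices at once, and in \<alpha> the blocks
  \<open>- A^*\<close>; the unknowns \<open>Y\<close> are indexed by a vertex and a row of its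
  matrices. On the edge-ends, the pairs \<open>(\<beta> Y, \<alpha> Y)\<close> parametrize
  \<open>cond\<close>.\<close>

definition \<beta> :: "('v \<times> nat \<Rightarrow> complex) \<Rightarrow> 'e \<times> bool \<Rightarrow> complex" where
  "\<beta> Y x = (if x \<in> N then \<Sum>i<d (vert x). cnj (b (vert x) i (idx x)) * Y (vert x, i) else 0)"
definition \<alpha> :: "('v \<times> nat \<Rightarrow> complex) \<Rightarrow> 'e \<times> bool \<Rightarrow> complex" where
  "\<alpha> Y x = (if x \<in> N then - (\<Sum>i<d (vert x). cnj (a (vert x) i (idx x)) * Y (vert x, i)) else 0)"

lemma \<beta>_nth: "\<lbrakk>w \<in> W; j < d w\<rbrakk> \<Longrightarrow> \<beta> Y (en w ! j) = sa_pair.Bs (d w) (b w) (\<lambda>i. Y (w, i)) j"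
  and \<alpha>_nth: "\<lbrakk>w \<in> W; j < d w\<rbrakk> \<Longrightarrow> \<alpha> Y (en w ! j) = - sa_pair.As (d w) (a w) (\<lambda>i. Y (w, i)) j"
  using vert_nth[of w j] by (simp_all add: \<beta>_def \<alpha>_def sa_pair.Bs_def[OF sa] sa_pair.As_def[OF sa])

lemma cond_at_iff: "w \<in> W \<Longrightarrow> cond_at w F F' \<longleftrightarrow>
    (\<exists>y. \<forall>j<d w. F (en w ! j) = sa_pair.Bs (d w) (b w) y j \<and> F' (en w ! j) = - sa_pair.As (d w) (a w) y j)"
  unfolding cond_at_def by (rule sa_pair.condition_iff[OF sa])

lemma cond_iff: "cond F F' \<longleftrightarrow> (\<exists>Y. \<forall>x\<in>N. F x = \<beta> Y x \<and> F' x = \<alpha> Y x)"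
proof
  assume "cond F F'"
  then have "\<forall>w\<in>W. \<exists>y. \<forall>j<d w. F (en w ! j) = sa_pair.Bs (d w) (b w) y j \<and> F' (en w ! j) = - sa_pair.As (d w) (a w) y j"
    by (simp add: cond_def cond_at_iff)
  from bchoice[OF this] obtain y where y: "\<And>w j. \<lbrakk>w \<in> W; j < d w\<rbrakk> \<Longrightarrow>
      F (en w ! j) = sa_pair.Bs (d w) (b w) (y w) j \<and> F' (en w ! j) = - sa_pair.As (d w) (a w) (y w) j" by blast
  define Y where "Y = (\<lambda>(w, i). y w i)"
  have "F x = \<beta> Y x \<and> F' x = \<alpha> Y x" if "x \<in> N" for x
  proof -
    have "x \<in> (\<Union>w\<in>W. set (en w))" using that cover by simp
    then obtain w where w: "w \<in> W" "x \<in> set (en w)" by blast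
    from w(2) obtain j where "j < d w" "x = en w ! j" unfolding in_set_conv_nth by blast
    with w(1) show ?thesis using y by (simp add: \<beta>_nth \<alpha>_nth Y_def)
  qed
  then show "\<exists>Y. \<forall>x\<in>N. F x = \<beta> Y x \<and> F' x = \<alpha> Y x" by blast
next
  assume "\<exists>Y. \<forall>x\<in>N. F x = \<beta> Y x \<and> F' x = \<alpha> Y x"
  then obtain Y where Y: "\<And>x. x \<in> N \<Longrightarrow> F x = \<beta> Y x \<and> F' x = \<alpha> Y x" by blast
  have "cond_at w F F'" if "w \<in> W" for w
    unfolding cond_at_iff[OF that] using that Y[OF vert_nth(3)[OF that]]
    by (intro exI[of _ "\<lambda>i. Y (w, i)"]) (auto simp: \<beta>_nth \<alpha>_nth)
  then show "cond F F'" by (simp add: cond_def)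
qed

lemma bspace_eq: "bspace = range \<beta>"
proof
  show "bspace \<subseteq> range \<beta>"
  proof
    fix F assume "F \<in> bspace"
    then obtain F' where F: "\<And>x. fst x \<notin> E \<Longrightarrow> F x = 0" "cond F F'" by (auto simp: bspace_def)
    from F(2) obtain Y where Y: "\<forall>x\<in>N. F x = \<beta> Y x" unfolding cond_iff by blast
    have "F = \<beta> Y"
    proof
      fix x
      show "F x = \<beta> Y x"
      proof (cases "x \<in> N")
        case True
        then show ?thesis using Y by blast
      next
        case False
        then show ?thesis using F(1)[of x] by (simp add: \<beta>_def mem_Times_iff)
      qed
    qed
    then show "F \<in> range \<beta>" by blast
  qed
  have "cond (\<beta> Y) (\<alpha> Y)" for Y unfolding cond_iff by blast
  then show "range \<beta> \<subseteq> bspace" by (auto simp: bspace_def \<beta>_def)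
qed

text \<open>The isotropy of self-adjoint conditions. It makes the pairing of \<open>F'\<close> with
  \<open>G\<close> independent of the choice of \<open>F'\<close> and the boundary form
  Hermitian.\<close>

lemma cond_symmetric:
  assumes "cond F F'" "cond G G'"
  shows "(\<Sum>x\<in>N. F' x * cnj (G x)) = (\<Sum>x\<in>N. F x * cnj (G' x))"
  unfolding sum_vertices
proof (rule sum.cong)
  fix w assume w: "w \<in> W"
  obtain y where y: "\<forall>j<d w. F (en w ! j) = sa_pair.Bs (d w) (b w) y j \<and> F' (en w ! j) = - sa_pair.As (d w) (a w) y j"
    using assms(1) w by (auto simp: cond_def cond_at_iff)
  obtain z where z: "\<forall>j<d w. G (en w ! j) = sa_pair.Bs (d w) (b w) z j \<and> G' (en w ! j) = - sa_pair.As (d w) (a w) z j"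
    using assms(2) w by (auto simp: cond_def cond_at_iff)
  show "(\<Sum>j<d w. F' (en w ! j) * cnj (G (en w ! j))) = (\<Sum>j<d w. F (en w ! j) * cnj (G' (en w ! j)))"
    using sa_pair.Bs_As_symmetric[OF sa[OF w], of y z] y z by (simp add: sum_negf)
qed simp

lemma cond_add: "\<lbrakk>cond F F'; cond G G'\<rbrakk> \<Longrightarrow> cond (\<lambda>x. F x + G x) (\<lambda>x. F' x + G' x)"
proof -
  assume C: "cond F F'" "cond G G'"
  have "(\<Sum>j<d w. a w i j * (F (en w ! j) + G (en w ! j))) + (\<Sum>j<d w. b w i j * (F' (en w ! j) + G' (en w ! j))) =
      ((\<Sum>j<d w. a w i j * F (en w ! j)) + (\<Sum>j<d w. b w i j * F' (en w ! j))) +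
      ((\<Sum>j<d w. a w i j * G (en w ! j)) + (\<Sum>j<d w. b w i j * G' (en w ! j)))" for w i
    by (simp add: sum.distrib distrib_left)
  then show ?thesis using C by (simp add: cond_def cond_at_def)
qed

lemma cond_scale: "cond F F' \<Longrightarrow> cond (\<lambda>x. c * F x) (\<lambda>x. c * F' x)"
proof -
  assume C: "cond F F'"
  have "(\<Sum>j<d w. a w i j * (c * F (en w ! j))) + (\<Sum>j<d w. b w i j * (c * F' (en w ! j))) =
      c * ((\<Sum>j<d w. a w i j * F (en w ! j)) + (\<Sum>j<d w. b w i j * F' (en w ! j)))" for w i
    by (simp add: sum_distrib_left distrib_left mult.left_commute)
  then show ?thesis using C by (simp add: cond_def cond_at_def)
qed

abbreviation "appN T F \<equiv> \<lambda>x. \<Sum>c\<in>N. T x c * F c"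

text \<open>\<open>T\<close> is a linear choice of \<open>F'\<close> with \<open>cond F F'\<close>, which makes the boundary form bounded, and \<open>P\<close> is a
  projection onto \<open>bspace\<close>, which shows that \<open>bspace\<close> is closed.\<close>

definition selection :: "('e \<times> bool \<Rightarrow> 'e \<times> bool \<Rightarrow> complex) \<Rightarrow> ('e \<times> bool \<Rightarrow> 'e \<times> bool \<Rightarrow> complex) \<Rightarrow> bool" where
  "selection T P \<longleftrightarrow> (\<forall>F\<in>bspace. cond F (appN T F)) \<and>
     (\<forall>F. (appN P F) \<in> bspace) \<and> (\<forall>F\<in>bspace. F = (appN P F))"

definition sel :: "'e \<times> bool \<Rightarrow> 'e \<times> bool \<Rightarrow> complex" where
  "sel = (SOME T. \<exists>P. selection T P)"

text \<open>A linear right inverse \<open>g\<close> of \<beta> gives \<open>T\<close> as \<alpha>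
  after \<open>g\<close> and \<open>P\<close> as \<beta> after \<open>g\<close>.\<close>

lemma selection_exists: "\<exists>T P. selection T P"
proof -
  have add: "\<beta> (x + y) = \<beta> x + \<beta> y" "\<alpha> (x + y) = \<alpha> x + \<alpha> y" for x y
    by (auto simp: \<beta>_def \<alpha>_def fun_eq_iff distrib_left sum.distrib)
  have scale: "\<beta> (\<lambda>i. c * x i) = (\<lambda>i. c * \<beta> x i)" "\<alpha> (\<lambda>i. c * x i) = (\<lambda>i. c * \<alpha> x i)" for c x
    by (auto simp: \<beta>_def \<alpha>_def fun_eq_iff sum_distrib_left mult.left_commute)
  obtain g where g: "\<And>x y. g (x + y) = g x + g y" "\<And>c x. g (\<lambda>i. c * x i) = (\<lambda>i. c * g x i)"
    "\<And>v. v \<in> range \<beta> \<Longrightarrow> \<beta> (g v) = v"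
    using linear_right_inverse[of \<beta>, OF add(1) scale(1)] by blast
  define \<delta> where "\<delta> = (\<lambda>c x :: 'e \<times> bool. if x = c then 1 else 0 :: complex)"
  \<comment> \<open>Expansion in the unit vectors of the edge-ends; by linearity the matrix entries
    are the values of the maps at these vectors.\<close>
  define K where "K = (\<lambda>F x. \<Sum>c\<in>N. F c * \<delta> c x)"
  have g0: "g (\<lambda>_. 0) = (\<lambda>_. 0)" using g(2)[of 0 "\<lambda>_. 0"] by simp
  have gK: "g (\<lambda>x. \<Sum>c\<in>I. F c * \<delta> c x) = (\<lambda>i. \<Sum>c\<in>I. F c * g (\<delta> c) i)" if "finite I" for F I
    using that
  proof (induction I rule: finite_induct)
    case (insert c I)
    have "(\<lambda>x. \<Sum>c\<in>insert c I. F c * \<delta> c x) = (\<lambda>x. F c * \<delta> c x) + (\<lambda>x. \<Sum>c\<in>I. F c * \<delta> c x)"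
      using insert.hyps by (auto simp: fun_eq_iff)
    then show ?case
      unfolding g(1) g(2) insert.IH using insert.hyps by (simp only: g(1) g(2) insert.IH) (simp add: fun_eq_iff)
  qed (simp add: g0)
  have gKN: "g (K F) = (\<lambda>i. \<Sum>c\<in>N. F c * g (\<delta> c) i)" for F unfolding K_def by (rule gK[OF finN])
  have \<beta>K: "\<beta> (g (K F)) = (\<lambda>x. \<Sum>c\<in>N. \<beta> (g (\<delta> c)) x * F c)" for F
    unfolding gKN by (auto simp: \<beta>_def fun_eq_iff sum_distrib_left sum_distrib_right mult_ac intro: sum.swap)
  have \<alpha>K: "\<alpha> (g (K F)) = (\<lambda>x. \<Sum>c\<in>N. \<alpha> (g (\<delta> c)) x * F c)" for F
    unfolding gKN
    by (auto simp: \<alpha>_def fun_eq_iff sum_distrib_left sum_distrib_right sum_negf mult_ac intro: sum.swap)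
  have KF: "K F = F" if "F \<in> bspace" for F
  proof
    fix x
    have "K F x = (if x \<in> N then F x else 0)" unfolding K_def \<delta>_def using finN by (simp add: if_distrib cong: if_cong)
    then show "K F x = F x" using that by (cases x) (auto simp: bspace_def)
  qed
  show ?thesis
    unfolding selection_def
  proof (intro exI conjI ballI allI)
    fix F assume F: "F \<in> bspace"
    then have bg: "\<beta> (g F) = F" by (intro g(3)) (simp add: bspace_eq)
    show "cond F (\<lambda>x. \<Sum>c\<in>N. \<alpha> (g (\<delta> c)) x * F c)"
      unfolding cond_iff using bg \<alpha>K[of F] KF[OF F] by (intro exI[of _ "g F"]) (simp add: fun_eq_iff)
    show "F = (\<lambda>x. \<Sum>c\<in>N. \<beta> (g (\<delta> c)) x * F c)" using bg \<beta>K[of F] KF[OF F] by simp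
  next
    fix F
    show "(\<lambda>x. \<Sum>c\<in>N. \<beta> (g (\<delta> c)) x * F c) \<in> bspace"
      unfolding \<beta>K[symmetric] bspace_eq by simp
  qed
qed

lemma sel: "\<exists>P. selection sel P"
  unfolding sel_def by (rule someI_ex[OF selection_exists])

lemma cond_sel: "F \<in> bspace \<Longrightarrow> cond F (appN sel F)"
  using sel unfolding selection_def by blast

text \<open>Symmetry is applied twice: it moves \<open>sel\<close> over to \<open>G\<close> and then
  back to \<open>F\<close>, where \<open>F'\<close> may take its place.\<close>

lemma bform_eq:
  assumes "F \<in> bspace" "G \<in> bspace" "cond F F'"
  shows "bform E sel F G = (\<Sum>x\<in>N. F' x * cnj (G x))"
proof -
  have "bform E sel F G = (\<Sum>x\<in>N. (\<Sum>c\<in>N. sel x c * F c) * cnj (G x))"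
    by (simp add: bform_def sum_distrib_right)
  also have "\<dots> = (\<Sum>x\<in>N. F x * cnj (\<Sum>c\<in>N. sel x c * G c))"
    by (rule cond_symmetric[OF cond_sel cond_sel]) fact+
  also have "\<dots> = (\<Sum>x\<in>N. F' x * cnj (G x))"
    by (rule cond_symmetric[OF assms(3) cond_sel[OF assms(2)], symmetric])
  finally show ?thesis .
qed

lemma bform_herm:
  assumes "F \<in> bspace" "G \<in> bspace"
  shows "bform E sel G F = cnj (bform E sel F G)"
  unfolding bform_eq[OF assms(2,1) cond_sel[OF assms(2)]] bform_eq[OF assms cond_sel[OF assms(1)]]
  using cond_symmetric[OF cond_sel[OF assms(2)] cond_sel[OF assms(1)]] by (simp add: mult.commute)

text \<open>Admissible derivative data for \<open>F\<close> differ by elements orthogonal to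
  \<open>bspace\<close>, the range of \<open>B^*\<close>, that is, by the kernel of
  \<open>B\<close>. So \<open>A F + B F'\<close> keeps the value 0 that it has at the selected data
  \<open>S\<close>.\<close>

theorem cond_iff_variational:
  assumes F: "F \<in> bspace"
  shows "cond F F' \<longleftrightarrow> (\<forall>G\<in>bspace. (\<Sum>x\<in>N. F' x * cnj (G x)) = bform E sel F G)"
proof
  assume "cond F F'"
  then show "\<forall>G\<in>bspace. (\<Sum>x\<in>N. F' x * cnj (G x)) = bform E sel F G"
    using bform_eq[OF F] by simp
next
  assume var: "\<forall>G\<in>bspace. (\<Sum>x\<in>N. F' x * cnj (G x)) = bform E sel F G"
  define S where "S = (appN sel F)"
  have S: "cond F S" unfolding S_def by (rule cond_sel[OF F])
  have K: "(\<Sum>j<d w. b w i j * (F' (en w ! j) - S (en w ! j))) = 0" if w: "w \<in> W" and i: "i < d w" for w i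
  proof -
    \<comment> \<open>The image \<open>\<beta> Y\<close> is column \<open>i\<close> of
      \<open>B^*\<close> at the vertex \<open>w\<close>; testing with it extracts row
      \<open>i\<close> of \<open>B (F' - S)\<close> there.\<close>
    define Y where "Y = (\<lambda>p. if p = (w, i) then 1 else 0 :: complex)"
    have Y: "\<beta> Y \<in> bspace" by (simp add: bspace_eq)
    have "(\<Sum>x\<in>N. (F' x - S x) * cnj (\<beta> Y x)) = 0"
      using var Y bform_eq[OF F Y S] by (simp add: left_diff_distrib sum_subtractf)
    moreover have "(\<Sum>j<d w'. (F' (en w' ! j) - S (en w' ! j)) * cnj (\<beta> Y (en w' ! j))) =
        (if w' = w then \<Sum>j<d w. b w i j * (F' (en w ! j) - S (en w ! j)) else 0)" if "w' \<in> W" for w'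
    proof -
      have "\<beta> Y (en w' ! j) = (if w' = w then cnj (b w i j) else 0)" if "j < d w'" for j
        unfolding \<beta>_nth[OF \<open>w' \<in> W\<close> that] sa_pair.Bs_def[OF sa[OF \<open>w' \<in> W\<close>]] Y_def using i
        by (auto simp: if_distrib cong: if_cong)
      then show ?thesis by (auto simp: mult.commute)
    qed
    ultimately show ?thesis using w finW by (simp add: sum_vertices)
  qed
  show "cond F F'"
    using S K unfolding cond_def cond_at_def by (simp add: right_diff_distrib sum_subtractf)
qed

lemma bspace_closed:
  assumes "\<And>n::nat. Fs n \<in> bspace" "\<And>x. (\<lambda>n. Fs n x) \<longlonglongrightarrow> F x"
  shows "F \<in> bspace"
proof -
  obtain P where P: "\<And>F. (appN P F) \<in> bspace"
    "\<And>F. F \<in> bspace \<Longrightarrow> F = (appN P F)" using sel unfolding selection_def by blast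
  have "F x = (\<Sum>c\<in>N. P x c * F c)" for x
  proof (rule LIMSEQ_unique[OF assms(2)])
    have "(\<lambda>n. \<Sum>c\<in>N. P x c * Fs n c) \<longlonglongrightarrow> (\<Sum>c\<in>N. P x c * F c)"
      by (intro tendsto_intros assms(2))
    moreover have "(\<Sum>c\<in>N. P x c * Fs n c) = Fs n x" for n using P(2)[OF assms(1)[of n]] by (metis (no_types, lifting))
    ultimately show "(\<lambda>n. Fs n x) \<longlonglongrightarrow> (\<Sum>c\<in>N. P x c * F c)" by simp
  qed
  then have F: "F = (appN P F)" by (intro ext)
  show ?thesis by (subst F) (rule P(1))
qed

lemma metric_graph_form_bspace:
  assumes "E \<noteq> {}" "\<And>e. e \<in> E \<Longrightarrow> 0 < l e" "\<And>e. e \<in> E \<Longrightarrow> L2_on (l e) (V e)"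
  shows "metric_graph_form E l V bspace sel"
proof
  have "cond (\<lambda>_. 0) (\<lambda>_. 0)" by (simp add: cond_def cond_at_def)
  then show "(\<lambda>_. 0) \<in> bspace" by (auto simp: bspace_def)
  show "(\<lambda>x. F x + G x) \<in> bspace" if "F \<in> bspace" "G \<in> bspace" for F G
    using that cond_add by (fastforce simp: bspace_def)
  show "(\<lambda>x. c * F x) \<in> bspace" if "F \<in> bspace" for F c
    using that cond_scale by (fastforce simp: bspace_def)
  show "F \<in> bspace" if "\<And>n::nat. Fs n \<in> bspace" "\<And>x. (\<lambda>n. Fs n x) \<longlonglongrightarrow> F x" for Fs F
    using that by (rule bspace_closed)
  show "bform E sel G F = cnj (bform E sel F G)" if "F \<in> bspace" "G \<in> bspace" for F G
    using that by (rule bform_herm)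
  show "F x = 0" if "F \<in> bspace" "fst x \<notin> E" for F x
    using that by (cases x) (simp add: bspace_def)
qed (fact finE assms)+

end

section \<open>From matrices to coefficient functions\<close>

lemma (in vec_space) full_rank_annihilator:
  assumes C: "C \<in> carrier_mat n m" and r: "rank C = n"
    and zero: "\<And>k. k < m \<Longrightarrow> (\<Sum>i<n. C $$ (i, k) * z i) = 0"
  shows "\<forall>i<n. z i = 0"
proof (intro allI impI)
  fix i0 assume i0: "i0 < n"
  have cc: "set (cols C) \<subseteq> carrier_vec n" using cols_dim C by blast
  have "lin_indpt {}" by (simp add: lin_dep_def)
  then obtain S where S: "maximal S (\<lambda>T. T \<subseteq> set (cols C) \<and> lin_indpt T)" and finS: "finite S"
    using maximal_exists_superset[of "set (cols C)" "\<lambda>T. T \<subseteq> set (cols C) \<and> lin_indpt T" "{}"] by auto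
  then have Sc: "S \<subseteq> set (cols C)" and li: "lin_indpt S" by (auto simp: maximal_def)
  have "card S = n" using rank_card_indpt[OF C S] r by simp
  \<comment> \<open>Rank \<open>n\<close> makes the columns span, so the unit vector is a
    combination of columns, each of which is annihilated by \<open>z\<close>.\<close>
  then have "basis S" using Sc cc li finS by (intro dim_li_is_basis) (auto simp: dim_is_n)
  then have "span S = carrier_vec n" by (simp add: basis_def)
  then have "unit_vec n i0 \<in> span S" by simp
  have SC: "S \<subseteq> carrier_vec n" using Sc cc by blast
  have "\<exists>c. lincomb c S = unit_vec n i0"
    using finite_in_span[OF finS _ \<open>unit_vec n i0 \<in> span S\<close>] SC by auto
  then obtain c where c: "unit_vec n i0 = lincomb c S" by metis
  have zS: "(\<Sum>i<n. x $ i * z i) = 0" if "x \<in> S" for x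
  proof -
    have "x \<in> col C ` {0..<m}" using that Sc C by (auto simp: cols_def)
    then obtain k where k: "k < m" "x = col C k" by auto
    have "(\<Sum>i<n. x $ i * z i) = (\<Sum>i<n. C $$ (i, k) * z i)"
      using k C by (intro sum.cong) auto
    then show ?thesis using zero[OF k(1)] by simp
  qed
  have "z i0 = (\<Sum>i<n. if i = i0 then z i else 0)" using i0 by simp
  also have "\<dots> = (\<Sum>i<n. unit_vec n i0 $ i * z i)"
    using i0 by (intro sum.cong) auto
  also have "\<dots> = (\<Sum>i<n. (\<Sum>x\<in>S. c x * x $ i) * z i)"
    unfolding c using Sc cc by (intro sum.cong) (auto simp: lincomb_index)
  also have "\<dots> = (\<Sum>x\<in>S. c x * (\<Sum>i<n. x $ i * z i))"
    unfolding sum_distrib_left sum_distrib_right by (subst sum.swap) (simp add: mult.assoc)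
  also have "\<dots> = 0" by (simp add: zS)
  finally show "z i0 = 0" .
qed

lemma mat_adjoint_index:
  "\<lbrakk>A \<in> carrier_mat n m; i < m; j < n\<rbrakk> \<Longrightarrow> mat_adjoint A $$ (i, j) = cnj (A $$ (j, i))"
  by (auto simp: mat_adjoint_def mat_of_rows_def cols_def conjugate_complex_def)

lemma mat_adjoint_carrier: "A \<in> carrier_mat n m \<Longrightarrow> mat_adjoint A \<in> carrier_mat m n"
  by (auto simp: mat_adjoint_def mat_of_rows_def cols_def)

lemma mult_mat_adjoint_index:
  assumes "A \<in> carrier_mat d d" "B \<in> carrier_mat d d" "i < d" "k < d"
  shows "(A * mat_adjoint B) $$ (i, k) = (\<Sum>j<d. A $$ (i, j) * cnj (B $$ (k, j)))"
proof -
  note B' = mat_adjoint_carrier[OF assms(2)]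
  have "(A * mat_adjoint B) $$ (i, k) = (\<Sum>j<d. A $$ (i, j) * mat_adjoint B $$ (j, k))"
    using assms B' by (auto simp: scalar_prod_def atLeast0LessThan intro!: sum.cong)
  then show ?thesis using assms by (simp add: mat_adjoint_index[OF assms(2)])
qed

lemma sa_pair_of_condition:
  assumes "self_adjoint_condition d A B"
  shows "sa_pair d (\<lambda>i j. A $$ (i, j)) (\<lambda>i j. B $$ (i, j))"
proof
  have A: "A \<in> carrier_mat d d" and B: "B \<in> carrier_mat d d" and r: "vec_space.rank d (hcat A B) = d"
    and s: "mat_adjoint (A * mat_adjoint B) = A * mat_adjoint B"
    using assms by (auto simp: self_adjoint_condition_def)
  note AB = mult_carrier_mat[OF A mat_adjoint_carrier[OF B]]
  show "(\<Sum>j<d. A $$ (i, j) * cnj (B $$ (k, j))) = (\<Sum>j<d. B $$ (i, j) * cnj (A $$ (k, j)))"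
    if "i < d" "k < d" for i k
  proof -
    have "(\<Sum>j<d. A $$ (i, j) * cnj (B $$ (k, j))) = (A * mat_adjoint B) $$ (i, k)"
      using mult_mat_adjoint_index[OF A B that] by simp
    also have "\<dots> = cnj ((A * mat_adjoint B) $$ (k, i))"
      using mat_adjoint_index[OF AB that] s by simp
    also have "\<dots> = (\<Sum>j<d. B $$ (i, j) * cnj (A $$ (k, j)))"
      unfolding mult_mat_adjoint_index[OF A B that(2,1)] by (simp add: mult.commute)
    finally show ?thesis .
  qed
  fix y assume y: "\<forall>j<d. (\<Sum>i<d. cnj (A $$ (i, j)) * y i) = 0 \<and> (\<Sum>i<d. cnj (B $$ (i, j)) * y i) = 0"
  have C: "hcat A B \<in> carrier_mat d (d + d)" using A B by (auto simp: hcat_def)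
  \<comment> \<open>\<open>full_rank_annihilator\<close> involves no conjugation, whereas
    \<open>y\<close> is annihilated by the adjoint matrices; hence \<open>cnj\<close>.\<close>
  have "\<forall>i<d. cnj (y i) = 0"
  proof (rule vec_space.full_rank_annihilator[OF C r])
    fix k assume k: "k < d + d"
    have cn: "(\<Sum>i<d. M i * cnj (y i)) = cnj (\<Sum>i<d. cnj (M i) * y i)" for M :: "nat \<Rightarrow> complex" by simp
    show "(\<Sum>i<d. hcat A B $$ (i, k) * cnj (y i)) = 0"
    proof (cases "k < d")
      case True
      have "(\<Sum>i<d. hcat A B $$ (i, k) * cnj (y i)) = (\<Sum>i<d. A $$ (i, k) * cnj (y i))"
        using True A B by (intro sum.cong) (auto simp: hcat_def)
      then show ?thesis unfolding cn using y True by simp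
    next
      case False
      have "(\<Sum>i<d. hcat A B $$ (i, k) * cnj (y i)) = (\<Sum>i<d. B $$ (i, k - d) * cnj (y i))"
        using False k A B by (intro sum.cong) (auto simp: hcat_def)
      then show ?thesis unfolding cn using y False k by simp
    qed
  qed
  then show "\<forall>i<d. y i = 0" by simp
qed

lemma satisfies_condition_sums:
  assumes "A \<in> carrier_mat d d" "B \<in> carrier_mat d d" "length xs = d"
  shows "satisfies_condition d A B (vec_of_list (map F xs)) (vec_of_list (map F' xs)) \<longleftrightarrow>
    (\<forall>i<d. (\<Sum>j<d. A $$ (i, j) * F (xs ! j)) + (\<Sum>j<d. B $$ (i, j) * F' (xs ! j)) = 0)"
proof -
  have eq: "(M *\<^sub>v vec_of_list (map G xs)) $ i = (\<Sum>j<d. M $$ (i, j) * G (xs ! j))"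
    if "M \<in> carrier_mat d d" "i < d" for M :: "complex mat" and G i
    using that assms(3) by (auto simp: scalar_prod_def vec_of_list_index atLeast0LessThan intro!: sum.cong)
  have "A *\<^sub>v vec_of_list (map F xs) + B *\<^sub>v vec_of_list (map F' xs) = 0\<^sub>v d \<longleftrightarrow>
      (\<forall>i<d. (A *\<^sub>v vec_of_list (map F xs) + B *\<^sub>v vec_of_list (map F' xs)) $ i = 0)"
    using assms by (auto simp: vec_eq_iff)
  also have "\<dots> \<longleftrightarrow> (\<forall>i<d. (\<Sum>j<d. A $$ (i, j) * F (xs ! j)) + (\<Sum>j<d. B $$ (i, j) * F' (xs ! j)) = 0)"
    using assms eq by (auto simp del: index_mult_mat_vec)
  finally show ?thesis by (simp add: satisfies_condition_def)
qed

section \<open>Eigenvalues of quantum graphs\<close>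

text \<open>Suppose \<open>u n < v n\<close> at the first index of disagreement. By monotonicity
  \<open>v\<close> takes the value \<open>u n\<close> only below \<open>n\<close>, where both agree,
  while \<open>u\<close> takes it at \<open>n\<close> as well, so the multiplicities differ.\<close>

lemma eigenvalue_labeling_unique:
  assumes s: "eigenvalue_labeling \<Gamma> s" and t: "eigenvalue_labeling \<Gamma> t"
  shows "1 \<le> n \<Longrightarrow> s n = t n"
proof (induction n rule: less_induct)
  case (less n)
  have *: "\<not> u n < v n"
    if uv: "eigenvalue_labeling \<Gamma> u" "eigenvalue_labeling \<Gamma> v" and eq: "\<And>m. m < n \<Longrightarrow> 1 \<le> m \<Longrightarrow> u m = v m" for u v
  proof
    assume lt: "u n < v n"
    have fin: "finite {m. 1 \<le> m \<and> u m = u n}"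
      and card: "card {m. 1 \<le> m \<and> u m = u n} = card {m. 1 \<le> m \<and> v m = u n}"
      using uv unfolding eigenvalue_labeling_def by auto
    have sub: "{m. 1 \<le> m \<and> v m = u n} \<subset> {m. 1 \<le> m \<and> u m = u n}"
    proof
      show "{m. 1 \<le> m \<and> v m = u n} \<subseteq> {m. 1 \<le> m \<and> u m = u n}"
      proof safe
        fix m assume m: "1 \<le> m" "v m = u n"
        have "m < n"
        proof (rule ccontr)
          assume "\<not> m < n"
          have "mono_on {1..} v" using uv(2) by (simp add: eigenvalue_labeling_def)
          from mono_onD[OF this, of n m] have "v n \<le> v m" using less.prems \<open>\<not> m < n\<close> by simp
          then show False using lt m by simp
        qed
        then show "u m = u n" using eq m by simp
      qed
      show "{m. 1 \<le> m \<and> v m = u n} \<noteq> {m. 1 \<le> m \<and> u m = u n}"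
      proof -
        have "n \<in> {m. 1 \<le> m \<and> u m = u n}" "n \<notin> {m. 1 \<le> m \<and> v m = u n}" using less.prems lt by auto
        then show ?thesis by blast
      qed
    qed
    then show False using psubset_card_mono[OF fin sub] card by linarith
  qed
  show ?case using *[OF s t] *[OF t s] less.IH by force
qed

section \<open>The form of a quantum graph and its eigenvalues\<close>

locale qgraph_form =
  fixes \<Gamma> :: "('e, 'v) qgraph"
  assumes qg: "quantum_graph \<Gamma>"
begin

sublocale vertex_system "edges \<Gamma>" "verts \<Gamma>" "ends \<Gamma>" "\<lambda>w i j. cA \<Gamma> w $$ (i, j)" "\<lambda>w i j. cB \<Gamma> w $$ (i, j)"
proof (rule vertex_system.intro)
  show "sa_pair (length (ends \<Gamma> w)) (\<lambda>i j. cA \<Gamma> w $$ (i, j)) (\<lambda>i j. cB \<Gamma> w $$ (i, j))" if "w \<in> verts \<Gamma>" for w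
    using qg that by (intro sa_pair_of_condition) (auto simp: quantum_graph_def vdegree_def)
qed (use qg in \<open>auto simp: quantum_graph_def\<close>)

sublocale metric_graph_form "edges \<Gamma>" "len \<Gamma>" "pot \<Gamma>" bspace sel
  using qg by (intro metric_graph_form_bspace) (auto simp: quantum_graph_def)

lemma satisfies_condition_iff:
  "w \<in> verts \<Gamma> \<Longrightarrow> satisfies_condition (vdegree \<Gamma> w) (cA \<Gamma> w) (cB \<Gamma> w)
     (vec_of_list (map F (ends \<Gamma> w))) (vec_of_list (map F' (ends \<Gamma> w))) \<longleftrightarrow> cond_at w F F'"
  unfolding cond_at_def using qg
  by (subst satisfies_condition_sums) (auto simp: quantum_graph_def self_adjoint_condition_def vdegree_def)

lemma end_value_etrace: "x \<in> N \<Longrightarrow> end_value \<Gamma> f x = tr f x"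
  by (cases x; cases "snd x") (auto simp: etrace_def)

lemma end_deriv_dtrace: "end_deriv \<Gamma> f x = dtrace (len \<Gamma>) f x"
  by (cases x; cases "snd x") (auto simp: dtrace_def)

lemma vertex_conditions_iff:
  "(\<forall>w\<in>verts \<Gamma>. satisfies_condition (vdegree \<Gamma> w) (cA \<Gamma> w) (cB \<Gamma> w) (vertex_values \<Gamma> f w) (vertex_derivs \<Gamma> f w))
   \<longleftrightarrow> cond (tr f) (dtrace (len \<Gamma>) f)"
proof -
  have "vertex_values \<Gamma> f w = vec_of_list (map (tr f) (ends \<Gamma> w))"
    "vertex_derivs \<Gamma> f w = vec_of_list (map (dtrace (len \<Gamma>) f) (ends \<Gamma> w))" if "w \<in> verts \<Gamma>" for w
  proof -
    have "set (ends \<Gamma> w) \<subseteq> N" unfolding cover[symmetric] using that by blast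
    then have "map (end_value \<Gamma> f) (ends \<Gamma> w) = map (tr f) (ends \<Gamma> w)"
      by (intro map_cong end_value_etrace) auto
    then show "vertex_values \<Gamma> f w = vec_of_list (map (tr f) (ends \<Gamma> w))"
      unfolding vertex_values_def by (rule arg_cong)
    show "vertex_derivs \<Gamma> f w = vec_of_list (map (dtrace (len \<Gamma>) f) (ends \<Gamma> w))"
      by (simp add: vertex_derivs_def end_deriv_dtrace[abs_def])
  qed
  then show ?thesis using satisfies_condition_iff by (simp add: cond_def)
qed

text \<open>\<open>weak_eigenvector_iff\<close> and \<open>cond_iff_variational\<close> meet here:
  the natural boundary condition of the form is the prescribed vertex condition.\<close>

lemma eigenspace_eq: "eigenspace \<Gamma> \<mu> = {f \<in> Q. \<forall>g\<in>Q. hf f g = complex_of_real \<mu> * ip f g}"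
proof -
  have "f \<in> eigenspace \<Gamma> \<mu> \<longleftrightarrow> f \<in> Q \<and> (\<forall>g\<in>Q. hf f g = complex_of_real \<mu> * ip f g)" for f
  proof -
    let ?F = "tr f" and ?F' = "dtrace (len \<Gamma>) f"
    have "cond ?F ?F' \<longleftrightarrow> ?F \<in> bspace \<and> (\<forall>G\<in>bspace. (\<Sum>x\<in>N. ?F' x * cnj (G x)) = bform (edges \<Gamma>) sel ?F G)"
    proof (cases "?F \<in> bspace")
      case True
      then show ?thesis using cond_iff_variational by blast
    next
      case False
      \<comment> \<open>\<open>tr f\<close> vanishes off the edges, so \<open>cond\<close> alone
        would put it into \<open>bspace\<close>; both sides are false.\<close>
      then show ?thesis by (auto simp: bspace_def etrace_def)
    qed
    then show ?thesis
      unfolding weak_eigenvector_iff eigenspace_def op_maps_def op_domain_def mem_Collect_eq vertex_conditions_iff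
      by (auto simp: fscale_def H2_on_def)
  qed
  then show ?thesis by blast
qed

text \<open>The spectral sequence is a labeling by \<open>sp_dim\<close>. Its existence gives
  \<open>SOME\<close> a meaning and uniqueness identifies the chosen labeling with it.\<close>

lemma eigval_spectral_seq:
  assumes sp: "spectral_seq Q ip hf \<phi> s"
  shows "eigval \<Gamma> (Suc n) = s n"
proof -
  \<comment> \<open>Labelings count from 1, spectral sequences from 0.\<close>
  define t where "t = (\<lambda>n. s (n - 1))"
  have "eigenvalue_labeling \<Gamma> t"
    unfolding eigenvalue_labeling_def
  proof (intro conjI allI)
    show "mono_on {1..} t"
      using sp_mono[OF sp] by (auto simp: mono_on_def t_def intro!: monoD[of s])
    fix \<mu>
    have eq: "{n. 1 \<le> n \<and> t n = \<mu>} = Suc ` {n. s n = \<mu>}"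
    proof safe
      fix n :: nat assume "1 \<le> n"
      then show "n \<in> Suc ` {m. s m = t n}" by (intro image_eqI[of _ _ "n - 1"]) (auto simp: t_def)
    qed (auto simp: t_def)
    show "finite {n. 1 \<le> n \<and> t n = \<mu>}" unfolding eq using sp_finite[OF sp] by simp
    show "card {n. 1 \<le> n \<and> t n = \<mu>} = eig_multiplicity \<Gamma> \<mu>"
      unfolding eq eig_multiplicity_def eigenspace_eq sp_dim[OF sp] by (simp add: card_image)
  qed
  moreover from this have "eigenvalue_labeling \<Gamma> (eigval \<Gamma>)" unfolding eigval_def by (rule someI[of "eigenvalue_labeling \<Gamma>"])
  ultimately have "eigval \<Gamma> (Suc n) = t (Suc n)" by (intro eigenvalue_labeling_unique) auto
  then show ?thesis by (simp add: t_def)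
qed

text \<open>Passing from lists to sets of edge-ends makes the condition independent of their order,
  which gluing leaves open.\<close>

lemma cond_at_delta:
  assumes v: "v \<in> verts \<Gamma>" and delta: "delta_type \<Gamma> v p"
  shows "cond_at v F F' \<longleftrightarrow> (\<exists>c. (\<forall>x\<in>set (ends \<Gamma> v). F x = c) \<and> (\<Sum>x\<in>set (ends \<Gamma> v). F' x) = of_real p * c)"
proof -
  let ?F = "vec_of_list (map F (ends \<Gamma> v))" and ?F' = "vec_of_list (map F' (ends \<Gamma> v))"
  have car: "?F \<in> carrier_vec (vdegree \<Gamma> v)" "?F' \<in> carrier_vec (vdegree \<Gamma> v)"
    by (auto simp: vdegree_def intro: carrier_vecI)
  have 1: "cond_at v F F' \<longleftrightarrow> (\<exists>c. (\<forall>i<vdegree \<Gamma> v. ?F $ i = c) \<and> (\<Sum>i<vdegree \<Gamma> v. ?F' $ i) = of_real p * c)"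
    using delta car unfolding satisfies_condition_iff[OF v, symmetric] delta_type_def Let_def by blast
  have 2: "(\<Sum>i<vdegree \<Gamma> v. ?F' $ i) = (\<Sum>x\<in>set (ends \<Gamma> v). F' x)"
  proof -
    have "(\<Sum>i<vdegree \<Gamma> v. ?F' $ i) = (\<Sum>i<vdegree \<Gamma> v. F' (ends \<Gamma> v ! i))"
      by (intro sum.cong) (auto simp: vdegree_def vec_of_list_index)
    then show ?thesis
      using sum.reindex_bij_betw[OF bij_betw_nth[OF dist[OF v] refl refl], of F'] by (simp add: vdegree_def)
  qed
  have 3: "(\<forall>i<vdegree \<Gamma> v. ?F $ i = c) \<longleftrightarrow> (\<forall>x\<in>set (ends \<Gamma> v). F x = c)" for c
    by (simp add: vdegree_def vec_of_list_index all_set_conv_all_nth)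
  show ?thesis using 1 by (simp only: 2 3)
qed

end

section \<open>Gluing\<close>

locale glued_graphs = A: qgraph_form \<Gamma> + B: qgraph_form \<Gamma>'
  for \<Gamma> \<Gamma>' :: "('e, 'v) qgraph" +
  assumes gl: "glued \<Gamma> \<Gamma>'"
begin

text \<open>One edge-end per vertex suffices to state the constraint, because values at a vertex
  agree by continuity. From \<Gamma> to \<Gamma>' the same \<open>F'\<close> serves, since the sums
  of derivatives and the parameters add up; in the other direction only \<open>F\<close> is
  kept.\<close>

lemma glued_bspace:
  "\<exists>a0 a1. B.bspace = {F \<in> A.bspace. F a0 = F a1} \<and>
    (\<forall>F\<in>B.bspace. bform (edges \<Gamma>') B.sel F F = bform (edges \<Gamma>) A.sel F F)"
proof -
  have E: "edges \<Gamma>' = edges \<Gamma>" using gl by (simp add: glued_def)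
  obtain v0 v1 v \<alpha>0 \<alpha>1 where v: "v0 \<in> verts \<Gamma>" "v1 \<in> verts \<Gamma>" "v0 \<noteq> v1"
    and d0: "delta_type \<Gamma> v0 \<alpha>0" and d1: "delta_type \<Gamma> v1 \<alpha>1"
    and vn: "v \<notin> verts \<Gamma> - {v0, v1}" and V': "verts \<Gamma>' = insert v (verts \<Gamma> - {v0, v1})"
    and ends: "set (ends \<Gamma>' v) = set (ends \<Gamma> v0) \<union> set (ends \<Gamma> v1)"
    and d: "delta_type \<Gamma>' v (\<alpha>0 + \<alpha>1)"
    and rest: "\<forall>w \<in> verts \<Gamma> - {v0, v1}. ends \<Gamma>' w = ends \<Gamma> w \<and> cA \<Gamma>' w = cA \<Gamma> w \<and> cB \<Gamma>' w = cB \<Gamma> w"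
    using gl unfolding glued_def by (elim conjE exE) (rule that; assumption)
  let ?S0 = "set (ends \<Gamma> v0)" and ?S1 = "set (ends \<Gamma> v1)"
  have disj01: "?S0 \<inter> ?S1 = {}" using A.disj v by blast
  have ne: "ends \<Gamma> v0 \<noteq> []" "ends \<Gamma> v1 \<noteq> []" using A.qg v by (auto simp: quantum_graph_def)
  define a0 where "a0 = hd (ends \<Gamma> v0)"
  define a1 where "a1 = hd (ends \<Gamma> v1)"
  have a: "a0 \<in> ?S0" "a1 \<in> ?S1" using ne by (auto simp: a0_def a1_def)
  have vB: "v \<in> verts \<Gamma>'" using V' by simp
  have restc: "B.cond_at w F F' \<longleftrightarrow> A.cond_at w F F'" if "w \<in> verts \<Gamma> - {v0, v1}" for w F F'
    using bspec[OF rest that] by (simp add: A.cond_at_def B.cond_at_def)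
  have Bc: "B.cond F F' \<longleftrightarrow> (\<forall>w\<in>verts \<Gamma> - {v0, v1}. A.cond_at w F F') \<and> B.cond_at v F F'" for F F'
    unfolding B.cond_def by (subst V') (use restc in auto)
  have Ac: "A.cond F F' \<longleftrightarrow> (\<forall>w\<in>verts \<Gamma> - {v0, v1}. A.cond_at w F F') \<and> A.cond_at v0 F F' \<and> A.cond_at v1 F F'" for F F'
    using v by (auto simp: A.cond_def)
  note c0 = A.cond_at_delta[OF v(1) d0] and c1 = A.cond_at_delta[OF v(2) d1] and cv = B.cond_at_delta[OF vB d, unfolded ends]
  have sumU: "(\<Sum>x\<in>?S0 \<union> ?S1. F' x) = (\<Sum>x\<in>?S0. F' x) + (\<Sum>x\<in>?S1. F' x)" for F' :: "'e \<times> bool \<Rightarrow> complex"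
    using disj01 by (simp add: sum.union_disjoint)
  have AB: "B.cond F F'" if AF: "A.cond F F'" and eq: "F a0 = F a1" for F F'
  proof -
    obtain c where c: "\<forall>x\<in>?S0. F x = c" "(\<Sum>x\<in>?S0. F' x) = of_real \<alpha>0 * c" using AF unfolding Ac c0 by blast
    obtain c' where c': "\<forall>x\<in>?S1. F x = c'" "(\<Sum>x\<in>?S1. F' x) = of_real \<alpha>1 * c'" using AF unfolding Ac c1 by blast
    have "c' = c" using c(1) c'(1) a eq by simp
    then have "B.cond_at v F F'"
      unfolding cv sumU using c c' by (intro exI[of _ c]) (auto simp: distrib_right)
    then show ?thesis using AF unfolding Ac Bc by blast
  qed
  have BA: "\<exists>F''. A.cond F F'' \<and> F a0 = F a1" if BF: "B.cond F F'" for F F'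
  proof -
    obtain c where c: "\<forall>x\<in>?S0 \<union> ?S1. F x = c" using BF unfolding Bc cv by blast
    \<comment> \<open>The glued condition prescribes only the total of \<open>F'\<close>, which may
      be split wrongly between the two vertices. The required sums are placed on the single ends
      \<open>a0\<close> and \<open>a1\<close>.\<close>
    define F'' where "F'' = (\<lambda>x. if x \<in> ?S0 then (if x = a0 then of_real \<alpha>0 * c else 0)
      else if x \<in> ?S1 then (if x = a1 then of_real \<alpha>1 * c else 0) else F' x)"
    have "A.cond_at w F F''" if w: "w \<in> verts \<Gamma> - {v0, v1}" for w
    proof -
      have "F'' (ends \<Gamma> w ! j) = F' (ends \<Gamma> w ! j)" if "j < A.d w" for j
      proof -
        have "ends \<Gamma> w ! j \<in> set (ends \<Gamma> w)" using that by simp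
        moreover have "set (ends \<Gamma> w) \<inter> ?S0 = {}" "set (ends \<Gamma> w) \<inter> ?S1 = {}" using A.disj w v by auto
        ultimately show ?thesis by (auto simp: F''_def)
      qed
      moreover have "A.cond_at w F F'" using BF w unfolding Bc by blast
      ultimately show ?thesis by (simp add: A.cond_at_def)
    qed
    moreover have "A.cond_at v0 F F''"
    proof -
      have "(\<Sum>x\<in>?S0. F'' x) = (\<Sum>x\<in>?S0. if x = a0 then of_real \<alpha>0 * c else 0)"
        by (intro sum.cong) (auto simp: F''_def)
      also have "\<dots> = of_real \<alpha>0 * c" using a by simp
      finally show ?thesis unfolding c0 using c by blast
    qed
    moreover have "A.cond_at v1 F F''"
    proof -
      have "(\<Sum>x\<in>?S1. F'' x) = (\<Sum>x\<in>?S1. if x = a1 then of_real \<alpha>1 * c else 0)"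
        using disj01 by (intro sum.cong) (auto simp: F''_def)
      also have "\<dots> = of_real \<alpha>1 * c" using a by simp
      finally show ?thesis unfolding c1 using c by blast
    qed
    ultimately have "A.cond F F''" unfolding Ac by blast
    moreover have "F a0 = F a1" using c a by simp
    ultimately show ?thesis by blast
  qed
  have eq: "B.bspace = {F \<in> A.bspace. F a0 = F a1}"
  proof (intro Set.set_eqI iffI)
    fix F assume "F \<in> B.bspace"
    then obtain F' where "\<forall>x. fst x \<notin> edges \<Gamma> \<longrightarrow> F x = 0" "B.cond F F'"
      unfolding B.bspace_def unfolding E by blast
    then show "F \<in> {F \<in> A.bspace. F a0 = F a1}" using BA unfolding A.bspace_def by blast
  next
    fix F assume "F \<in> {F \<in> A.bspace. F a0 = F a1}"
    then obtain F' where "\<forall>x. fst x \<notin> edges \<Gamma> \<longrightarrow> F x = 0" "A.cond F F'" "F a0 = F a1" unfolding A.bspace_def by blast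
    then show "F \<in> B.bspace" using AB unfolding B.bspace_def unfolding E by blast
  qed
  have "bform (edges \<Gamma>') B.sel F F = bform (edges \<Gamma>) A.sel F F" if F: "F \<in> B.bspace" for F
  proof -
    have FA: "F \<in> A.bspace" "F a0 = F a1" using F eq by auto
    obtain F' where F': "A.cond F F'" using FA(1) by (auto simp: A.bspace_def)
    \<comment> \<open>By \<open>bform_eq\<close> any admissible derivative data compute a boundary
      form, and \<open>AB\<close> makes the same \<open>F'\<close> admissible on both
      graphs.\<close>
    show ?thesis
      unfolding A.bform_eq[OF FA(1) FA(1) F'] B.bform_eq[OF F F AB[OF F' FA(2)]] by (simp add: E)
  qed
  then show ?thesis using eq by blast
qed

lemma glued_interlacing:
  assumes n: "1 \<le> n"
  shows "eigval \<Gamma> n \<le> eigval \<Gamma>' n \<and> eigval \<Gamma>' n \<le> eigval \<Gamma> (n + 1)"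
proof -
  have E: "edges \<Gamma>' = edges \<Gamma>" "len \<Gamma>' = len \<Gamma>" "pot \<Gamma>' = pot \<Gamma>" using gl by (auto simp: glued_def)
  obtain a0 a1 where bs: "B.bspace = {F \<in> A.bspace. F a0 = F a1}"
    and bf: "\<And>F. F \<in> B.bspace \<Longrightarrow> bform (edges \<Gamma>') B.sel F F = bform (edges \<Gamma>) A.sel F F"
    using glued_bspace by blast
  obtain \<phi> s where sp: "spectral_seq A.Q A.ip A.hf \<phi> s" using A.spectral_seq_exists by blast
  obtain \<phi>' s' where sp': "spectral_seq B.Q B.ip B.hf \<phi>' s'" using B.spectral_seq_exists by blast
  \<comment> \<open>The single linear constraint \<open>f(v0) = f(v1)\<close>, read off at one
    edge-end of each vertex.\<close>
  define ell where "ell = (\<lambda>f. A.tr f a0 - A.tr f a1)"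
  have ip: "B.ip = A.ip" by (simp add: E)
  have Q: "B.Q = {f \<in> A.Q. ell f = 0}" unfolding bs unfolding h1_space_def E ell_def by auto
  have h: "B.hf f f = A.hf f f" if "f \<in> B.Q" for f
    using bf[OF B.QD(3)[OF that]] by (simp add: graph_form_def E)
  have lin: "ell (\<Sum>j\<le>n. fscale (a j) (\<psi> j)) = (\<Sum>j\<le>n. ell (\<psi> j) * a j)" for a \<psi> and n :: nat
  proof -
    have "A.tr (\<Sum>j\<le>n. fscale (a j) (\<psi> j)) x = (\<Sum>j\<le>n. a j * A.tr (\<psi> j) x)" for x
      by (auto simp: etrace_def sum_fun_apply2 fscale_def)
    then show ?thesis by (simp add: ell_def sum_subtractf[symmetric] algebra_simps)
  qed
  obtain m where m: "n = Suc m" using n by (cases n) auto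
  have "s m \<le> s' m"
    by (rule spectral_seq_le_subspace[OF A.form_space_axioms B.form_space_axioms[unfolded ip] _ h sp sp'[unfolded ip]])
       (auto simp: Q)
  moreover have "s' m \<le> s (Suc m)"
    by (rule spectral_seq_le_codim_1[OF A.form_space_axioms B.form_space_axioms[unfolded ip] Q h lin sp sp'[unfolded ip]])
  ultimately show ?thesis
    unfolding m using A.eigval_spectral_seq[OF sp] B.eigval_spectral_seq[OF sp'] by simp
qed

end

theorem theorem5p4:
  fixes \<Gamma> \<Gamma>' :: "('e, 'v) qgraph" and k n :: nat
  assumes "quantum_graph \<Gamma>"
    and "(glued ^^ k) \<Gamma> \<Gamma>'"
    and "n \<ge> 1"
  shows "eigval \<Gamma> n \<le> eigval \<Gamma>' n \<and> eigval \<Gamma>' n \<le> eigval \<Gamma> (n + k)"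
  using assms(2,3)
proof (induction k arbitrary: \<Gamma>' n)
  case 0
  then show ?case by simp
next
  case (Suc k)
  then obtain \<Delta> where \<Delta>: "(glued ^^ k) \<Gamma> \<Delta>" and gl: "glued \<Delta> \<Gamma>'" by auto
  interpret glued_graphs \<Delta> \<Gamma>' by unfold_locales (use gl in \<open>simp_all add: glued_def\<close>)
  \<comment> \<open>The last gluing raises the index by one in the upper bound, so the induction
    hypothesis is used at \<open>n\<close> for the lower and at \<open>n + 1\<close> for the upper
    bound.\<close>
  have "eigval \<Gamma> n \<le> eigval \<Delta> n" "eigval \<Delta> (n + 1) \<le> eigval \<Gamma> (n + 1 + k)"
    using Suc.IH[OF \<Delta>, of n] Suc.IH[OF \<Delta>, of "n + 1"] Suc.prems(2) by auto
  then show ?case using glued_interlacing[OF Suc.prems(2)] by simp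
qed

end
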